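(* Let $\beta\in\{1,2\}$ and $0<d<1$ be fixed. For each $n$ let $W=W_{n,\beta,d}$ be the $\beta$-Wishart matrix and let $\mathbf b=\mathbf b^{(n)}$ be a (possibly random) vector with $\|\mathbf b\|_2=1$, independent of $W$. Let $t_\epsilon^{(1)},t_\epsilon^{(2)}$ be the halting times of the conjugate gradient algorithm (with $\mathbf x_0=\mathbf 0$) applied to $W\mathbf x=\mathbf b$. Let $\ell\in\{1,2\}$ and let $\epsilon>0$ be fixed. (i) If $\epsilon\ne\mathfrak e_{\ell,k,d}$ for all $k=0,1,2,\dots$ and $\epsilon<\mathfrak e_{\ell,0,d}$ (that is, $\epsilon^2<(1-d)^{-1}$ if $\ell=1$ and $\epsilon<1$ if $\ell=2$), then $$\lim_{n\to\infty}\mathbb P\left(t_\epsilon^{(\ell)}(W_{n,\beta,d},\mathbf b)=\tau_\epsilon^{(\ell)}(\beta,d)\right)=1.$$ (ii) If $\epsilon=\mathfrak e_{\ell,k,d}$ for some $k>0$ (i.e. $k=\tau_\epsilon^{(\ell)}(\beta,d)$), then $$\lim_{n\to\infty}\mathbb P\left(t_\epsilon^{(\ell)}(W_{n,\beta,d},\mathbf b)=\tau_\epsilon^{(\ell)}(\beta,d)\ \text{ or }\ t_\epsilon^{(\ell)}(W_{n,\beta,d},\mathbf b)=\tau_\epsilon^{(\ell)}(\beta,d)+1\right)=1.$$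
   Context: Wishart matrices: for $\beta\in\{1,2\}$, $0<d<1$, $n\ge1$, put $m=\lfloor n/d\rfloor$. Let $X$ be an $n\times m$ matrix of iid real standard normal variables if $\beta=1$, and $X=X_1+\mathrm i X_2$ with $X_1,X_2$ independent $n\times m$ matrices of iid real standard normals if $\beta=2$. Then $W_{n,\beta,d}=\frac1{\beta m}XX^*$ (positive definite almost surely). The vectors $\mathbf b$ are in $\mathbb R^n$ if $\beta=1$ and in $\mathbb C^n$ if $\beta=2$. Conjugate gradient algorithm for $W\mathbf x=\mathbf b$, $W>0$, with $\mathbf x_0=\mathbf 0$, in exact arithmetic: $\mathbf x_k$ is the unique minimizer of $\|\mathbf y-\mathbf x\|_W$ over $\mathbf y\in\mathrm{span}\{\mathbf b,W\mathbf b,\dots,W^{k-1}\mathbf b\}$, where $\|\mathbf y\|_W^2=\mathbf y^*W\mathbf y$. Error $\mathbf e_k=\mathbf x-\mathbf x_k$, residual $\mathbf r_k=\mathbf b-W\mathbf x_k$, $k=0,1,2,\dots$. Halting times: $t_\epsilon^{(1)}(W,\mathbf b)=\min\{k:\|\mathbf e_k\|_W<\epsilon\}$, $t_\epsilon^{(2)}(W,\mathbf b)=\min\{k:\|\mathbf r_k\|_2<\epsilon\}$. Candidate limits: $\tau_\epsilon^{(1)}(\beta,d)=\left\lceil\frac{2\log\epsilon+\log(1-d)}{\log d}\right\rceil$ for $\epsilon^2<(1-d)^{-1}$, and $\tau_\epsilon^{(2)}(\beta,d)=\left\lceil\frac{2\log\epsilon}{\log d}\right\rceil$ for $\epsilon<1$.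 $\mathfrak e_{\ell,k,d}\ge0$ is defined by $\mathfrak e_{\ell,k,d}^2=\int\lambda^{\ell-2}\det(\mathbb T_{k,d}-\lambda I)^2\mu_{\mathrm{MP},d}(\mathrm d\lambda)$ (with the determinant equal to $1$ when $k=0$), where $\mu_{\mathrm{MP},d}$ is the probability measure with density $\frac1{2\pi d}\frac{\sqrt{|(d_+-x)(x-d_-)|}}{x}\mathbf 1_{[d_-,d_+]}(x)$, $d_\pm=(1\pm\sqrt d)^2$, and $\mathbb T_{k,d}$ is the upper-left $k\times k$ block of $\mathbb H_d\mathbb H_d^*$, $\mathbb H_d$ being the infinite lower bidiagonal matrix with diagonal entries $1$ and first-subdiagonal entries $\sqrt d$. *)

theory Defs
  imports
    "HOL-Probability.Probability"
    "Jordan_Normal_Form.Schur_Decomposition"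
begin

unbundle no vec_syntax

(* Both symmetry classes are treated with complex matrices and vectors; for beta = 1 all
   entries and all coefficients are restricted to the real subfield of the complex numbers. *)
definition scalars :: "nat \<Rightarrow> complex set" where
  "scalars \<beta> = (if \<beta> = 1 then \<real> else UNIV)"

(* For beta = 2 the real and imaginary parts of the entries are the entries of X1 and X2;
   the index p selects the real (p = 0) or imaginary (p = 1) part. *)
definition std_gaussian_matrix ::
  "'a measure \<Rightarrow> nat \<Rightarrow> nat \<Rightarrow> nat \<Rightarrow> ('a \<Rightarrow> complex Matrix.mat) \<Rightarrow> bool" where
  "std_gaussian_matrix M \<beta> n m X \<longleftrightarrow>
     (let I = {..<\<beta>} \<times> {..<n} \<times> {..<m};
          entry = (\<lambda>(p::nat, i, j) \<omega>. if p = 0 then Re (X \<omega> $$ (i, j)) else Im (X \<omega> $$ (i, j)))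
      in (\<forall>\<omega>\<in>space M. X \<omega> \<in> carrier_mat n m \<and> elements_mat (X \<omega>) \<subseteq> scalars \<beta>) \<and>
         prob_space.indep_vars M (\<lambda>_. borel) entry I \<and>
         (\<forall>q\<in>I. distributed M lborel (entry q) std_normal_density))"

definition wishart_cols :: "real \<Rightarrow> nat \<Rightarrow> nat" where
  "wishart_cols d n = nat \<lfloor>real n / d\<rfloor>"

definition wishart :: "nat \<Rightarrow> nat \<Rightarrow> complex Matrix.mat \<Rightarrow> complex Matrix.mat" where
  "wishart \<beta> m X = complex_of_real (1 / (real \<beta> * real m)) \<cdot>\<^sub>m (X * mat_adjoint X)"

(* indep_var requires both variables to have the same codomain, so independence is expressed
   through the generated sigma-algebras. *)
definition indep_rvs ::
  "'a measure \<Rightarrow> 'b measure \<Rightarrow> ('a \<Rightarrow> 'b) \<Rightarrow> 'c measure \<Rightarrow> ('a \<Rightarrow> 'c) \<Rightarrow> bool" where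
  "indep_rvs M N\<^sub>1 X N\<^sub>2 Y \<longleftrightarrow>
     X \<in> measurable M N\<^sub>1 \<and> Y \<in> measurable M N\<^sub>2 \<and>
     prob_space.indep_set M (sets (vimage_algebra (space M) X N\<^sub>1))
                            (sets (vimage_algebra (space M) Y N\<^sub>2))"

(* The Borel structure on matrices and vectors is the entrywise one. *)
definition indep_mat_vec ::
  "'a measure \<Rightarrow> nat \<Rightarrow> ('a \<Rightarrow> complex Matrix.mat) \<Rightarrow> ('a \<Rightarrow> complex Matrix.vec) \<Rightarrow> bool" where
  "indep_mat_vec M n W b \<longleftrightarrow>
     indep_rvs M
       (PiM ({..<n} \<times> {..<n}) (\<lambda>_. borel)) (\<lambda>\<omega>. restrict (\<lambda>ij. W \<omega> $$ ij) ({..<n} \<times> {..<n}))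
       (PiM {..<n} (\<lambda>_. borel)) (\<lambda>\<omega>. restrict (\<lambda>i. b \<omega> $ i) {..<n})"

definition norm2 :: "complex Matrix.vec \<Rightarrow> real" where
  "norm2 v = L2_set (\<lambda>i. cmod (v $ i)) {..<dim_vec v}"

definition energy_norm :: "complex Matrix.mat \<Rightarrow> complex Matrix.vec \<Rightarrow> real" where
  "energy_norm W y = sqrt (Re ((W *\<^sub>v y) \<bullet>c y))"

definition positive_definite :: "complex Matrix.mat \<Rightarrow> bool" where
  "positive_definite W \<longleftrightarrow>
     square_mat W \<and> mat_adjoint W = W \<and>
     (\<forall>v\<in>carrier_vec (dim_row W). v \<noteq> 0\<^sub>v (dim_row W) \<longrightarrow> 0 < Re ((W *\<^sub>v v) \<bullet>c v))"

definition krylov ::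
  "complex set \<Rightarrow> complex Matrix.mat \<Rightarrow> complex Matrix.vec \<Rightarrow> nat \<Rightarrow> complex Matrix.vec set" where
  "krylov K W b k =
     {Matrix.vec (dim_vec b) (\<lambda>i. \<Sum>j<k. c j * ((W ^\<^sub>m j) *\<^sub>v b) $ i) |c. \<forall>j<k. c j \<in> K}"

definition solution :: "complex Matrix.mat \<Rightarrow> complex Matrix.vec \<Rightarrow> complex Matrix.vec" where
  "solution W b = (THE x. x \<in> carrier_vec (dim_col W) \<and> W *\<^sub>v x = b)"

definition cg_iterate ::
  "complex set \<Rightarrow> complex Matrix.mat \<Rightarrow> complex Matrix.vec \<Rightarrow> nat \<Rightarrow> complex Matrix.vec" where
  "cg_iterate K W b k =
     (THE y. is_arg_min (\<lambda>y. energy_norm W (y - solution W b)) (\<lambda>y. y \<in> krylov K W b k) y)"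

definition cg_error ::
  "complex set \<Rightarrow> complex Matrix.mat \<Rightarrow> complex Matrix.vec \<Rightarrow> nat \<Rightarrow> complex Matrix.vec" where
  "cg_error K W b k = solution W b - cg_iterate K W b k"

definition cg_residual ::
  "complex set \<Rightarrow> complex Matrix.mat \<Rightarrow> complex Matrix.vec \<Rightarrow> nat \<Rightarrow> complex Matrix.vec" where
  "cg_residual K W b k = b - W *\<^sub>v cg_iterate K W b k"

(* The conjugate gradient algorithm is only defined for positive definite W. The value 0
   otherwise is a convention on a null event of the Wishart ensemble; it keeps the events
   in terms of the halting time measurable there. *)
definition halting_time ::
  "nat \<Rightarrow> complex set \<Rightarrow> real \<Rightarrow> complex Matrix.mat \<Rightarrow> complex Matrix.vec \<Rightarrow> nat" where
  "halting_time l K \<epsilon> W b =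
     (if positive_definite W then
        LEAST k. (if l = 1 then energy_norm W (cg_error K W b k)
                  else norm2 (cg_residual K W b k)) < \<epsilon>
      else 0)"

(* The candidate limits do not depend on beta. *)
definition limit_time :: "nat \<Rightarrow> real \<Rightarrow> real \<Rightarrow> int" where
  "limit_time l \<epsilon> d =
     (if l = 1 then \<lceil>(2 * ln \<epsilon> + ln (1 - d)) / ln d\<rceil> else \<lceil>2 * ln \<epsilon> / ln d\<rceil>)"

definition marchenko_pastur :: "real \<Rightarrow> real measure" where
  "marchenko_pastur d =
     (let dm = (1 - sqrt d)\<^sup>2; dp = (1 + sqrt d)\<^sup>2
      in density lborel (\<lambda>x. ennreal
           (1 / (2 * pi * d) * (sqrt \<bar>(dp - x) * (x - dm)\<bar> / x) * indicator {dm..dp} x)))"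

definition bidiag :: "real \<Rightarrow> nat \<Rightarrow> nat \<Rightarrow> real" where
  "bidiag d i j = (if i = j then 1 else if i = Suc j then sqrt d else 0)"

(* Each row of the infinite matrix bidiag d has at most two nonzero entries, so the series
   giving the entries of its product with its adjoint are finite sums. *)
definition jacobi_block :: "real \<Rightarrow> nat \<Rightarrow> real Matrix.mat" where
  "jacobi_block d k = Matrix.mat k k (\<lambda>(i, j). \<Sum>l. bidiag d i l * bidiag d j l)"

definition limit_error :: "nat \<Rightarrow> nat \<Rightarrow> real \<Rightarrow> real" where
  "limit_error l k d =
     sqrt (LINT x|marchenko_pastur d.
       x powi (int l - 2) * (Determinant.det (jacobi_block d k - x \<cdot>\<^sub>m 1\<^sub>m k))\<^sup>2)"

end

theory Submission
  imports Defs "HOL-Complex_Analysis.Cauchy_Integral_Theorem"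
begin

unbundle no vec_syntax

text \<open>By unitary invariance of the Gaussian law, \<open>b\<close> may be replaced by the first unit vector. Conditionally on
  the first row of \<open>X\<close>, a rotation of the columns turns that row into \<open>(a, 0, \<dots>, 0)\<close>, where \<open>a\<close> is its norm; the
  remaining rows consist of a Gaussian column \<open>y\<close> and an independent Gaussian matrix \<open>Z\<close>. The first conjugate
  gradient step then leaves the system with matrix \<open>Z Z\<^sup>*\<close> and right-hand side \<open>y\<close>, up to the factor \<open>1 / a\<close>.
  Hence every step multiplies the error by a quotient \<open>|y| / a\<close> of independent chi variables, which tends to
  \<open>sqrt d\<close>. The initial residual is \<open>1\<close>, and the initial energy is the inverse of a scaled chi-squared variable
  with about \<open>\<beta> (m - n)\<close> degrees of freedom, which gives \<open>1 / (1 - d)\<close>. The limits are the values of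
  \<open>limit_error\<close> because the substitution \<open>x = 1 + d - 2 sqrt d cos t\<close> turns the determinants into trigonometric
  polynomials.\<close>

section \<open>The limiting errors\<close>

text \<open>Each reduction lowers both \<open>n\<close> and \<open>m\<close> by one, so the limit at
  step \<open>k\<close> cannot be proved for \<open>wishart_cols\<close> alone; it is proved for
  every pair of sequences tending to infinity with ratio tending to \<open>d\<close>. As every
  probability in question tends to 1, lower bounds suffice: conditioning becomes a product bound on
  sections. Definiteness of the matrix is part of each event, so its asymptotic certainty comes from
  the same bounds. The iterates are defined by definite descriptions and minimisation; an explicit
  error built from Cramer's rule and Gram--Schmidt gives measurability, and Galerkin orthogonality
  identifies it with the defined one. The halting time is read off from finitely many steps at which
  the limit differs from \<epsilon>. If \<open>\<epsilon> = limit_error l k d\<close>, the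
  comparison at step \<open>k\<close> stays undecided, which is the source of the two
  values.\<close>

lemma jacobi_entry_0: "(\<Sum>l. bidiag d 0 l * bidiag d j l) = bidiag d j 0"
  by (subst suminf_finite[of "{0}"]) (auto simp: bidiag_def)

lemma jacobi_entry_Suc:
  "(\<Sum>l. bidiag d (Suc i) l * bidiag d j l) = bidiag d j (Suc i) + sqrt d * bidiag d j i"
  by (subst suminf_finite[of "{i, Suc i}"]) (auto simp: bidiag_def)

section \<open>Characteristic polynomials of the Jacobi blocks\<close>

definition jacobi_det :: "real \<Rightarrow> nat \<Rightarrow> real \<Rightarrow> real" where
  "jacobi_det d k x = Determinant.det (jacobi_block d k - x \<cdot>\<^sub>m 1\<^sub>m k)"

lemma jacobi_det_0: "jacobi_det d 0 x = 1"
  unfolding jacobi_det_def by (rule det_dim_zero) (simp add: jacobi_block_def carrier_matI)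

lemma jacobi_det_1: "jacobi_det d (Suc 0) x = 1 - x"
proof -
  let ?A = "jacobi_block d (Suc 0) - x \<cdot>\<^sub>m 1\<^sub>m (Suc 0)"
  have "?A \<in> carrier_mat 1 1" by (simp add: jacobi_block_def carrier_matI)
  then have "Determinant.det ?A = ?A $$ (0,0)" by (rule det_single)
  then show ?thesis
    by (simp add: jacobi_det_def jacobi_block_def jacobi_entry_0) (simp add: bidiag_def)
qed

text \<open>The block is tridiagonal. Expansion along the last row leaves two minors, and the
  off-diagonal one has a single nonzero entry in its last column, which produces the second factor
  \<open>sqrt d\<close>. The diagonal entry is \<open>1 + d\<close> from the second row on but 1 in
  the first, so the recurrence starts from degrees 0 and 1.\<close>

lemma jacobi_det_Suc_Suc:
  assumes "0 \<le> d"
  shows "jacobi_det d (Suc (Suc k)) x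
           = (1 + d - x) * jacobi_det d (Suc k) x - d * jacobi_det d k x"
proof -
  define T where "T n = jacobi_block d n - x \<cdot>\<^sub>m 1\<^sub>m n" for n
  define t where "t i j = (\<Sum>l. bidiag d i l * bidiag d j l) - (if i = j then x else 0)" for i j
  have dim [simp]: "dim_row (T n) = n" "dim_col (T n) = n" for n
    by (simp_all add: T_def jacobi_block_def)
  have Tc: "T n \<in> carrier_mat n n" for n by (simp add: carrier_matI)
  have T_entry: "T n $$ (i, j) = t i j" if "i < n" "j < n" for n i j
    using that by (auto simp: T_def jacobi_block_def t_def)
  have t1: "t (Suc k) (Suc k) = 1 + d - x" "t (Suc k) k = sqrt d" "t k (Suc k) = sqrt d"
    using assms by (cases k; simp add: t_def jacobi_entry_Suc jacobi_entry_0; simp add: bidiag_def)+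
  have t0: "t (Suc k) j = 0" "t j (Suc k) = 0" if "j < k" for j
    using that by (cases j; simp add: t_def jacobi_entry_Suc jacobi_entry_0; simp add: bidiag_def)+
  let ?A = "T (Suc (Suc k))"
  have del1: "mat_delete ?A (Suc k) (Suc k) = T (Suc k)"
    by (rule eq_matI) (auto simp: mat_delete_def T_entry)
  define B where "B = mat_delete ?A (Suc k) k"
  have Bc: "B \<in> carrier_mat (Suc k) (Suc k)"
    by (auto simp: B_def mat_delete_def)
  have B_last: "B $$ (i, k) = t i (Suc k)" if "i < Suc k" for i
    using that by (auto simp: B_def mat_delete_def T_entry)
  have del2: "mat_delete B k k = T k"
    by (rule eq_matI) (auto simp: B_def mat_delete_def T_entry)
  have "Determinant.det B = (\<Sum>i<Suc k. B $$ (i, k) * cofactor B i k)"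
    by (rule laplace_expansion_column[OF Bc]) simp
  also have "\<dots> = sqrt d * Determinant.det (T k)"
    by (simp add: B_last t0 t1 cofactor_def del2)
  finally have detB: "Determinant.det B = sqrt d * Determinant.det (T k)" .
  have "Determinant.det ?A = (\<Sum>j<Suc (Suc k). ?A $$ (Suc k, j) * cofactor ?A (Suc k) j)"
    by (rule laplace_expansion_row[OF Tc]) simp
  also have "\<dots> = sqrt d * (- Determinant.det B) + (1 + d - x) * Determinant.det (T (Suc k))"
    by (simp add: T_entry t0 t1 cofactor_def del1 B_def)
  also have "\<dots> = (1 + d - x) * Determinant.det (T (Suc k)) - d * Determinant.det (T k)"
    using assms by (simp add: detB)
  finally show ?thesis by (simp add: jacobi_det_def T_def)
qed

lemma continuous_jacobi_det: "0 \<le> d \<Longrightarrow> continuous_on S (jacobi_det d k)"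
proof (induction k rule: induct_nat_012)
  case 0
  have "jacobi_det d 0 = (\<lambda>x. 1)" by (simp add: jacobi_det_0 fun_eq_iff)
  then show ?case by simp
next
  case 1
  have "jacobi_det d (Suc 0) = (\<lambda>x. 1 - x)" by (simp add: jacobi_det_1 fun_eq_iff)
  then show ?case by (auto intro!: continuous_intros)
next
  case (ge2 k)
  have "jacobi_det d (Suc (Suc k)) = (\<lambda>x. (1 + d - x) * jacobi_det d (Suc k) x - d * jacobi_det d k x)"
    using ge2 by (simp add: jacobi_det_Suc_Suc fun_eq_iff)
  then show ?case using ge2 by (auto intro!: continuous_intros)
qed

text \<open>Chebyshev polynomials of the second kind in the variable \<open>cos t\<close>, multiplied by \<open>sin t\<close>.\<close>

lemma jacobi_det_chebyshev:
  assumes "0 \<le> d"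
  shows "jacobi_det d k (1 + d - 2 * sqrt d * cos t) * sin t
           = sqrt d ^ k * (sin (real (Suc k) * t) - sqrt d * sin (real k * t))"
  using assms
proof (induction k rule: induct_nat_012)
  case 0
  then show ?case by (simp add: jacobi_det_0)
next
  case 1
  then show ?case
    using sin_double[of t] by (simp add: jacobi_det_1 algebra_simps)
next
  case (ge2 k)
  have rec: "sin (real (Suc (Suc j)) * t) = 2 * cos t * sin (real (Suc j) * t) - sin (real j * t)" for j
  proof -
    have e: "real (Suc (Suc j)) * t = real (Suc j) * t + t" "real j * t = real (Suc j) * t - t"
      by (simp_all add: algebra_simps)
    show ?thesis unfolding e sin_add sin_diff by simp
  qed
  have sq: "sqrt d * (sqrt d * y) = d * y" for y
    using ge2.prems by (simp flip: mult.assoc)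
  let ?x = "1 + d - 2 * sqrt d * cos t"
  have "jacobi_det d (Suc (Suc k)) ?x * sin t
      = 2 * sqrt d * cos t * (jacobi_det d (Suc k) ?x * sin t) - d * (jacobi_det d k ?x * sin t)"
    using ge2.prems by (simp add: jacobi_det_Suc_Suc algebra_simps)
  also have "\<dots> = sqrt d ^ Suc (Suc k) * (sin (real (Suc (Suc (Suc k))) * t)
                 - sqrt d * sin (real (Suc (Suc k)) * t))"
    unfolding ge2.IH(1)[OF ge2.prems] ge2.IH(2)[OF ge2.prems] rec[of "Suc k"] rec[of k]
    by (simp add: algebra_simps sq)
  finally show ?case .
qed

section \<open>Half-circle integrals and the Marchenko-Pastur law\<close>

text \<open>The integral of \<open>Re (z * q z)\<close> over the upper half circle vanishes: with a
  primitive \<open>G\<close> of \<open>q\<close> it is the increment of \<open>Im G\<close> from 1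
  to -1, and \<open>Im G\<close> is constant on the real segment because \<open>q\<close> is real
  there. The half circle is what the substitution for the Marchenko-Pastur law produces.\<close>

lemma circle_primitive:
  assumes R: "1 < R" and hol: "q holomorphic_on ball 0 R"
    and real: "\<And>x::real. \<bar>x\<bar> < R \<Longrightarrow> Im (q (of_real x)) = 0"
  obtains \<Phi> where "\<And>t. (\<Phi> has_real_derivative Re (cis t * q (cis t))) (at t)" "\<Phi> pi = \<Phi> 0"
proof -
  obtain G where G: "\<And>z. z \<in> ball 0 R \<Longrightarrow> (G has_field_derivative q z) (at z within ball 0 R)"
    using holomorphic_convex_primitive'[OF convex_ball open_ball hol] by blast
  then have G: "(G has_field_derivative q z) (at z)" if "cmod z < R" for z
    using that at_within_open[of z "ball 0 R"] by force
  have dG: "((\<lambda>t. Im (G (g t))) has_real_derivative Im (g' * q (g t))) (at t within S)"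
    if "(g has_vector_derivative g') (at t within S)" "cmod (g t) < R" for g g' t S
  proof -
    have "(G \<circ> g has_vector_derivative g' * q (g t)) (at t within S)"
      by (rule field_vector_diff_chain_within[OF that(1)])
         (rule has_field_derivative_at_within[OF G[OF that(2)]])
    then show ?thesis
      by (auto dest: has_field_derivative_Im simp: o_def)
  qed
  show ?thesis
  proof
    fix t :: real
    have "((\<lambda>t. exp (\<i> * of_real t)) has_vector_derivative (\<i> * cis t)) (at t)"
      unfolding cis_conv_exp by (auto intro!: derivative_eq_intros)
    then have "(cis has_vector_derivative (\<i> * cis t)) (at t)"
      by (simp add: cis_conv_exp[abs_def])
    then have "((\<lambda>t. Im (G (cis t))) has_real_derivative Im (\<i> * cis t * q (cis t))) (at t)"
      using R by (intro dG) auto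
    moreover have "Im (\<i> * cis t * q (cis t)) = Re (cis t * q (cis t))" by simp
    ultimately show "((\<lambda>t. Im (G (cis t))) has_real_derivative Re (cis t * q (cis t))) (at t)"
      by simp
  next
    have "\<exists>c. \<forall>x\<in>{-1..1::real}. Im (G (of_real x)) = c"
    proof (rule has_field_derivative_zero_constant)
      fix x :: real assume x: "x \<in> {-1..1}"
      have "((\<lambda>x. Im (G (of_real x))) has_real_derivative Im (1 * q (of_real x))) (at x within {-1..1})"
        using x R by (intro dG) (auto intro!: derivative_eq_intros)
      moreover have "Im (1 * q (of_real x)) = 0" using real[of x] x R by auto
      ultimately show "((\<lambda>x. Im (G (of_real x))) has_real_derivative 0) (at x within {-1..1})"
        by simp
    qed simp
    then obtain c where c: "\<And>x::real. x \<in> {-1..1} \<Longrightarrow> Im (G (of_real x)) = c" by blast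
    show "Im (G (cis pi)) = Im (G (cis 0))" using c[of 1] c[of "-1"] by simp
  qed
qed


text \<open>The two integrands left by the substitution, the first for residuals and the second for
  energies, are written as a constant plus real parts of \<open>z * q z\<close> with
  \<open>q\<close> holomorphic in the disc of radius \<open>1 / s\<close>;
  \<open>circle_primitive\<close> removes the latter. With \<open>w = z - s\<close> one has
  \<open>x = w * cnj w\<close> and \<open>A = Im (z ^ k * w)\<close>, and the square of an imaginary
  part is half of the squared modulus minus the real part of the square.\<close>

lemma circle_identities:
  fixes s t :: real and k :: nat
  assumes s: "0 < s" "s < 1"
  defines "z \<equiv> cis t" and "x \<equiv> 1 + s\<^sup>2 - 2 * s * cos t"
    and "A \<equiv> sin (real (Suc k) * t) - s * sin (real k * t)"
  shows "A\<^sup>2 / x = 1 / 2 - Re (z * (z ^ (2 * k) * (z - of_real s) / (1 - of_real s * z))) / 2"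
    and "A\<^sup>2 / x\<^sup>2 = (1 + Re (z * (2 * of_real s / (1 - of_real s * z)))) / (2 * (1 - s\<^sup>2))
          - Re (z * (z ^ (2 * k + 1) / (1 - of_real s * z)\<^sup>2)) / 2"
    and "0 < x"
proof -
  define w where "w = z - of_real s"
  have z0: "z \<noteq> 0" "z * cnj z = 1" by (simp_all add: z_def complex_norm_square[symmetric] cis_mult cis_cnj)
  have xw: "of_real x = w * cnj w"
    using sin_cos_squared_add[of t]
    by (simp add: w_def x_def z_def complex_eq_iff power2_eq_square algebra_simps)
  have "s * cos t \<le> s" using s by simp
  then have "1 + s\<^sup>2 - 2 * s \<le> x" by (simp add: x_def)
  moreover have "1 + s\<^sup>2 - 2 * s = (1 - s)\<^sup>2" by (simp add: power2_eq_square algebra_simps)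
  ultimately show x: "0 < x" using s by (smt (verit) zero_less_power)
  have w0: "w \<noteq> 0" "cnj w \<noteq> 0" using xw x by auto
  have cw: "1 - of_real s * z = z * cnj w"
    using z0 by (simp add: w_def algebra_simps)
  have A: "A = Im (z ^ k * w)"
  proof -
    have "z ^ k * w = cis (real (Suc k) * t) - of_real s * cis (real k * t)"
    proof -
      have e: "cis (real (Suc k) * t) = cis (real k * t) * cis t"
        by (simp add: cis_mult algebra_simps)
      show ?thesis unfolding e w_def z_def Complex.DeMoivre 
        by (simp add: right_diff_distrib power_commutes mult.commute[of _ "of_real s"])
    qed
    then show ?thesis by (simp add: A_def)
  qed
  have sq: "(Im v)\<^sup>2 = ((cmod v)\<^sup>2 - Re (v\<^sup>2)) / 2" for v
    by (simp add: cmod_power2 Re_power2)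
  have "complex_of_real ((cmod w)\<^sup>2) = of_real x"
    by (simp only: complex_norm_square xw)
  then have "(cmod (z ^ k * w))\<^sup>2 = x"
    unfolding of_real_eq_iff by (simp add: norm_mult norm_power z_def)
  then have A2: "A\<^sup>2 = (x - Re ((z ^ k * w)\<^sup>2)) / 2" by (simp only: A sq)
  have e1: "z * (z ^ (2 * k) * (z - of_real s) / (1 - of_real s * z)) = (z ^ k * w)\<^sup>2 / of_real x"
    unfolding cw xw w_def[symmetric] using z0 w0
    by (simp add: field_simps power2_eq_square power_mult[symmetric] power_add[symmetric] mult_2 mult_2_right)
  have e2: "z * (z ^ (2 * k + 1) / (1 - of_real s * z)\<^sup>2) = (z ^ k * w)\<^sup>2 / (of_real x)\<^sup>2"
    unfolding cw xw using z0 w0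
    by (simp add: field_simps power2_eq_square power_mult[symmetric] power_add[symmetric] mult_2 mult_2_right)
  \<comment> \<open>The Poisson kernel: \<open>1 + 2 s z / (1 - s z) = (1 + s z) / (1 - s z)\<close>
    has real part \<open>(1 - s\<^sup>2) / x\<close>, which turns the leftover \<open>1 / x\<close>
    in the second identity into a constant plus a harmonic term.\<close>
  have e3: "1 + z * (2 * of_real s / (1 - of_real s * z)) = (cnj z + of_real s) * w / of_real x"
  proof -
    have "1 + z * (2 * of_real s / (1 - of_real s * z)) = (z * cnj w + 2 * of_real s * z) / (z * cnj w)"
      unfolding cw using z0 w0 by (simp add: field_simps)
    also have "\<dots> = (cnj w + 2 * of_real s) / cnj w" using z0 w0 by (simp add: field_simps)
    also have "\<dots> = (cnj z + of_real s) * w / of_real x" unfolding xw using w0 by (simp add: w_def)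
    finally show ?thesis .
  qed
  have "Re ((cnj z + of_real s) * w) = 1 - s\<^sup>2"
    using sin_cos_squared_add[of t] by (simp add: w_def z_def power2_eq_square algebra_simps)
  then have r3: "1 + Re (z * (2 * of_real s / (1 - of_real s * z))) = (1 - s\<^sup>2) / x"
    using arg_cong[OF e3, of Re] by (simp add: Re_divide_of_real)
  show "A\<^sup>2 / x = 1 / 2 - Re (z * (z ^ (2 * k) * (z - of_real s) / (1 - of_real s * z))) / 2"
    unfolding e1 A2 using x by (simp add: Re_divide_of_real field_simps)
  have "1 - s\<^sup>2 \<noteq> 0" using s by (simp add: power2_eq_1_iff)
  moreover have "Re ((z ^ k * w)\<^sup>2 / (of_real x)\<^sup>2) = Re ((z ^ k * w)\<^sup>2) / x\<^sup>2"
    by (metis Re_divide_of_real of_real_power)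
  ultimately show "A\<^sup>2 / x\<^sup>2 = (1 + Re (z * (2 * of_real s / (1 - of_real s * z)))) / (2 * (1 - s\<^sup>2))
          - Re (z * (z ^ (2 * k + 1) / (1 - of_real s * z)\<^sup>2)) / 2"
    unfolding e2 r3 A2 using x by (simp add: field_simps power2_eq_square)
qed

text \<open>With \<open>s = sqrt d\<close> the root in the density becomes
  \<open>2 * s * sin t\<close>, equal to the derivative of the substitution, so the measure turns
  into \<open>2 / pi * (sin t)\<^sup>2 / x\<close> on \<open>[0, pi]\<close>. A primitive is taken
  as input because \<open>circle_primitive\<close> provides primitives known only through their
  derivative and their end values.\<close>

lemma marchenko_pastur_integral:
  assumes d: "0 < d" "d < 1" and h: "h \<in> borel_measurable borel" "continuous_on {0<..} h"
    and \<Psi>: "\<And>t. 0 \<le> t \<Longrightarrow> t \<le> pi \<Longrightarrow> (\<Psi> has_real_derivative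
          (sin t)\<^sup>2 * h (1 + d - 2 * sqrt d * cos t) / (1 + d - 2 * sqrt d * cos t)) (at t)"
  shows "(LINT x|marchenko_pastur d. h x) = 2 / pi * (\<Psi> pi - \<Psi> 0)"
proof -
  define s where "s = sqrt d"
  have s: "0 < s" "s < 1" "s\<^sup>2 = d" using d by (auto simp: s_def)
  define g where "g t = 1 + d - 2 * s * cos t" for t
  have g_ends: "g 0 = (1 - s)\<^sup>2" "g pi = (1 + s)\<^sup>2"
    by (simp_all add: g_def s(3)[symmetric] power2_eq_square algebra_simps)
  define \<rho> where "\<rho> x = 1 / (2 * pi * d) * (sqrt \<bar>((1 + s)\<^sup>2 - x) * (x - (1 - s)\<^sup>2)\<bar> / x)" for x
  have g_pos: "0 < g t" for t
    using circle_identities(3)[OF s(1,2), of t] s(3) by (simp add: g_def)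
  have pos: "0 < x" if "(1 - s)\<^sup>2 \<le> x" for x :: real
    using g_pos[of 0] that unfolding g_ends by linarith
  have [measurable]: "\<rho> \<in> borel_measurable borel" unfolding \<rho>_def by measurable
  note [measurable] = h(1)
  have "(LINT x|marchenko_pastur d. h x)
       = (LBINT x. (\<rho> x * indicator {(1 - s)\<^sup>2..(1 + s)\<^sup>2} x) *\<^sub>R h x)"
    unfolding marchenko_pastur_def Let_def s_def[symmetric] \<rho>_def[symmetric]
    by (subst integral_density)
       (auto split: split_indicator simp: \<rho>_def d(1) less_imp_le[OF pos] intro!: AE_I2 divide_nonneg_nonneg mult_nonneg_nonneg,
        use d in auto)
  also have "\<dots> = (LBINT x. (\<rho> x * h x) * indicator {g 0..g pi} x)"
    unfolding g_ends by (intro Bochner_Integration.integral_cong) (auto split: split_indicator)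
  also have "\<dots> = (LBINT t. (\<rho> (g t) * h (g t)) * (2 * s * sin t) * indicator {0..pi} t)"
  proof (rule integral_substitution)
    show "set_integrable lborel {g 0..g pi} (\<lambda>x. \<rho> x * h x)"
    proof (rule borel_integrable_atLeastAtMost')
      show "continuous_on {g 0..g pi} (\<lambda>x. \<rho> x * h x)"
        unfolding \<rho>_def
        by (intro continuous_intros continuous_on_subset[OF h(2)]) (use s in \<open>auto simp: g_ends dest!: pos\<close>)
    qed
    show "(g has_real_derivative 2 * s * sin t) (at t)" for t
      unfolding g_def by (auto intro!: derivative_eq_intros)
    show "0 \<le> 2 * s * sin t" if "t \<in> {0..pi}" for t using that s by (simp add: sin_ge_zero)
  qed (auto intro!: continuous_intros)
  also have "\<dots> = (LBINT t. indicator {0..pi} t *\<^sub>R (2 / pi * ((sin t)\<^sup>2 * h (g t) / g t)))"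
  proof (intro Bochner_Integration.integral_cong refl)
    fix t
    show "\<rho> (g t) * h (g t) * (2 * s * sin t) * indicat_real {0..pi} t
        = indicat_real {0..pi} t *\<^sub>R (2 / pi * ((sin t)\<^sup>2 * h (g t) / g t))"
    proof (cases "t \<in> {0..pi}")
      case True
      have "((1 + s)\<^sup>2 - g t) * (g t - (1 - s)\<^sup>2) = (2 * s + 2 * s * cos t) * (2 * s - 2 * s * cos t)"
        by (simp add: g_def s(3)[symmetric] power2_eq_square algebra_simps)
      also have "\<dots> = (2 * s * sin t)\<^sup>2"
        unfolding power_mult_distrib sin_squared_eq by (simp add: power2_eq_square algebra_simps)
      finally have "sqrt \<bar>((1 + s)\<^sup>2 - g t) * (g t - (1 - s)\<^sup>2)\<bar> = 2 * s * sin t"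
        using True s by (simp add: sin_ge_zero abs_mult)
      then have "\<rho> (g t) * (2 * s * sin t) = 2 * s\<^sup>2 * (sin t)\<^sup>2 / (pi * d * g t)"
        unfolding \<rho>_def by (simp add: power2_eq_square)
      then have "\<rho> (g t) * (2 * s * sin t) = 2 / pi * ((sin t)\<^sup>2 / g t)"
        using s(3) d by simp
      then have "h (g t) * (\<rho> (g t) * (2 * s * sin t)) = h (g t) * (2 / pi * ((sin t)\<^sup>2 / g t))"
        by simp
      then show ?thesis using True
        by (simp add: ac_simps)
    qed simp
  qed
  also have "\<dots> = 2 / pi * \<Psi> pi - 2 / pi * \<Psi> 0"
  proof (rule integral_FTC_atLeastAtMost)
    fix t :: real assume "0 \<le> t" "t \<le> pi"
    then have "(\<Psi> has_real_derivative (sin t)\<^sup>2 * h (g t) / g t) (at t within {0..pi})"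
      using \<Psi>[of t] has_field_derivative_at_within unfolding g_def s_def by blast
    then have "((\<lambda>t. 2 / pi * \<Psi> t) has_real_derivative 2 / pi * ((sin t)\<^sup>2 * h (g t) / g t)) (at t within {0..pi})"
      by (rule DERIV_cmult)
    then show "((\<lambda>t. 2 / pi * \<Psi> t) has_vector_derivative 2 / pi * ((sin t)\<^sup>2 * h (g t) / g t)) (at t within {0..pi})"
      by (simp add: has_real_derivative_iff_has_vector_derivative)
  next
    have "continuous_on {0..pi} (\<lambda>t. h (g t))"
      by (rule continuous_on_compose2[OF h(2)]) (auto simp: g_pos g_def[abs_def] intro!: continuous_intros, use g_pos g_def in auto)
    moreover have "continuous_on {0..pi} g" unfolding g_def[abs_def] by (intro continuous_intros)
    ultimately show "continuous_on {0..pi} (\<lambda>t. 2 / pi * ((sin t)\<^sup>2 * h (g t) / g t))"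
      using g_pos by (auto intro!: continuous_intros simp: less_imp_neq[symmetric] dest: less_imp_neq)
  qed simp
  finally show ?thesis by (simp add: right_diff_distrib)
qed

lemma limit_error_eq:
  assumes d: "0 < d" "d < 1" and l: "l \<in> {1, 2}"
  shows "limit_error l k d = sqrt (d ^ k / (if l = 1 then 1 - d else 1))"
proof -
  define s where "s = sqrt d"
  have s: "0 < s" "s < 1" "s\<^sup>2 = d" using d by (auto simp: s_def)
  define h where "h x = x powi (int l - 2) * (jacobi_det d k x)\<^sup>2" for x
  have cj: "continuous_on S (jacobi_det d k)" for S
    using continuous_jacobi_det d by simp
  have [measurable]: "jacobi_det d k \<in> borel_measurable borel"
    using cj[of UNIV] by (rule borel_measurable_continuous_onI)
  have h_eq: "h = (if l = 1 then (\<lambda>x. inverse x * (jacobi_det d k x)\<^sup>2) else (\<lambda>x. (jacobi_det d k x)\<^sup>2))"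
    using l by (auto simp: h_def fun_eq_iff power_int_minus)
  have hm: "h \<in> borel_measurable borel" unfolding h_eq by (cases "l = 1") simp_all
  have hc: "continuous_on {0<..} h"
    unfolding h_eq by (cases "l = 1") (auto intro!: continuous_intros cj)
  \<comment> \<open>The only pole of the integrands, at \<open>1 / s\<close>, lies outside the
    closed unit disc because \<open>d < 1\<close>.\<close>
  define R where "R = 1 / s"
  have R: "1 < R" using s by (simp add: R_def)
  have ne: "1 - of_real s * z \<noteq> 0" if "cmod z < R" for z :: complex
  proof
    assume "1 - of_real s * z = 0"
    then have "cmod (of_real s * z) = 1" by (metis eq_iff_diff_eq_0 norm_one)
    then show False using that s by (simp add: norm_mult R_def field_simps)
  qed
  have hol: "(\<lambda>z. z ^ (2 * k) * (z - of_real s) / (1 - of_real s * z)) holomorphic_on ball 0 R"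
    "(\<lambda>z. 2 * of_real s / (1 - of_real s * z)) holomorphic_on ball 0 R"
    "(\<lambda>z. z ^ (2 * k + 1) / (1 - of_real s * z)\<^sup>2) holomorphic_on ball 0 R"
    using ne by (auto intro!: holomorphic_intros)
  have real: "Im (of_real x ^ (2 * k) * (of_real x - of_real s) / (1 - of_real s * of_real x)) = 0"
    "Im (2 * of_real s / (1 - of_real s * of_real x)) = 0"
    "Im (of_real x ^ (2 * k + 1) / (1 - of_real s * of_real x)\<^sup>2) = 0" for x :: real
    by (simp_all add: complex_is_Real_iff[symmetric])
  obtain \<Phi>1 where \<Phi>1: "\<And>t. (\<Phi>1 has_real_derivative
      Re (cis t * (cis t ^ (2 * k) * (cis t - of_real s) / (1 - of_real s * cis t)))) (at t)" "\<Phi>1 pi = \<Phi>1 0"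
    using circle_primitive[OF R hol(1) real(1)] by metis
  obtain \<Phi>2 where \<Phi>2: "\<And>t. (\<Phi>2 has_real_derivative
      Re (cis t * (2 * of_real s / (1 - of_real s * cis t)))) (at t)" "\<Phi>2 pi = \<Phi>2 0"
    using circle_primitive[OF R hol(2) real(2)] by metis
  obtain \<Phi>3 where \<Phi>3: "\<And>t. (\<Phi>3 has_real_derivative
      Re (cis t * (cis t ^ (2 * k + 1) / (1 - of_real s * cis t)\<^sup>2))) (at t)" "\<Phi>3 pi = \<Phi>3 0"
    using circle_primitive[OF R hol(3) real(3)] by metis
  \<comment> \<open>Between 0 and \<open>pi\<close> the parts \<open>\<Phi>1\<close>,
    \<open>\<Phi>2\<close>, \<open>\<Phi>3\<close> have no increment. Apart from
    \<open>d ^ k\<close> only the linear term contributes, \<open>pi / 2\<close> or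
    \<open>pi / (2 * (1 - d))\<close>, and \<open>2 / pi\<close> normalises it.\<close>
  define \<Psi> where "\<Psi> t = (if l = 1 then d ^ k * ((t + \<Phi>2 t) / (2 * (1 - d)) - \<Phi>3 t / 2)
                            else d ^ k * (t / 2 - \<Phi>1 t / 2))" for t
  have "(LINT x|marchenko_pastur d. h x) = 2 / pi * (\<Psi> pi - \<Psi> 0)"
  proof (rule marchenko_pastur_integral[OF d hm hc])
    fix t
    define x where "x = 1 + d - 2 * s * cos t"
    define A where "A = sin (real (Suc k) * t) - s * sin (real k * t)"
    have dx: "d = s\<^sup>2" using s by simp
    have "(s ^ k)\<^sup>2 = d ^ k" by (simp add: dx power_mult[symmetric] mult.commute)
    then have jd: "(sin t)\<^sup>2 * (jacobi_det d k x)\<^sup>2 = d ^ k * A\<^sup>2"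
      using jacobi_det_chebyshev[of d k t] d unfolding s_def[symmetric] x_def[symmetric] A_def[symmetric]
      by (metis less_imp_le mult.commute power_mult_distrib)
    note ci = circle_identities(1)[OF s(1,2), where k = k and t = t, folded dx, folded x_def A_def]
      circle_identities(2)[OF s(1,2), where k = k and t = t, folded dx, folded x_def A_def]
      circle_identities(3)[OF s(1,2), where t = t, folded dx, folded x_def]
    show "(\<Psi> has_real_derivative
          (sin t)\<^sup>2 * h (1 + d - 2 * sqrt d * cos t) / (1 + d - 2 * sqrt d * cos t)) (at t)"
      unfolding s_def[symmetric] x_def[symmetric]
    proof (cases "l = 1")
      case True
      have "(sin t)\<^sup>2 * h x / x = d ^ k * (A\<^sup>2 / x\<^sup>2)"
        using jd ci(3) True by (simp add: h_eq field_simps power2_eq_square)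
      then show "(\<Psi> has_real_derivative (sin t)\<^sup>2 * h x / x) (at t)"
        unfolding \<Psi>_def using True d unfolding ci(2)
        by (auto intro!: derivative_eq_intros \<Phi>2(1) \<Phi>3(1))
    next
      case False
      have "(sin t)\<^sup>2 * h x / x = d ^ k * (A\<^sup>2 / x)"
        using jd False by (simp add: h_eq)
      then show "(\<Psi> has_real_derivative (sin t)\<^sup>2 * h x / x) (at t)"
        unfolding \<Psi>_def using False unfolding ci(1)
        by (auto intro!: derivative_eq_intros \<Phi>1(1))
    qed
  qed
  also have "\<dots> = d ^ k / (if l = 1 then 1 - d else 1)"
    using d by (simp add: \<Psi>_def \<Phi>1(2) \<Phi>2(2) \<Phi>3(2) field_simps)
  finally show ?thesis by (simp add: limit_error_def h_def jacobi_det_def)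
qed

section \<open>Vectors and matrices over the scalars\<close>

abbreviation ip :: "complex Matrix.vec \<Rightarrow> complex Matrix.vec \<Rightarrow> complex" where
  "ip u v \<equiv> u \<bullet>c v"

lemma ip_sum: "v \<in> carrier_vec n \<Longrightarrow> ip u v = (\<Sum>i<n. u $ i * cnj (v $ i))"
  by (auto simp: scalar_prod_def lessThan_atLeast0)

lemma ip_add_left: "u \<in> carrier_vec n \<Longrightarrow> v \<in> carrier_vec n \<Longrightarrow> w \<in> carrier_vec n \<Longrightarrow>
    ip (u + v) w = ip u w + ip v w"
  by (simp add: ip_sum[of _ n] sum.distrib algebra_simps)

lemma ip_diff_left: "u \<in> carrier_vec n \<Longrightarrow> v \<in> carrier_vec n \<Longrightarrow> w \<in> carrier_vec n \<Longrightarrow>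
    ip (u - v) w = ip u w - ip v w"
  by (simp add: ip_sum[of _ n] sum_subtractf algebra_simps)

lemma ip_smult_left: "u \<in> carrier_vec n \<Longrightarrow> w \<in> carrier_vec n \<Longrightarrow> ip (c \<cdot>\<^sub>v u) w = c * ip u w"
  by (simp add: ip_sum[of _ n] sum_distrib_left algebra_simps)

lemma ip_cnj: "u \<in> carrier_vec n \<Longrightarrow> w \<in> carrier_vec n \<Longrightarrow> cnj (ip u w) = ip w u"
  by (simp add: ip_sum[of _ n] algebra_simps)

lemma ip_add_right: "u \<in> carrier_vec n \<Longrightarrow> v \<in> carrier_vec n \<Longrightarrow> w \<in> carrier_vec n \<Longrightarrow>
    ip w (u + v) = ip w u + ip w v"
  by (simp add: ip_sum[of _ n] sum.distrib algebra_simps)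

lemma ip_diff_right: "u \<in> carrier_vec n \<Longrightarrow> v \<in> carrier_vec n \<Longrightarrow> w \<in> carrier_vec n \<Longrightarrow>
    ip w (u - v) = ip w u - ip w v"
  by (simp add: ip_sum[of _ n] sum_subtractf algebra_simps)

lemma ip_smult_right: "u \<in> carrier_vec n \<Longrightarrow> w \<in> carrier_vec n \<Longrightarrow> ip w (c \<cdot>\<^sub>v u) = cnj c * ip w u"
  by (simp add: ip_sum[of _ n] sum_distrib_left algebra_simps)

lemma ip_zero [simp]: "w \<in> carrier_vec n \<Longrightarrow> ip (0\<^sub>v n) w = 0" "ip w (0\<^sub>v n) = 0"
  using ip_sum[of "0\<^sub>v n" n w] by (simp_all add: ip_sum[of _ n])

lemmas ip_simps = ip_add_left ip_diff_left ip_smult_left ip_add_right ip_diff_right ip_smult_right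

lemma ip_self: "ip v v = of_real ((norm2 v)\<^sup>2)"
proof -
  have "(norm2 v)\<^sup>2 = (\<Sum>i<dim_vec v. (cmod (v $ i))\<^sup>2)"
    by (simp add: norm2_def L2_set_def sum_nonneg)
  then show ?thesis
    by (simp add: ip_sum[of v "dim_vec v"] complex_norm_square del: of_real_power)
qed

lemma norm2_nonneg [simp]: "0 \<le> norm2 v"
  by (simp add: norm2_def)

lemma norm2_eq_0_iff: "v \<in> carrier_vec n \<Longrightarrow> norm2 v = 0 \<longleftrightarrow> v = 0\<^sub>v n"
  using conjugate_square_eq_0_vec[of v n] ip_self[of v] by auto

lemma norm2_smult: "norm2 (c \<cdot>\<^sub>v v) = cmod c * norm2 v"
proof -
  have "of_real ((norm2 (c \<cdot>\<^sub>v v))\<^sup>2) = (of_real ((cmod c * norm2 v)\<^sup>2) :: complex)"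
    unfolding ip_self[symmetric]
    by (subst ip_smult_left[of _ "dim_vec v"], simp, simp, subst ip_smult_right[of _ "dim_vec v"], simp, simp)
       (simp add: power_mult_distrib ip_self[of v, symmetric] complex_norm_square[of c] mult.assoc
          del: of_real_power flip: of_real_power)
  then have "(norm2 (c \<cdot>\<^sub>v v))\<^sup>2 = (cmod c * norm2 v)\<^sup>2" using of_real_eq_iff by blast
  then show ?thesis by (simp add: power2_eq_iff_nonneg)
qed

lemma adjoint_carrier [simp]: "A \<in> carrier_mat n m \<Longrightarrow> mat_adjoint A \<in> carrier_mat m n"
  by (auto simp: mat_adjoint_def)

lemma adjoint_dims [simp]: "dim_row (mat_adjoint A) = dim_col A" "dim_col (mat_adjoint A) = dim_row A"
  by (auto simp: mat_adjoint_def)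

lemma adjoint_index [simp]:
  "i < dim_col A \<Longrightarrow> j < dim_row A \<Longrightarrow> mat_adjoint (A :: complex Matrix.mat) $$ (i, j) = cnj (A $$ (j, i))"
  by (simp add: mat_adjoint_def mat_of_rows_def)

lemma adjoint_adjoint [simp]: "mat_adjoint (mat_adjoint (A :: complex Matrix.mat)) = A"
  by (rule eq_matI) auto

lemma adjoint_mult: "A \<in> carrier_mat n m \<Longrightarrow> B \<in> carrier_mat m k \<Longrightarrow>
    mat_adjoint (A * B :: complex Matrix.mat) = mat_adjoint B * mat_adjoint A"
  by (rule eq_matI) (auto simp: scalar_prod_def intro!: sum.cong)

lemma adjoint_smult: "mat_adjoint (c \<cdot>\<^sub>m (A :: complex Matrix.mat)) = cnj c \<cdot>\<^sub>m mat_adjoint A"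
  by (rule eq_matI) auto

lemma mult_mat_vec_sum:
  "A \<in> carrier_mat n m \<Longrightarrow> v \<in> carrier_vec m \<Longrightarrow> i < n \<Longrightarrow> (A *\<^sub>v v) $ i = (\<Sum>j<m. A $$ (i, j) * v $ j)"
  by (auto simp: scalar_prod_def lessThan_atLeast0)

lemma mult_unit_vec_index:
  "A \<in> carrier_mat n m \<Longrightarrow> i < n \<Longrightarrow> j < m \<Longrightarrow> (A *\<^sub>v unit_vec m j) $ i = (A $$ (i, j) :: complex)"
  by auto

lemma mult_mat_sum:
  "A \<in> carrier_mat n m \<Longrightarrow> B \<in> carrier_mat m k \<Longrightarrow> i < n \<Longrightarrow> j < k \<Longrightarrow>
    (A * B) $$ (i, j) = (\<Sum>l<m. A $$ (i, l) * B $$ (l, j))"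
  by (auto simp: scalar_prod_def lessThan_atLeast0)

lemma ip_adjoint:
  assumes A: "A \<in> carrier_mat n m" and v: "v \<in> carrier_vec m" and w: "w \<in> carrier_vec n"
  shows "ip (A *\<^sub>v v) w = ip v (mat_adjoint A *\<^sub>v w)"
proof -
  have "ip (A *\<^sub>v v) w = (\<Sum>i<n. \<Sum>j<m. A $$ (i, j) * v $ j * cnj (w $ i))"
    using assms by (simp add: ip_sum[of _ n] mult_mat_vec_sum[OF A v] sum_distrib_right del: index_mult_mat_vec)
  also have "\<dots> = (\<Sum>j<m. \<Sum>i<n. A $$ (i, j) * v $ j * cnj (w $ i))" by (rule sum.swap)
  also have "\<dots> = ip v (mat_adjoint A *\<^sub>v w)"
  proof -
    have "mat_adjoint A *\<^sub>v w \<in> carrier_vec m" using A by (auto intro!: carrier_vecI)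
    moreover have "(mat_adjoint A *\<^sub>v w) $ j = (\<Sum>i<n. cnj (A $$ (i, j)) * w $ i)" if "j < m" for j
      using that A w by (subst mult_mat_vec_sum[of _ m n]) auto
    ultimately show ?thesis
      by (simp add: ip_sum[of _ m] sum_distrib_left algebra_simps del: index_mult_mat_vec)
  qed
  finally show ?thesis .
qed

lemma smult_mat_mult_vec:
  "A \<in> carrier_mat n m \<Longrightarrow> v \<in> carrier_vec m \<Longrightarrow> (c \<cdot>\<^sub>m (A :: complex Matrix.mat)) *\<^sub>v v = c \<cdot>\<^sub>v (A *\<^sub>v v)"
  by (rule eq_vecI) (auto simp: scalar_prod_def sum_distrib_left mult.assoc)

section \<open>Scalars from a subfield\<close>

definition vec_in :: "complex set \<Rightarrow> complex Matrix.vec \<Rightarrow> bool" where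
  "vec_in K v \<longleftrightarrow> (\<forall>i<dim_vec v. v $ i \<in> K)"

definition mat_in :: "complex set \<Rightarrow> complex Matrix.mat \<Rightarrow> bool" where
  "mat_in K A \<longleftrightarrow> (\<forall>i<dim_row A. \<forall>j<dim_col A. A $$ (i, j) \<in> K)"

text \<open>Covers both symmetry classes, the reals inside the complex numbers and the complex
  numbers themselves. Closure under \<open>cnj\<close> keeps adjoints and inner products over
  \<open>K\<close>; closure under inverses and real constants allows normalisation by norms.\<close>

locale conj_subfield =
  fixes K :: "complex set"
  assumes K_0 [simp]: "0 \<in> K" and K_1 [simp]: "1 \<in> K"
    and K_add [simp]: "x \<in> K \<Longrightarrow> y \<in> K \<Longrightarrow> x + y \<in> K"
    and K_mult [simp]: "x \<in> K \<Longrightarrow> y \<in> K \<Longrightarrow> x * y \<in> K"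
    and K_minus [simp]: "x \<in> K \<Longrightarrow> - x \<in> K"
    and K_inverse [simp]: "x \<in> K \<Longrightarrow> inverse x \<in> K"
    and K_cnj [simp]: "x \<in> K \<Longrightarrow> cnj x \<in> K"
    and K_real [simp]: "complex_of_real r \<in> K"
begin

lemma K_diff [simp]: "x \<in> K \<Longrightarrow> y \<in> K \<Longrightarrow> x - y \<in> K"
  using K_add[of x "- y"] by simp

lemma K_divide [simp]: "x \<in> K \<Longrightarrow> y \<in> K \<Longrightarrow> x / y \<in> K"
  by (simp add: divide_inverse)

lemma K_sum: "(\<And>i. i \<in> I \<Longrightarrow> f i \<in> K) \<Longrightarrow> sum f I \<in> K"
  by (induction I rule: infinite_finite_induct) auto

lemma K_ip: "u \<in> carrier_vec n \<Longrightarrow> v \<in> carrier_vec n \<Longrightarrow> vec_in K u \<Longrightarrow> vec_in K v \<Longrightarrow> ip u v \<in> K"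
  by (auto simp: ip_sum[of _ n] vec_in_def intro!: K_sum)

lemma vec_in_mult: "A \<in> carrier_mat n m \<Longrightarrow> v \<in> carrier_vec m \<Longrightarrow> mat_in K A \<Longrightarrow> vec_in K v \<Longrightarrow> vec_in K (A *\<^sub>v v)"
  unfolding vec_in_def mat_in_def
  by (auto simp: mult_mat_vec_sum simp del: index_mult_mat_vec intro!: K_sum)

lemma mat_in_mult: "A \<in> carrier_mat n m \<Longrightarrow> B \<in> carrier_mat m k \<Longrightarrow> mat_in K A \<Longrightarrow> mat_in K B \<Longrightarrow> mat_in K (A * B)"
  unfolding mat_in_def
  by (auto simp: mult_mat_sum simp del: index_mult_mat(1) intro!: K_sum)

lemma mat_in_adjoint: "mat_in K A \<Longrightarrow> mat_in K (mat_adjoint A)"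
  by (auto simp: mat_in_def)

lemma vec_in_add: "u \<in> carrier_vec n \<Longrightarrow> v \<in> carrier_vec n \<Longrightarrow> vec_in K u \<Longrightarrow> vec_in K v \<Longrightarrow> vec_in K (u + v)"
  by (auto simp: vec_in_def)

lemma vec_in_smult: "c \<in> K \<Longrightarrow> vec_in K v \<Longrightarrow> vec_in K (c \<cdot>\<^sub>v v)"
  by (auto simp: vec_in_def)

text \<open>The Householder reflection in the direction of \<open>x + e\<^sup>i\<^sup>\<phi> |x| e\<^sub>0\<close>, where \<open>\<phi>\<close> is the argument of the
  first entry of \<open>x\<close>; this choice of phase keeps the direction nonzero.\<close>

lemma householder:
  assumes x: "x \<in> carrier_vec m" "vec_in K x" and m: "0 < m"
  obtains U a where "U \<in> carrier_mat m m" "mat_in K U" "mat_adjoint U * U = 1\<^sub>m m"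
    "U * mat_adjoint U = 1\<^sub>m m" "U *\<^sub>v x = a \<cdot>\<^sub>v unit_vec m 0" "a \<in> K" "cmod a = norm2 x"
proof (cases "x = 0\<^sub>v m")
  case True
  have "U *\<^sub>v x = 0 \<cdot>\<^sub>v unit_vec m 0" if "U = 1\<^sub>m m" for U
    unfolding that True by (rule eq_vecI) auto
  moreover have "mat_adjoint (1\<^sub>m m :: complex Matrix.mat) = 1\<^sub>m m"
    by (rule eq_matI) auto
  moreover have "norm2 x = 0" using True x norm2_eq_0_iff by blast
  ultimately show ?thesis
    by (intro that[of "1\<^sub>m m" 0]) (auto simp: mat_in_def)
next
  case False
  define N where "N = norm2 x"
  have N: "0 < N" using False x norm2_eq_0_iff norm2_nonneg unfolding N_def by (metis order_le_less)
  define p where "p = (if x $ 0 = 0 then 1 else x $ 0 / of_real (cmod (x $ 0)))"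
  have p: "p \<in> K" "cmod p = 1" "cnj p * x $ 0 = of_real (cmod (x $ 0))"
    using x m complex_norm_square[of "x $ 0"]
    by (auto simp: p_def vec_in_def norm_divide power2_eq_square mult.commute field_simps)
  define e where "e = (unit_vec m 0 :: complex Matrix.vec)"
  have e: "e \<in> carrier_vec m" by (simp add: e_def)
  have ie: "ip x e = x $ 0" "ip e x = cnj (x $ 0)" "ip e e = 1"
    using x m by (simp_all add: ip_sum[of _ m] e_def unit_vec_def if_distrib[of cnj] if_distrib[of "(*) _"]
      if_distribR sum.delta cong: if_cong)
       (auto simp: if_distrib[of "\<lambda>c. c * _"] cong: if_cong)
  define v where "v = x + (p * of_real N) \<cdot>\<^sub>v e"
  have v: "v \<in> carrier_vec m" "vec_in K v"
    using x e p by (auto simp: v_def e_def vec_in_def)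
  \<comment> \<open>\<open>t\<close> equals \<open>ip x v\<close> and half of \<open>ip v v\<close>.
    Subtracting \<open>ip w v / t\<close> times \<open>v\<close> from \<open>w\<close> is therefore
    the reflection along \<open>v\<close>, and it sends \<open>x\<close> to \<open>x - v\<close>, a
    multiple of the first unit vector.\<close>
  define t where "t = N\<^sup>2 + N * cmod (x $ 0)"
  have t: "0 < t" using N by (simp add: t_def add_pos_nonneg)
  have pp: "p * cnj p = 1" using p(2) by (simp add: complex_norm_square[symmetric])
  have xx: "ip x x = of_real (N\<^sup>2)" by (simp add: ip_self N_def)
  have px: "p * cnj (x $ 0) = of_real (cmod (x $ 0))"
    using arg_cong[OF p(3), of cnj] by simp
  have xv: "ip x v = of_real t"
    using x e p(3) by (simp add: v_def ip_simps[of _ m] xx ie t_def algebra_simps)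
  have ev: "of_real N * p * ip e v = of_real t"
  proof -
    have "of_real N * p * ip e v = of_real N * (p * cnj (x $ 0)) + of_real N * of_real N * (p * cnj p)"
      using x e by (simp add: v_def ip_simps[of _ m] ie algebra_simps)
    then show ?thesis by (simp add: px pp t_def power2_eq_square)
  qed
  have vv: "ip v v = of_real (2 * t)"
  proof -
    have "ip v v = ip x v + of_real N * p * ip e v"
      using x e v(1) by (subst (1) v_def) (simp add: ip_simps[of _ m])
    then show ?thesis by (simp add: xv ev)
  qed
  define U where "U = Matrix.mat m m (\<lambda>(i, j). (if i = j then 1 else 0) - v $ i * cnj (v $ j) / of_real t)"
  have U: "U \<in> carrier_mat m m" by (simp add: U_def)
  have Uw: "U *\<^sub>v w = w - (ip w v / of_real t) \<cdot>\<^sub>v v" if w: "w \<in> carrier_vec m" for w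
  proof (rule eq_vecI)
    fix i assume "i < dim_vec (w - (ip w v / of_real t) \<cdot>\<^sub>v v)"
    then have i: "i < m" using v by simp
    have "(U *\<^sub>v w) $ i = (\<Sum>j<m. ((if i = j then 1 else 0) - v $ i * cnj (v $ j) / of_real t) * w $ j)"
      by (subst mult_mat_vec_sum[OF U w i]) (simp add: U_def i)
    also have "\<dots> = (\<Sum>j<m. if i = j then w $ j else 0) - v $ i / of_real t * (\<Sum>j<m. w $ j * cnj (v $ j))"
      unfolding sum_distrib_left sum_subtractf[symmetric]
      by (intro sum.cong) (auto simp: algebra_simps)
    also have "\<dots> = (w - (ip w v / of_real t) \<cdot>\<^sub>v v) $ i"
      using i v w by (simp add: ip_sum[of _ m])
    finally show "(U *\<^sub>v w) $ i = (w - (ip w v / of_real t) \<cdot>\<^sub>v v) $ i" .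
  qed (use U v in auto)
  have adj: "mat_adjoint U = U"
    by (rule eq_matI) (auto simp: U_def)
  have UUw: "U *\<^sub>v (U *\<^sub>v w) = w" if w: "w \<in> carrier_vec m" for w
  proof -
    have "U *\<^sub>v (U *\<^sub>v w) = (w - (ip w v / of_real t) \<cdot>\<^sub>v v)
        - (ip (w - (ip w v / of_real t) \<cdot>\<^sub>v v) v / of_real t) \<cdot>\<^sub>v v"
      using Uw w v by simp
    also have "ip (w - (ip w v / of_real t) \<cdot>\<^sub>v v) v / of_real t = - (ip w v / of_real t)"
      using w v t by (simp add: ip_simps[of _ m] vv field_simps)
    also have "w - (ip w v / of_real t) \<cdot>\<^sub>v v - (- (ip w v / of_real t)) \<cdot>\<^sub>v v = w"
      using w v by (intro eq_vecI) auto
    finally show ?thesis .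
  qed
  have UU: "U * U = 1\<^sub>m m"
  proof (rule eq_matI)
    fix i j assume ij: "i < dim_row (1\<^sub>m m :: complex Matrix.mat)" "j < dim_col (1\<^sub>m m :: complex Matrix.mat)"
    have "(U * U) $$ (i, j) = ((U * U) *\<^sub>v unit_vec m j) $ i"
      using U ij by (intro mult_unit_vec_index[of _ m m, symmetric]) auto
    also have "(U * U) *\<^sub>v unit_vec m j = U *\<^sub>v (U *\<^sub>v unit_vec m j)"
      using U by (simp add: assoc_mult_mat_vec[of _ m m _ m])
    also have "\<dots> = unit_vec m j" by (rule UUw) simp
    finally show "(U * U) $$ (i, j) = 1\<^sub>m m $$ (i, j)" using ij by auto
  qed (use U in auto)
  show ?thesis
  proof (rule that[of U "- (p * of_real N)"])
    show "mat_in K U" using v p by (auto simp: mat_in_def U_def vec_in_def)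
    have "ip x v / of_real t = 1" using xv t by simp
    then have "U *\<^sub>v x = x - v" using x Uw v by simp
    also have "\<dots> = - (p * of_real N) \<cdot>\<^sub>v unit_vec m 0"
      using x e by (intro eq_vecI) (auto simp: v_def e_def)
    finally show "U *\<^sub>v x = - (p * of_real N) \<cdot>\<^sub>v unit_vec m 0" .
  qed (use U UU adj p N in \<open>auto simp: norm_mult N_def\<close>)
qed

end

lemma conj_subfield_scalars: "conj_subfield (scalars \<beta>)"
  by standard (auto simp: scalars_def Reals_cnj_iff)

section \<open>Conjugate gradient errors\<close>

lemma pow_mult_vec_0: "W \<in> carrier_mat n n \<Longrightarrow> b \<in> carrier_vec n \<Longrightarrow> W ^\<^sub>m 0 *\<^sub>v b = (b :: complex Matrix.vec)"
  by auto

lemma pow_mult_vec_Suc: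
  assumes W: "W \<in> carrier_mat n n" and b: "b \<in> carrier_vec n"
  shows "W ^\<^sub>m Suc j *\<^sub>v b = W *\<^sub>v (W ^\<^sub>m j *\<^sub>v (b :: complex Matrix.vec))"
proof -
  have "W ^\<^sub>m Suc j = W * W ^\<^sub>m j"
    by (induction j) (use W in \<open>auto simp: assoc_mult_mat[of _ n n _ n _ n] pow_carrier_mat\<close>)
  then show ?thesis using W b by (simp add: assoc_mult_mat_vec[of _ n n _ n] pow_carrier_mat)
qed

lemma pow_mult_vec_carrier [simp]:
  "W \<in> carrier_mat n n \<Longrightarrow> b \<in> carrier_vec n \<Longrightarrow> W ^\<^sub>m j *\<^sub>v b \<in> carrier_vec n"
  by (metis pow_carrier_mat mult_mat_vec_carrier)

lemma krylov_carrier: "y \<in> krylov K W b k \<Longrightarrow> b \<in> carrier_vec n \<Longrightarrow> y \<in> carrier_vec n"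
  by (auto simp: krylov_def)

lemma krylov_0: "krylov K W b 0 = {0\<^sub>v (dim_vec b)}"
  by (auto simp: krylov_def)

lemma krylov_Suc_iff:
  assumes W: "W \<in> carrier_mat n n" and b: "b \<in> carrier_vec n"
  shows "y \<in> krylov K W b (Suc k) \<longleftrightarrow> (\<exists>y0\<in>krylov K W b k. \<exists>c\<in>K. y = y0 + c \<cdot>\<^sub>v (W ^\<^sub>m k *\<^sub>v b))"
    (is "_ \<longleftrightarrow> ?R")
proof
  assume "y \<in> krylov K W b (Suc k)"
  then obtain c where c: "\<forall>j<Suc k. c j \<in> K"
    and y: "y = Matrix.vec n (\<lambda>i. \<Sum>j<Suc k. c j * (W ^\<^sub>m j *\<^sub>v b) $ i)"
    using b by (auto simp: krylov_def)
  have "y = Matrix.vec n (\<lambda>i. \<Sum>j<k. c j * (W ^\<^sub>m j *\<^sub>v b) $ i) + c k \<cdot>\<^sub>v (W ^\<^sub>m k *\<^sub>v b)"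
    unfolding y using carrier_vecD[OF pow_mult_vec_carrier[OF W b]]
    by (intro eq_vecI) (simp_all del: index_mult_mat_vec)
  moreover have "Matrix.vec n (\<lambda>i. \<Sum>j<k. c j * (W ^\<^sub>m j *\<^sub>v b) $ i) \<in> krylov K W b k"
    using c b unfolding krylov_def by force
  ultimately show ?R using c by blast
next
  assume ?R
  then obtain y0 c where y0: "y0 \<in> krylov K W b k" and c: "c \<in> K"
    and y: "y = y0 + c \<cdot>\<^sub>v (W ^\<^sub>m k *\<^sub>v b)" by blast
  from y0 obtain c' where c': "\<forall>j<k. c' j \<in> K"
    and y0: "y0 = Matrix.vec n (\<lambda>i. \<Sum>j<k. c' j * (W ^\<^sub>m j *\<^sub>v b) $ i)"
    using b by (auto simp: krylov_def)
  have "y = Matrix.vec n (\<lambda>i. \<Sum>j<Suc k. (c'(k := c)) j * (W ^\<^sub>m j *\<^sub>v b) $ i)"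
    unfolding y y0 using carrier_vecD[OF pow_mult_vec_carrier[OF W b]]
    by (intro eq_vecI) (simp_all del: index_mult_mat_vec)
  moreover have "\<forall>j<Suc k. (c'(k := c)) j \<in> K" using c c' by auto
  ultimately show "y \<in> krylov K W b (Suc k)"
    unfolding krylov_def carrier_vecD[OF b] by (intro CollectI exI[of _ "c'(k := c)"] conjI)
qed

lemma ip_krylov:
  assumes W: "W \<in> carrier_mat n n" and b: "b \<in> carrier_vec n" and r: "r \<in> carrier_vec n"
    and orth: "\<And>j. j < k \<Longrightarrow> ip r (W ^\<^sub>m j *\<^sub>v b) = 0" and y: "y \<in> krylov K W b k"
  shows "ip r y = 0"
  using orth y
proof (induction k arbitrary: y)
  case 0
  then show ?case using b r by (auto simp: krylov_0)
next
  case (Suc k)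
  then obtain y0 c where "y0 \<in> krylov K W b k" "y = y0 + c \<cdot>\<^sub>v (W ^\<^sub>m k *\<^sub>v b)"
    by (auto simp: krylov_Suc_iff[OF W b])
  with Suc show ?case
    using W b r krylov_carrier[of y0 K W b k n] by (simp add: ip_simps[of _ n])
qed

context conj_subfield
begin

lemma krylov_zero: "W \<in> carrier_mat n n \<Longrightarrow> b \<in> carrier_vec n \<Longrightarrow> 0\<^sub>v n \<in> krylov K W b k"
  unfolding krylov_def by (intro CollectI exI[of _ "\<lambda>_. 0"]) auto

lemma krylov_add:
  assumes "b \<in> carrier_vec n" "y \<in> krylov K W b k" "z \<in> krylov K W b k"
  shows "y + z \<in> krylov K W b k"
proof -
  obtain c c' where "\<forall>j<k. c j \<in> K" "y = Matrix.vec n (\<lambda>i. \<Sum>j<k. c j * (W ^\<^sub>m j *\<^sub>v b) $ i)"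
    "\<forall>j<k. c' j \<in> K" "z = Matrix.vec n (\<lambda>i. \<Sum>j<k. c' j * (W ^\<^sub>m j *\<^sub>v b) $ i)"
    using assms by (auto simp: krylov_def)
  then show ?thesis using assms(1)
    unfolding krylov_def by (intro CollectI exI[of _ "\<lambda>j. c j + c' j"])
      (auto intro!: eq_vecI simp: sum.distrib distrib_right simp del: index_mult_mat_vec)
qed

lemma krylov_smult:
  assumes "b \<in> carrier_vec n" "y \<in> krylov K W b k" "a \<in> K"
  shows "a \<cdot>\<^sub>v y \<in> krylov K W b k"
proof -
  obtain c where "\<forall>j<k. c j \<in> K" "y = Matrix.vec n (\<lambda>i. \<Sum>j<k. c j * (W ^\<^sub>m j *\<^sub>v b) $ i)"
    using assms by (auto simp: krylov_def)
  then show ?thesis using assms(1,3)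
    unfolding krylov_def by (intro CollectI exI[of _ "\<lambda>j. a * c j"])
      (auto intro!: eq_vecI simp: sum_distrib_left mult.assoc simp del: index_mult_mat_vec)
qed

lemma krylov_diff:
  assumes "b \<in> carrier_vec n" "y \<in> krylov K W b k" "z \<in> krylov K W b k"
  shows "y - z \<in> krylov K W b k"
proof -
  have "y - z = y + (-1) \<cdot>\<^sub>v z" using assms by (intro eq_vecI) (auto simp: krylov_def)
  then show ?thesis using assms by (auto intro!: krylov_add krylov_smult)
qed

lemma krylov_Suc_mono:
  assumes W: "W \<in> carrier_mat n n" and b: "b \<in> carrier_vec n" and y: "y \<in> krylov K W b k"
  shows "y \<in> krylov K W b (Suc k)"
  unfolding krylov_Suc_iff[OF W b]
  using y krylov_carrier[OF y b] W b by (intro bexI[of _ y] bexI[of _ 0]) auto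

lemma krylov_power:
  assumes W: "W \<in> carrier_mat n n" and b: "b \<in> carrier_vec n"
  shows "j < k \<Longrightarrow> W ^\<^sub>m j *\<^sub>v b \<in> krylov K W b k"
proof (induction k)
  case (Suc k)
  show ?case
  proof (cases "j = k")
    case True
    show ?thesis unfolding krylov_Suc_iff[OF W b] True
      using krylov_zero[OF W b] W b by (intro bexI[of _ "0\<^sub>v n"] bexI[of _ 1]) auto
  qed (use Suc krylov_Suc_mono[OF W b] in auto)
qed simp

lemma krylov_mult:
  assumes W: "W \<in> carrier_mat n n" and b: "b \<in> carrier_vec n"
  shows "y \<in> krylov K W b k \<Longrightarrow> W *\<^sub>v y \<in> krylov K W b (Suc k)"
proof (induction k arbitrary: y)
  case 0
  then have "W *\<^sub>v y = 0\<^sub>v n" using W b by (auto simp: krylov_0)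
  then show ?case using krylov_zero[OF W b] by simp
next
  case (Suc k)
  then obtain y0 c where y0: "y0 \<in> krylov K W b k" "c \<in> K" "y = y0 + c \<cdot>\<^sub>v (W ^\<^sub>m k *\<^sub>v b)"
    by (auto simp: krylov_Suc_iff[OF W b])
  have "W *\<^sub>v y = W *\<^sub>v y0 + c \<cdot>\<^sub>v (W ^\<^sub>m Suc k *\<^sub>v b)"
    unfolding y0(3) using W b krylov_carrier[OF y0(1) b]
    by (simp add: mult_add_distrib_mat_vec[of _ n n] mult_mat_vec[of _ n n] pow_mult_vec_Suc del: pow_mat.simps)
  then show ?case
    unfolding krylov_Suc_iff[OF W b, of _ _ "Suc k"] using Suc.IH[OF y0(1)] y0(2) by blast
qed

lemma vec_in_power:
  assumes W: "W \<in> carrier_mat n n" "mat_in K W" and b: "b \<in> carrier_vec n" "vec_in K b"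
  shows "vec_in K (W ^\<^sub>m j *\<^sub>v b)"
proof (induction j)
  case 0
  then show ?case using assms by (simp add: pow_mult_vec_0)
next
  case (Suc j)
  then show ?case using W b
    unfolding pow_mult_vec_Suc[OF W(1) b(1)]
    by (intro vec_in_mult[OF W(1) pow_mult_vec_carrier[OF W(1) b(1)] W(2)])
qed

lemma krylov_vec_in:
  assumes W: "W \<in> carrier_mat n n" "mat_in K W" and b: "b \<in> carrier_vec n" "vec_in K b"
  shows "y \<in> krylov K W b k \<Longrightarrow> vec_in K y"
proof (induction k arbitrary: y)
  case 0
  then show ?case by (auto simp: krylov_0 vec_in_def)
next
  case (Suc k)
  then obtain y0 c where "y0 \<in> krylov K W b k" "c \<in> K" "y = y0 + c \<cdot>\<^sub>v (W ^\<^sub>m k *\<^sub>v b)"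
    by (auto simp: krylov_Suc_iff[OF W(1) b(1)])
  then show ?case
    using Suc.IH W b krylov_carrier[of y0 K W b k n] vec_in_power[OF W b]
    by (auto intro!: vec_in_add[of _ n] vec_in_smult)
qed

end

section \<open>Galerkin errors and the minimiser\<close>

lemma positive_definiteD:
  assumes "positive_definite W" "W \<in> carrier_mat n n"
  shows "mat_adjoint W = W" "\<And>v. v \<in> carrier_vec n \<Longrightarrow> v \<noteq> 0\<^sub>v n \<Longrightarrow> 0 < Re (ip (W *\<^sub>v v) v)"
    "\<And>v. v \<in> carrier_vec n \<Longrightarrow> 0 \<le> Re (ip (W *\<^sub>v v) v)"
    "\<And>u v. u \<in> carrier_vec n \<Longrightarrow> v \<in> carrier_vec n \<Longrightarrow> ip (W *\<^sub>v u) v = ip u (W *\<^sub>v v)"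
proof -
  show "mat_adjoint W = W" using assms by (simp add: positive_definite_def)
  show pos: "0 < Re (ip (W *\<^sub>v v) v)" if "v \<in> carrier_vec n" "v \<noteq> 0\<^sub>v n" for v
    using assms that by (auto simp: positive_definite_def)
  show "0 \<le> Re (ip (W *\<^sub>v v) v)" if "v \<in> carrier_vec n" for v
  proof (cases "v = 0\<^sub>v n")
    case True
    then show ?thesis using ip_zero(2)[of "W *\<^sub>v v" n] assms by (simp add: mult_mat_vec_carrier[OF assms(2)])
  qed (use pos[of v] that in auto)
  show "ip (W *\<^sub>v u) v = ip u (W *\<^sub>v v)" if "u \<in> carrier_vec n" "v \<in> carrier_vec n" for u v
    using ip_adjoint[OF assms(2) that] assms(1) by (simp add: positive_definite_def)
qed

lemma add_diff_cancel_left_vec: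
  "u \<in> carrier_vec n \<Longrightarrow> v \<in> carrier_vec n \<Longrightarrow> (u + v) - u = (v :: complex Matrix.vec)"
  by (intro eq_vecI) auto

lemma solution_eq:
  assumes pd: "positive_definite W" and W: "W \<in> carrier_mat n n" and x: "x \<in> carrier_vec n" "W *\<^sub>v x = b"
  shows "solution W b = x"
  unfolding solution_def
proof (rule the_equality)
  fix z assume z: "z \<in> carrier_vec (dim_col W) \<and> W *\<^sub>v z = b"
  then have zc: "z \<in> carrier_vec n" using W by auto
  have "W *\<^sub>v (z - x) = 0\<^sub>v n"
    using z zc x W by (simp add: mult_minus_distrib_mat_vec[of _ n n]) (auto intro!: eq_vecI)
  then have "z - x = 0\<^sub>v n"
    using positive_definiteD(2)[OF pd W, of "z - x"] zc x by force
  then show "z = x" using zc x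
    by (metis (no_types, lifting) eq_vecI carrier_vecD index_minus_vec(1) index_zero_vec(1) right_minus_eq)
qed (use x W in auto)

text \<open>\<open>e\<close> is an error of a Galerkin approximation: the exact solution minus an element of the Krylov
  space, with residual orthogonal to the Krylov space.\<close>

definition cg_err :: "complex set \<Rightarrow> complex Matrix.mat \<Rightarrow> complex Matrix.vec \<Rightarrow> nat \<Rightarrow> complex Matrix.vec \<Rightarrow> bool" where
  "cg_err K W b k e \<longleftrightarrow> e \<in> carrier_vec (dim_vec b) \<and> (\<exists>y\<in>krylov K W b k. W *\<^sub>v (y + e) = b) \<and>
     (\<forall>j<k. ip (W *\<^sub>v e) (W ^\<^sub>m j *\<^sub>v b) = 0)"

text \<open>The tested quantity for an explicit error vector, where \<open>W *\<^sub>v e\<close>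
  plays the residual. Kept apart from \<open>cg_size\<close>, which refers to the minimisation;
  \<open>cg_err_imp\<close> joins the two.\<close>

definition err_size :: "nat \<Rightarrow> complex Matrix.mat \<Rightarrow> complex Matrix.vec \<Rightarrow> real" where
  "err_size l W e = (if l = 1 then energy_norm W e else norm2 (W *\<^sub>v e))"

definition cg_size :: "nat \<Rightarrow> complex set \<Rightarrow> complex Matrix.mat \<Rightarrow> complex Matrix.vec \<Rightarrow> nat \<Rightarrow> real" where
  "cg_size l K W b k = (if l = 1 then energy_norm W (cg_error K W b k) else norm2 (cg_residual K W b k))"

context conj_subfield
begin

text \<open>Galerkin orthogonality determines the minimiser: by Pythagoras in the \<open>W\<close>
  inner product the squared distance of a competitor \<open>z\<close> exceeds that of
  \<open>y\<close> by the energy of \<open>z - y\<close>, which is positive unless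
  \<open>z = y\<close>. This resolves the definite description in \<open>cg_iterate\<close>, and any
  vector with \<open>cg_err\<close> may then stand for the error.\<close>

lemma cg_err_imp:
  assumes pd: "positive_definite W" and W: "W \<in> carrier_mat n n" and b: "b \<in> carrier_vec n"
    and e: "cg_err K W b k e"
  shows "cg_error K W b k = e" "cg_residual K W b k = W *\<^sub>v e" "cg_size l K W b k = err_size l W e"
proof -
  obtain y where ec: "e \<in> carrier_vec n" and y: "y \<in> krylov K W b k" "W *\<^sub>v (y + e) = b"
    and orth: "\<And>j. j < k \<Longrightarrow> ip (W *\<^sub>v e) (W ^\<^sub>m j *\<^sub>v b) = 0"
    using e b by (auto simp: cg_err_def)
  have yc: "y \<in> carrier_vec n" using krylov_carrier[OF y(1) b] .
  note P = positive_definiteD[OF pd W]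
  have sol: "solution W b = y + e"
    using solution_eq[OF pd W _ y(2)] yc ec by simp
  have pyth: "Re (ip (W *\<^sub>v (z - (y + e))) (z - (y + e))) = Re (ip (W *\<^sub>v (z - y)) (z - y)) + Re (ip (W *\<^sub>v e) e)"
    if z: "z \<in> krylov K W b k" for z
  proof -
    have zc: "z \<in> carrier_vec n" using krylov_carrier[OF z b] .
    have u: "z - (y + e) = (z - y) - e" using zc yc ec by (intro eq_vecI) auto
    have 0: "ip (W *\<^sub>v e) (z - y) = 0"
      using ip_krylov[OF W b _ orth krylov_diff[OF b z y(1)]] W ec by auto
    then have "ip (W *\<^sub>v (z - y)) e = 0"
      using ip_cnj[of "W *\<^sub>v e" n "z - y"] P(4)[of "z - y" e] zc yc ec W by auto
    with 0 show ?thesis unfolding u using zc yc ec W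
      by (simp add: mult_minus_distrib_mat_vec[of _ n n _ e] mult_mat_vec_carrier[OF W] ip_diff_left[of _ n] ip_diff_right[of _ n])
  qed
  define f where "f z = energy_norm W (z - (y + e))" for z
  have f: "f z = sqrt (Re (ip (W *\<^sub>v (z - y)) (z - y)) + Re (ip (W *\<^sub>v e) e))"
    if "z \<in> krylov K W b k" for z
    unfolding f_def energy_norm_def pyth[OF that] ..
  have yy: "y - y = 0\<^sub>v n" using yc by auto
  have fy: "f y = sqrt (Re (ip (W *\<^sub>v e) e))"
    unfolding f[OF y(1)] yy using ip_zero(2)[of "W *\<^sub>v 0\<^sub>v n" n] by simp
  have it: "cg_iterate K W b k = y"
    unfolding cg_iterate_def sol f_def[symmetric]
  proof (rule the_equality)
    have "f y \<le> f z" if "z \<in> krylov K W b k" for z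
      unfolding fy f[OF that] using P(3)[of "z - y"] krylov_carrier[OF that b] yc by auto
    then show "is_arg_min f (\<lambda>z. z \<in> krylov K W b k) y"
      using y(1) by (auto simp: is_arg_min_def not_less)
  next
    fix z assume z: "is_arg_min f (\<lambda>z. z \<in> krylov K W b k) z"
    then have zk: "z \<in> krylov K W b k" and "f z \<le> f y"
      using y(1) by (auto simp: is_arg_min_def not_less)
    have zc: "z \<in> carrier_vec n" using krylov_carrier[OF zk b] .
    have "\<not> 0 < Re (ip (W *\<^sub>v (z - y)) (z - y))"
      using \<open>f z \<le> f y\<close> unfolding fy f[OF zk] by simp
    then have "z - y = 0\<^sub>v n" using P(2)[of "z - y"] zc yc by auto
    then show "z = y" using zc yc
      by (metis (no_types, lifting) eq_vecI carrier_vecD index_minus_vec(1) index_zero_vec(1) right_minus_eq)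
  qed
  show err: "cg_error K W b k = e"
    unfolding cg_error_def sol it using yc ec by (intro eq_vecI) auto
  have "b = W *\<^sub>v y + W *\<^sub>v e"
    using y(2) mult_add_distrib_mat_vec[OF W yc ec] by simp
  then have "b - W *\<^sub>v y = W *\<^sub>v e"
    using mult_mat_vec_carrier[OF W yc] mult_mat_vec_carrier[OF W ec] by (metis (no_types) add_diff_cancel_left_vec)
  then show res: "cg_residual K W b k = W *\<^sub>v e" by (simp add: cg_residual_def it)
  show "cg_size l K W b k = err_size l W e" by (simp add: cg_size_def err_size_def err res)
qed

end

text \<open>The \<open>W\<close>-orthogonal projection onto the Krylov space by Gram--Schmidt. The convention \<open>x / 0 = 0\<close>
  takes care of directions that are linearly dependent on the previous ones.\<close>

primrec wproj :: "complex Matrix.mat \<Rightarrow> complex Matrix.vec \<Rightarrow> nat \<Rightarrow> complex Matrix.vec \<Rightarrow> complex Matrix.vec" where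
  "wproj W b 0 u = 0\<^sub>v (dim_vec b)"
| "wproj W b (Suc k) u = (let p = W ^\<^sub>m k *\<^sub>v b - wproj W b k (W ^\<^sub>m k *\<^sub>v b)
     in wproj W b k u + (ip (W *\<^sub>v u) p / ip (W *\<^sub>v p) p) \<cdot>\<^sub>v p)"

context conj_subfield
begin

text \<open>The induction runs over all \<open>u\<close>, since it is used both for the next Krylov
  vector, giving the new direction, and for \<open>u\<close> itself. Only
  \<open>W *\<^sub>v u\<close> is required to have entries in \<open>K\<close>, because
  \<open>u\<close> enters the coefficients through it; for the solution of the system this product
  is \<open>b\<close>.\<close>

lemma wproj:
  assumes pd: "positive_definite W" and W: "W \<in> carrier_mat n n" "mat_in K W"
    and b: "b \<in> carrier_vec n" "vec_in K b"
    and u: "u \<in> carrier_vec n" "vec_in K (W *\<^sub>v u)"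
  shows "wproj W b k u \<in> krylov K W b k \<and> (\<forall>j<k. ip (W *\<^sub>v (u - wproj W b k u)) (W ^\<^sub>m j *\<^sub>v b) = 0)"
  using u
proof (induction k arbitrary: u)
  case 0
  then show ?case using b by (simp add: krylov_0)
next
  case (Suc k)
  note P = positive_definiteD[OF pd W(1)]
  define v where "v = W ^\<^sub>m k *\<^sub>v b"
  have v: "v \<in> carrier_vec n" "vec_in K v" using W b vec_in_power[OF W b] by (auto simp: v_def)
  define q where "q = wproj W b k v"
  define p where "p = v - q"
  have q: "q \<in> krylov K W b k" and porth: "\<And>j. j < k \<Longrightarrow> ip (W *\<^sub>v p) (W ^\<^sub>m j *\<^sub>v b) = 0"
    using Suc.IH[of v] v vec_in_mult[OF W(1) v(1) W(2) v(2)] by (auto simp: q_def p_def)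
  have qc: "q \<in> carrier_vec n" "vec_in K q" using krylov_carrier[OF q b(1)] krylov_vec_in[OF W b q] by auto
  have pk: "p \<in> krylov K W b (Suc k)"
    unfolding p_def v_def using krylov_diff[OF b(1)] krylov_power[OF W(1) b(1)] krylov_Suc_mono[OF W(1) b(1) q] by auto
  have pc: "p \<in> carrier_vec n" "vec_in K p" using krylov_carrier[OF pk b(1)] krylov_vec_in[OF W b pk] by auto
  define w where "w = wproj W b k u"
  have w: "w \<in> krylov K W b k" and worth: "\<And>j. j < k \<Longrightarrow> ip (W *\<^sub>v (u - w)) (W ^\<^sub>m j *\<^sub>v b) = 0"
    using Suc.IH[of u] Suc.prems by (auto simp: w_def)
  have wc: "w \<in> carrier_vec n" using krylov_carrier[OF w b(1)] .
  define c where "c = ip (W *\<^sub>v u) p / ip (W *\<^sub>v p) p"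
  have Wc: "W *\<^sub>v z \<in> carrier_vec n" if "z \<in> carrier_vec n" for z using mult_mat_vec_carrier[OF W(1) that] .
  have cK: "c \<in> K" unfolding c_def
    using pc Suc.prems vec_in_mult[OF W(1) pc(1) W(2) pc(2)] Wc by (intro K_divide K_ip[of _ n]) auto
  define u' where "u' = w + c \<cdot>\<^sub>v p"
  have eq: "wproj W b (Suc k) u = u'"
    by (simp add: u'_def w_def c_def p_def v_def q_def Let_def)
  have u'c: "u' \<in> carrier_vec n" using wc pc by (simp add: u'_def)
  have "u' \<in> krylov K W b (Suc k)" unfolding u'_def
    using krylov_add[OF b(1)] krylov_smult[OF b(1) pk cK] krylov_Suc_mono[OF W(1) b(1) w] by blast
  moreover have res: "W *\<^sub>v (u - u') = W *\<^sub>v (u - w) - c \<cdot>\<^sub>v (W *\<^sub>v p)"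
  proof -
    have "u - u' = (u - w) - c \<cdot>\<^sub>v p" unfolding u'_def using Suc.prems wc pc by (intro eq_vecI) auto
    then show ?thesis using Suc.prems wc pc
      by (simp add: mult_minus_distrib_mat_vec[OF W(1), of _ "c \<cdot>\<^sub>v p"] mult_mat_vec[OF W(1)])
  qed
  have orth1: "ip (W *\<^sub>v (u - u')) (W ^\<^sub>m j *\<^sub>v b) = 0" if "j < k" for j
    unfolding res using that worth porth Wc Suc.prems wc pc W b by (simp add: ip_simps[of _ n])
  have orth2: "ip (W *\<^sub>v (u - u')) p = 0"
  proof -
    have "ip (W *\<^sub>v w) p = 0"
    proof -
      have "ip (W *\<^sub>v p) w = 0" using ip_krylov[OF W(1) b(1) _ porth w] Wc pc by auto
      then show ?thesis using P(4)[of w p] ip_cnj[of "W *\<^sub>v p" n w] wc pc Wc by simp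
    qed
    then have "ip (W *\<^sub>v (u - u')) p = ip (W *\<^sub>v u) p - c * ip (W *\<^sub>v p) p"
      unfolding res using Suc.prems wc pc Wc
      by (simp add: ip_simps[of _ n] mult_minus_distrib_mat_vec[OF W(1)])
    also have "\<dots> = 0"
    proof (cases "ip (W *\<^sub>v p) p = 0")
      case True
      then have "p = 0\<^sub>v n" using P(2)[of p] pc by auto
      then show ?thesis using ip_zero(2)[of "W *\<^sub>v u" n] ip_zero(2)[of "W *\<^sub>v p" n] Wc Suc.prems pc by simp
    qed (simp add: c_def)
    finally show ?thesis .
  qed
  have "ip (W *\<^sub>v (u - u')) v = 0"
  proof -
    have "v = p + q" unfolding p_def using v qc by (intro eq_vecI) auto
    moreover have "ip (W *\<^sub>v (u - u')) q = 0"
      using ip_krylov[OF W(1) b(1) _ orth1 q] Wc Suc.prems u'c by auto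
    ultimately show ?thesis using orth2 pc qc Wc Suc.prems u'c by (simp add: ip_simps[of _ n])
  qed
  then have "\<forall>j<Suc k. ip (W *\<^sub>v (u - u')) (W ^\<^sub>m j *\<^sub>v b) = 0"
    using orth1 by (auto simp: less_Suc_eq v_def)
  ultimately show ?case unfolding eq by blast
qed

lemma cg_err_wproj:
  assumes pd: "positive_definite W" and W: "W \<in> carrier_mat n n" "mat_in K W"
    and b: "b \<in> carrier_vec n" "vec_in K b" and x: "x \<in> carrier_vec n" "W *\<^sub>v x = b"
  shows "cg_err K W b k (x - wproj W b k x)"
proof -
  have "vec_in K (W *\<^sub>v x)" unfolding x(2) by (rule b(2))
  from wproj[OF pd W b x(1) this, of k]
  have y: "wproj W b k x \<in> krylov K W b k"
    and orth: "\<forall>j<k. ip (W *\<^sub>v (x - wproj W b k x)) (W ^\<^sub>m j *\<^sub>v b) = 0" by (rule conjunct1, rule conjunct2)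
  have c: "wproj W b k x \<in> carrier_vec n" using krylov_carrier[OF y b(1)] .
  have sum: "wproj W b k x + (x - wproj W b k x) = x" using c x(1) by (intro eq_vecI) auto
  have "W *\<^sub>v (wproj W b k x + (x - wproj W b k x)) = b" unfolding sum by (rule x(2))
  moreover have "x - wproj W b k x \<in> carrier_vec (dim_vec b)"
    unfolding carrier_vecD[OF b(1)] using x(1) c by (rule minus_carrier_vec)
  ultimately show ?thesis using y orth unfolding cg_err_def by blast
qed

end

section \<open>Gram matrices and explicit solutions\<close>

lemma Re_of_real_mult: "Re (of_real r * z) = r * Re z"
  by simp

lemma mult_mat_zero_vec: "A \<in> carrier_mat n m \<Longrightarrow> (A :: complex Matrix.mat) *\<^sub>v 0\<^sub>v m = 0\<^sub>v n"
  by (rule eq_vecI) (auto simp: scalar_prod_def)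

text \<open>The Wishart matrix without its normalisation. The elimination step changes the number of
  columns, so the factor is left out until \<open>wishart_props\<close> restores it through
  \<open>scale\<close>.\<close>

definition gram :: "complex Matrix.mat \<Rightarrow> complex Matrix.mat" where
  "gram X = X * mat_adjoint X"

lemma gram_carrier [simp]: "X \<in> carrier_mat n m \<Longrightarrow> gram X \<in> carrier_mat n n"
  unfolding gram_def by (metis adjoint_carrier mult_carrier_mat)

lemma gram_mult_vec:
  assumes "X \<in> carrier_mat n m" "v \<in> carrier_vec n"
  shows "gram X *\<^sub>v v = X *\<^sub>v (mat_adjoint X *\<^sub>v v)"
  unfolding gram_def using assms by (meson adjoint_carrier assoc_mult_mat_vec)

lemma gram_adjoint: "X \<in> carrier_mat n m \<Longrightarrow> mat_adjoint (gram X) = gram X"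
  unfolding gram_def by (simp add: adjoint_mult[of X n m "mat_adjoint X" n])

lemma ip_gram:
  assumes X: "X \<in> carrier_mat n m" and v: "v \<in> carrier_vec n"
  shows "ip (gram X *\<^sub>v v) v = of_real ((norm2 (mat_adjoint X *\<^sub>v v))\<^sup>2)"
proof -
  have "mat_adjoint X *\<^sub>v v \<in> carrier_vec m"
    using adjoint_carrier[OF X] v by (rule mult_mat_vec_carrier)
  then show ?thesis
    using ip_adjoint[OF X _ v] by (simp add: gram_mult_vec[OF X v] ip_self)
qed

lemma positive_definite_gram_iff:
  assumes X: "X \<in> carrier_mat n m"
  shows "positive_definite (gram X) \<longleftrightarrow> (\<forall>v\<in>carrier_vec n. v \<noteq> 0\<^sub>v n \<longrightarrow> mat_adjoint X *\<^sub>v v \<noteq> 0\<^sub>v m)"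
proof -
  have "0 < Re (ip (gram X *\<^sub>v v) v) \<longleftrightarrow> mat_adjoint X *\<^sub>v v \<noteq> 0\<^sub>v m" if "v \<in> carrier_vec n" for v
    using norm2_eq_0_iff[OF mult_mat_vec_carrier[OF adjoint_carrier[OF X] that]] norm2_nonneg[of "mat_adjoint X *\<^sub>v v"]
    by (simp add: ip_gram[OF X that] less_le del: norm2_nonneg)
  then show ?thesis
    using gram_carrier[OF X] by (auto simp: positive_definite_def gram_adjoint[OF X])
qed

lemma det_ne_0_if_positive_definite:
  assumes "positive_definite W" "W \<in> carrier_mat n n"
  shows "Determinant.det W \<noteq> 0"
proof
  assume "Determinant.det W = 0"
  then obtain v where v: "v \<in> carrier_vec n" "v \<noteq> 0\<^sub>v n" "W *\<^sub>v v = 0\<^sub>v n"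
    using det_0_iff_vec_prod_zero[OF assms(2)] by blast
  then show False using positive_definiteD(2)[OF assms v(1,2)] by simp
qed

text \<open>A Gram matrix is positive semidefinite, so definiteness is invertibility. The
  determinant is a polynomial in the entries, which makes definiteness a measurable event.\<close>

lemma positive_definite_gram_iff_det:
  assumes X: "X \<in> carrier_mat n m"
  shows "positive_definite (gram X) \<longleftrightarrow> Determinant.det (gram X) \<noteq> 0"
proof
  assume d: "Determinant.det (gram X) \<noteq> 0"
  show "positive_definite (gram X)"
    unfolding positive_definite_gram_iff[OF X]
  proof (intro ballI impI notI)
    fix v assume v: "v \<in> carrier_vec n" "v \<noteq> 0\<^sub>v n" "mat_adjoint X *\<^sub>v v = 0\<^sub>v m"
    then have "gram X *\<^sub>v v = 0\<^sub>v n" by (simp add: gram_mult_vec[OF X] mult_mat_zero_vec[OF X])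
    then show False using d v det_0_iff_vec_prod_zero[OF gram_carrier[OF X]] by blast
  qed
qed (use det_ne_0_if_positive_definite gram_carrier[OF X] in blast)

text \<open>Cramer's rule gives the solution as a rational function of the entries, hence a
  measurable one, in contrast to the definite description in \<open>solution\<close>. For a singular
  matrix the value is the zero vector, by \<open>1 / 0 = 0\<close>.\<close>

definition cramer :: "complex Matrix.mat \<Rightarrow> complex Matrix.vec \<Rightarrow> complex Matrix.vec" where
  "cramer W b = (1 / Determinant.det W) \<cdot>\<^sub>v (adj_mat W *\<^sub>v b)"

lemma cramer:
  assumes W: "W \<in> carrier_mat n n" and d: "Determinant.det W \<noteq> 0" and b: "b \<in> carrier_vec n"
  shows "cramer W b \<in> carrier_vec n" "W *\<^sub>v cramer W b = b"
proof -
  note adj = adj_mat[OF W]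
  show "cramer W b \<in> carrier_vec n" using adj(1) b by (simp add: cramer_def)
  have "W *\<^sub>v cramer W b = (1 / Determinant.det W) \<cdot>\<^sub>v ((W * adj_mat W) *\<^sub>v b)"
    unfolding cramer_def using W adj(1) b
    by (simp add: mult_mat_vec[OF W] assoc_mult_mat_vec[OF W adj(1) b])
  also have "\<dots> = b"
    unfolding adj(2) using b d by (subst smult_mat_mult_vec[of _ n n]) (auto simp: smult_smult_assoc)
  finally show "W *\<^sub>v cramer W b = b" .
qed

section \<open>Existence of errors and invariance under scaling and unitary maps\<close>

context conj_subfield
begin

lemma cg_err_exists:
  assumes pd: "positive_definite W" and W: "W \<in> carrier_mat n n" "mat_in K W"
    and b: "b \<in> carrier_vec n" "vec_in K b"
  shows "cg_err K W b k (cramer W b - wproj W b k (cramer W b))"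
  using cg_err_wproj[OF pd W b] cramer[OF W(1) det_ne_0_if_positive_definite[OF pd W(1)] b(1)] by blast

text \<open>Scalings of \<open>W\<close> and \<open>b\<close> as well as unitary changes of basis are covered by a single transformation rule.\<close>

lemma cg_err_transform:
  assumes W: "W \<in> carrier_mat n n" and W': "W' \<in> carrier_mat n n" and b: "b \<in> carrier_vec n"
    and T: "T \<in> carrier_mat n n" and g: "0 < (g::real)"
    and comm: "\<And>v. v \<in> carrier_vec n \<Longrightarrow> W' *\<^sub>v (T *\<^sub>v v) = of_real g \<cdot>\<^sub>v (T *\<^sub>v (W *\<^sub>v v))"
    and iso: "\<And>u v. u \<in> carrier_vec n \<Longrightarrow> v \<in> carrier_vec n \<Longrightarrow> ip (T *\<^sub>v u) (T *\<^sub>v v) = of_real (c\<^sup>2) * ip u v"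
    and c: "0 \<le> c" and e: "cg_err K W b k e"
  shows "cg_err K W' (T *\<^sub>v b) k (of_real (1 / g) \<cdot>\<^sub>v (T *\<^sub>v e))"
    and "err_size l W' (of_real (1 / g) \<cdot>\<^sub>v (T *\<^sub>v e))
      = (if l = 1 then c / sqrt g else c) * err_size l W e"
proof -
  note [simp] = mult_mat_vec_carrier[OF W] mult_mat_vec_carrier[OF W'] mult_mat_vec_carrier[OF T]
  have Tb: "T *\<^sub>v b \<in> carrier_vec n" using b by simp
  have pow: "W' ^\<^sub>m j *\<^sub>v (T *\<^sub>v b) = of_real (g ^ j) \<cdot>\<^sub>v (T *\<^sub>v (W ^\<^sub>m j *\<^sub>v b))" for j
  proof (induction j)
    case 0
    then show ?case using W W' b by (simp add: pow_mult_vec_0)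
  next
    case (Suc j)
    have "W' ^\<^sub>m Suc j *\<^sub>v (T *\<^sub>v b) = of_real (g ^ j) \<cdot>\<^sub>v (W' *\<^sub>v (T *\<^sub>v (W ^\<^sub>m j *\<^sub>v b)))"
      unfolding pow_mult_vec_Suc[OF W' Tb] Suc using W b by (simp add: mult_mat_vec[OF W'])
    also have "\<dots> = of_real (g ^ Suc j) \<cdot>\<^sub>v (T *\<^sub>v (W ^\<^sub>m Suc j *\<^sub>v b))"
      unfolding pow_mult_vec_Suc[OF W b] using W b
      by (simp add: comm smult_smult_assoc mult.commute)
    finally show ?case .
  qed
  have kry: "T *\<^sub>v y \<in> krylov K W' (T *\<^sub>v b) k" if "y \<in> krylov K W b k" for y k
    using that
  proof (induction k arbitrary: y)
    case 0
    have "T *\<^sub>v 0\<^sub>v n = 0\<^sub>v n" by (rule mult_mat_zero_vec[OF T])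
    then show ?case using 0 b T by (simp add: krylov_0)
  next
    case (Suc k)
    then obtain y0 a where y: "y0 \<in> krylov K W b k" "a \<in> K" "y = y0 + a \<cdot>\<^sub>v (W ^\<^sub>m k *\<^sub>v b)"
      by (auto simp: krylov_Suc_iff[OF W b])
    have "T *\<^sub>v y = T *\<^sub>v y0 + (a / of_real (g ^ k)) \<cdot>\<^sub>v (W' ^\<^sub>m k *\<^sub>v (T *\<^sub>v b))"
      unfolding pow y(3) using W b g krylov_carrier[OF y(1) b]
      by (simp add: mult_add_distrib_mat_vec[OF T] mult_mat_vec[OF T] smult_smult_assoc)
    moreover have "a / of_real (g ^ k) \<in> K" using y(2) by (intro K_divide K_real)
    ultimately show ?case
      unfolding krylov_Suc_iff[OF W' Tb] using Suc.IH[OF y(1)] by blast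
  qed
  obtain y where ec: "e \<in> carrier_vec n" and y: "y \<in> krylov K W b k" "W *\<^sub>v (y + e) = b"
    and orth: "\<And>j. j < k \<Longrightarrow> ip (W *\<^sub>v e) (W ^\<^sub>m j *\<^sub>v b) = 0"
    using e b by (auto simp: cg_err_def)
  have yc: "y \<in> carrier_vec n" using krylov_carrier[OF y(1) b] .
  \<comment> \<open>Since \<open>W'\<close> after \<open>T\<close> is \<open>g\<close> times
    \<open>T\<close> after \<open>W\<close>, the solution of the new system is \<open>T\<close>
    applied to the old one, divided by \<open>g\<close>; errors transform in the same way.\<close>
  define e' where "e' = of_real (1 / g) \<cdot>\<^sub>v (T *\<^sub>v e)"
  have ec': "e' \<in> carrier_vec n" using ec by (simp add: e'_def)
  have We': "W' *\<^sub>v e' = T *\<^sub>v (W *\<^sub>v e)"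
    unfolding e'_def using ec g by (simp add: mult_mat_vec[OF W'] comm smult_smult_assoc)
  have "W' *\<^sub>v (of_real (1 / g) \<cdot>\<^sub>v (T *\<^sub>v y)) = T *\<^sub>v (W *\<^sub>v y)"
    using yc g by (simp add: mult_mat_vec[OF W'] comm smult_smult_assoc)
  then have "W' *\<^sub>v (of_real (1 / g) \<cdot>\<^sub>v (T *\<^sub>v y) + e') = T *\<^sub>v b"
    unfolding y(2)[symmetric] using yc ec ec' We'
    by (simp add: mult_add_distrib_mat_vec[OF W'] mult_add_distrib_mat_vec[OF W] mult_add_distrib_mat_vec[OF T])
  moreover have "of_real (1 / g) \<cdot>\<^sub>v (T *\<^sub>v y) \<in> krylov K W' (T *\<^sub>v b) k"
    by (intro krylov_smult[OF Tb] kry y K_real)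
  moreover have "ip (W' *\<^sub>v e') (W' ^\<^sub>m j *\<^sub>v (T *\<^sub>v b)) = 0" if "j < k" for j
    unfolding pow We' using orth[OF that] ec W b by (simp add: ip_simps[of _ n] iso)
  ultimately have "cg_err K W' (T *\<^sub>v b) k e'"
    unfolding cg_err_def using ec' Tb by (metis carrier_vecD)
  then show "cg_err K W' (T *\<^sub>v b) k (of_real (1 / g) \<cdot>\<^sub>v (T *\<^sub>v e))" by (simp add: e'_def)
  have "ip (W' *\<^sub>v e') e' = of_real (c\<^sup>2 / g) * ip (W *\<^sub>v e) e"
    unfolding We' using ec by (simp add: e'_def ip_simps[of _ n] iso)
  then have "Re (ip (W' *\<^sub>v e') e') = c\<^sup>2 / g * Re (ip (W *\<^sub>v e) e)" by (simp only: Re_of_real_mult)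
  then have 1: "energy_norm W' e' = c / sqrt g * energy_norm W e"
    using c g by (simp add: energy_norm_def real_sqrt_mult real_sqrt_divide)
  have "ip (W' *\<^sub>v e') (W' *\<^sub>v e') = of_real (c\<^sup>2) * ip (W *\<^sub>v e) (W *\<^sub>v e)"
    unfolding We' using ec by (simp add: iso)
  then have "of_real ((norm2 (W' *\<^sub>v e'))\<^sup>2) = (of_real ((c * norm2 (W *\<^sub>v e))\<^sup>2) :: complex)"
    unfolding ip_self of_real_mult[symmetric] power_mult_distrib .
  then have "norm2 (W' *\<^sub>v e') = c * norm2 (W *\<^sub>v e)"
    using c unfolding of_real_eq_iff by (simp add: power2_eq_iff_nonneg)
  with 1 show "err_size l W' (of_real (1 / g) \<cdot>\<^sub>v (T *\<^sub>v e))
      = (if l = 1 then c / sqrt g else c) * err_size l W e"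
    unfolding e'_def[symmetric] by (simp add: err_size_def)
qed

lemma cg_size_transform:
  assumes pd: "positive_definite W" "positive_definite W'"
    and W: "W \<in> carrier_mat n n" "mat_in K W" and W': "W' \<in> carrier_mat n n"
    and b: "b \<in> carrier_vec n" "vec_in K b"
    and T: "T \<in> carrier_mat n n" and g: "0 < (g::real)"
    and comm: "\<And>v. v \<in> carrier_vec n \<Longrightarrow> W' *\<^sub>v (T *\<^sub>v v) = of_real g \<cdot>\<^sub>v (T *\<^sub>v (W *\<^sub>v v))"
    and iso: "\<And>u v. u \<in> carrier_vec n \<Longrightarrow> v \<in> carrier_vec n \<Longrightarrow> ip (T *\<^sub>v u) (T *\<^sub>v v) = of_real (c\<^sup>2) * ip u v"
    and c: "0 \<le> c"
  shows "cg_size l K W' (T *\<^sub>v b) k = (if l = 1 then c / sqrt g else c) * cg_size l K W b k"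
proof -
  note e = cg_err_exists[OF pd(1) W b, of k]
  note tr = cg_err_transform[OF W(1) W' b(1) T g comm iso c e]
  have Tb: "T *\<^sub>v b \<in> carrier_vec n" using mult_mat_vec_carrier[OF T b(1)] .
  show ?thesis
    using cg_err_imp(3)[OF pd(2) W' Tb tr(1)] tr(2) cg_err_imp(3)[OF pd(1) W(1) b(1) e] by simp
qed

lemma cg_size_scale:
  assumes pd: "positive_definite W" and W: "W \<in> carrier_mat n n" "mat_in K W"
    and b: "b \<in> carrier_vec n" "vec_in K b" and g: "0 < (g::real)"
  shows "positive_definite (of_real g \<cdot>\<^sub>m W)"
    and "cg_size l K (of_real g \<cdot>\<^sub>m W) b k = (if l = 1 then 1 / sqrt g else 1) * cg_size l K W b k"
proof -
  note P = positive_definiteD[OF pd W(1)]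
  have gv: "(of_real g \<cdot>\<^sub>m W) *\<^sub>v v = of_real g \<cdot>\<^sub>v (W *\<^sub>v v)" if "v \<in> carrier_vec n" for v
    using smult_mat_mult_vec[OF W(1) that] .
  show pd': "positive_definite (of_real g \<cdot>\<^sub>m W)"
    unfolding positive_definite_def using P W g mult_mat_vec_carrier[OF W(1)]
    by (auto simp: gv adjoint_smult ip_smult_left[of _ n])
  have "cg_size l K (of_real g \<cdot>\<^sub>m W) (1\<^sub>m n *\<^sub>v b) k = (if l = 1 then 1 / sqrt g else 1) * cg_size l K W b k"
    using W by (intro cg_size_transform[OF pd pd' W _ b, where g = g and c = 1])
      (auto simp: gv g mult_mat_vec_carrier[OF W(1)])
  then show "cg_size l K (of_real g \<cdot>\<^sub>m W) b k = (if l = 1 then 1 / sqrt g else 1) * cg_size l K W b k"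
    using b by simp
qed

lemma cg_size_smult:
  assumes pd: "positive_definite W" and W: "W \<in> carrier_mat n n" "mat_in K W"
    and b: "b \<in> carrier_vec n" "vec_in K b"
  shows "cg_size l K W (a \<cdot>\<^sub>v b) k = cmod a * cg_size l K W b k"
proof -
  have T: "(a \<cdot>\<^sub>m 1\<^sub>m n) *\<^sub>v v = a \<cdot>\<^sub>v v" if "v \<in> carrier_vec n" for v
    using that by (subst smult_mat_mult_vec[of _ n n]) auto
  have "cg_size l K W ((a \<cdot>\<^sub>m 1\<^sub>m n) *\<^sub>v b) k = (if l = 1 then cmod a / sqrt 1 else cmod a) * cg_size l K W b k"
    using W by (intro cg_size_transform[OF pd pd W _ b])
      (auto simp: T mult_mat_vec_carrier[OF W(1)] mult_mat_vec[OF W(1)] ip_simps[of _ n]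
        complex_norm_square[of a] mult_ac simp del: of_real_power)
  then show ?thesis using b by (simp add: T)
qed

lemma cg_size_unitary:
  assumes X: "X \<in> carrier_mat n m" "mat_in K X" and pd: "positive_definite (gram X)"
    and b: "b \<in> carrier_vec n" "vec_in K b"
    and U: "U \<in> carrier_mat n n" "mat_adjoint U * U = 1\<^sub>m n" "U * mat_adjoint U = 1\<^sub>m n"
  shows "positive_definite (gram (U * X))"
    and "cg_size l K (gram (U * X)) (U *\<^sub>v b) k = cg_size l K (gram X) b k"
proof -
  note U' = adjoint_carrier[OF U(1)]
  have UX: "U * X \<in> carrier_mat n m" using U X by simp
  have adj: "mat_adjoint (U * X) = mat_adjoint X * mat_adjoint U" using adjoint_mult[OF U(1) X(1)] .
  have UU: "mat_adjoint U *\<^sub>v (U *\<^sub>v v) = v" "U *\<^sub>v (mat_adjoint U *\<^sub>v v) = v"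
    if "v \<in> carrier_vec n" for v :: "complex Matrix.vec"
    using that U U' by (simp_all flip: assoc_mult_mat_vec[OF U' U(1)] assoc_mult_mat_vec[OF U(1) U'])
  have "gram (U * X) = U * gram X * mat_adjoint U"
    unfolding gram_def adj using U U' X adjoint_carrier[OF X(1)]
    by (smt (verit) assoc_mult_mat mult_carrier_mat)
  then have comm: "gram (U * X) *\<^sub>v (U *\<^sub>v v) = U *\<^sub>v (gram X *\<^sub>v v)" if "v \<in> carrier_vec n" for v
    using that U(1) U' gram_carrier[OF X(1)] UU(1)[OF that]
    by (smt (verit) assoc_mult_mat_vec mult_carrier_mat mult_mat_vec_carrier)
  show pd': "positive_definite (gram (U * X))"
    unfolding positive_definite_gram_iff[OF UX]
  proof (intro ballI impI)
    fix v :: "complex Matrix.vec" assume v: "v \<in> carrier_vec n" "v \<noteq> 0\<^sub>v n"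
    have c: "mat_adjoint U *\<^sub>v v \<in> carrier_vec n" using mult_mat_vec_carrier[OF U' v(1)] .
    have "mat_adjoint U *\<^sub>v v \<noteq> 0\<^sub>v n"
    proof
      assume "mat_adjoint U *\<^sub>v v = 0\<^sub>v n"
      then have "v = U *\<^sub>v 0\<^sub>v n" using UU(2)[OF v(1)] by simp
      then show False using v(2) mult_mat_zero_vec[OF U(1)] by simp
    qed
    then show "mat_adjoint (U * X) *\<^sub>v v \<noteq> 0\<^sub>v m"
      using pd c v unfolding positive_definite_gram_iff[OF X(1)] adj
      by (simp add: assoc_mult_mat_vec[OF adjoint_carrier[OF X(1)] U' v(1)])
  qed
  have Xin: "mat_in K (gram X)"
    unfolding gram_def by (intro mat_in_mult[OF X(1) adjoint_carrier[OF X(1)]] X mat_in_adjoint)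
  have "cg_size l K (gram (U * X)) (U *\<^sub>v b) k = (if l = 1 then 1 / sqrt 1 else 1) * cg_size l K (gram X) b k"
  proof (rule cg_size_transform[OF pd pd' gram_carrier[OF X(1)] Xin gram_carrier[OF UX] b U(1)])
    fix u v :: "complex Matrix.vec" assume uv: "u \<in> carrier_vec n" "v \<in> carrier_vec n"
    show "ip (U *\<^sub>v u) (U *\<^sub>v v) = of_real (1\<^sup>2) * ip u v"
      using ip_adjoint[OF U(1) uv(1) mult_mat_vec_carrier[OF U(1) uv(2)]] UU(1)[OF uv(2)] by simp
  qed (simp_all add: comm)
  then show "cg_size l K (gram (U * X)) (U *\<^sub>v b) k = cg_size l K (gram X) b k" by simp
qed

end

lemma gram_mult_unitary:
  assumes X: "X \<in> carrier_mat n m" and V: "V \<in> carrier_mat m m" "V * mat_adjoint V = 1\<^sub>m m"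
  shows "gram (X * V) = gram X"
proof -
  note V' = adjoint_carrier[OF V(1)] and X' = adjoint_carrier[OF X]
  have "gram (X * V) = X * (V * (mat_adjoint V * mat_adjoint X))"
    unfolding gram_def adjoint_mult[OF X V(1)]
    using assoc_mult_mat[OF X V(1)] mult_carrier_mat[OF V' X'] by blast
  also have "\<dots> = X * ((V * mat_adjoint V) * mat_adjoint X)"
    using assoc_mult_mat[OF V(1) V' X'] by simp
  finally show ?thesis unfolding V(2) gram_def left_mult_one_mat[OF X'] .
qed

section \<open>Bordered matrices and elimination of the first coordinate\<close>

definition bordered :: "complex \<Rightarrow> complex Matrix.vec \<Rightarrow> complex Matrix.mat \<Rightarrow> complex Matrix.mat" where
  "bordered a y Z = Matrix.mat (Suc (dim_row Z)) (Suc (dim_col Z)) (\<lambda>(i, j).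
     case i of 0 \<Rightarrow> (case j of 0 \<Rightarrow> a | Suc j \<Rightarrow> 0)
     | Suc i \<Rightarrow> (case j of 0 \<Rightarrow> y $ i | Suc j \<Rightarrow> Z $$ (i, j)))"

lemma bordered_carrier: "Z \<in> carrier_mat n m \<Longrightarrow> bordered a y Z \<in> carrier_mat (Suc n) (Suc m)"
  by (auto simp: bordered_def)

lemma carrier_vec_SucE:
  assumes "v \<in> carrier_vec (Suc n)"
  obtains c u where "u \<in> carrier_vec n" "v = vCons c u"
proof (rule that)
  show "Matrix.vec n (\<lambda>i. v $ Suc i) \<in> carrier_vec n" by simp
  show "v = vCons (v $ 0) (Matrix.vec n (\<lambda>i. v $ Suc i))"
    using assms by (intro eq_vecI) (auto simp: less_Suc_eq_0_disj)
qed

lemma bordered_mult: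
  assumes y: "y \<in> carrier_vec n" and Z: "Z \<in> carrier_mat n m" and w: "w \<in> carrier_vec m"
  shows "bordered a y Z *\<^sub>v vCons t w = vCons (a * t) (t \<cdot>\<^sub>v y + Z *\<^sub>v w)"
proof (rule eq_vecI)
  note X = bordered_carrier[OF Z, of a y]
  fix i assume "i < dim_vec (vCons (a * t) (t \<cdot>\<^sub>v y + Z *\<^sub>v w))"
  then have i: "i < Suc n" using y Z by simp
  show "(bordered a y Z *\<^sub>v vCons t w) $ i = vCons (a * t) (t \<cdot>\<^sub>v y + Z *\<^sub>v w) $ i"
    using i y Z w
    by (subst mult_mat_vec_sum[OF X _ i])
      (auto simp: less_Suc_eq_0_disj bordered_def sum.lessThan_Suc_shift mult_mat_vec_sum[OF Z w] simp del: index_mult_mat_vec sum.lessThan_Suc)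
qed (use y Z bordered_carrier[OF Z, of a y] in auto)

lemma bordered_adjoint_mult:
  assumes y: "y \<in> carrier_vec n" and Z: "Z \<in> carrier_mat n m" and u: "u \<in> carrier_vec n"
  shows "mat_adjoint (bordered a y Z) *\<^sub>v vCons c u = vCons (cnj a * c + ip u y) (mat_adjoint Z *\<^sub>v u)"
proof (rule eq_vecI)
  note X = adjoint_carrier[OF bordered_carrier[OF Z, of a y]]
  note Z' = adjoint_carrier[OF Z]
  fix i assume "i < dim_vec (vCons (cnj a * c + ip u y) (mat_adjoint Z *\<^sub>v u))"
  then have i: "i < Suc m" using y Z by simp
  show "(mat_adjoint (bordered a y Z) *\<^sub>v vCons c u) $ i = vCons (cnj a * c + ip u y) (mat_adjoint Z *\<^sub>v u) $ i"
    using i y Z u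
    by (subst mult_mat_vec_sum[OF X _ i])
      (auto simp: less_Suc_eq_0_disj bordered_def sum.lessThan_Suc_shift mult_mat_vec_sum[OF Z' u] ip_sum[OF y]
        mult.commute simp del: index_mult_mat_vec sum.lessThan_Suc)
qed (use y Z bordered_carrier[OF Z, of a y] in auto)

lemma gram_bordered_mult:
  assumes y: "y \<in> carrier_vec n" and Z: "Z \<in> carrier_mat n m" and u: "u \<in> carrier_vec n"
  shows "gram (bordered a y Z) *\<^sub>v vCons c u
    = vCons (a * (cnj a * c + ip u y)) ((cnj a * c + ip u y) \<cdot>\<^sub>v y + gram Z *\<^sub>v u)"
  using assms mult_mat_vec_carrier[OF adjoint_carrier[OF Z] u]
  by (simp add: gram_mult_vec[OF bordered_carrier[OF Z]] gram_mult_vec[OF Z] bordered_adjoint_mult bordered_mult)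

lemma vCons_zero_eq: "0\<^sub>v (Suc n) = vCons 0 (0\<^sub>v n)"
  by (rule eq_vecI) (auto simp: less_Suc_eq_0_disj)

lemma vCons_unit_eq: "unit_vec (Suc n) 0 = vCons 1 (0\<^sub>v n)"
  by (rule eq_vecI) (auto simp: less_Suc_eq_0_disj)

lemma positive_definite_bordered:
  assumes y: "y \<in> carrier_vec n" and Z: "Z \<in> carrier_mat n m"
    and a: "a \<noteq> 0" and pd: "positive_definite (gram Z)"
  shows "positive_definite (gram (bordered a y Z))"
  unfolding positive_definite_gram_iff[OF bordered_carrier[OF Z]]
proof (intro ballI impI notI)
  fix v assume v: "v \<in> carrier_vec (Suc n)" "v \<noteq> 0\<^sub>v (Suc n)"
    "mat_adjoint (bordered a y Z) *\<^sub>v v = 0\<^sub>v (Suc m)"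
  then obtain c u where u: "u \<in> carrier_vec n" "v = vCons c u" using carrier_vec_SucE by blast
  from v(3) have "cnj a * c + ip u y = 0" "mat_adjoint Z *\<^sub>v u = 0\<^sub>v m"
    unfolding u(2) bordered_adjoint_mult[OF y Z u(1)] vCons_zero_eq by auto
  then have "u = 0\<^sub>v n" using pd u(1) unfolding positive_definite_gram_iff[OF Z] by blast
  with \<open>cnj a * c + ip u y = 0\<close> have "c = 0" using a y by simp
  with \<open>u = 0\<^sub>v n\<close> v(2) show False unfolding u(2) vCons_zero_eq by simp
qed

context conj_subfield
begin

lemma vec_in_vCons: "a \<in> K \<Longrightarrow> vec_in K u \<Longrightarrow> vec_in K (vCons a u)"
  by (auto simp: vec_in_def less_Suc_eq_0_disj)

text \<open>Eliminating the first coordinate. The residuals after the first step live in the lower block, where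
  they are the residuals of the same algorithm for the matrix \<open>Z Z*\<close> and the right-hand side \<open>y\<close>.\<close>

lemma cg_size_bordered_Suc:
  assumes y: "y \<in> carrier_vec n" "vec_in K y" and Z: "Z \<in> carrier_mat n m" "mat_in K Z"
    and a: "a \<noteq> 0" "a \<in> K" and pd: "positive_definite (gram Z)"
  shows "cg_size l K (gram (bordered a y Z)) (unit_vec (Suc n) 0) (Suc k) = cg_size l K (gram Z) y k / cmod a"
proof -
  define V where "V = gram Z"
  define W where "W = gram (bordered a y Z)"
  define b where "b = (unit_vec (Suc n) 0 :: complex Matrix.vec)"
  have V: "V \<in> carrier_mat n n" "mat_in K V"
    unfolding V_def using Z by (simp, simp add: gram_def mat_in_mult[OF Z(1) adjoint_carrier[OF Z(1)]] mat_in_adjoint)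
  have W: "W \<in> carrier_mat (Suc n) (Suc n)" unfolding W_def using bordered_carrier[OF Z(1)] gram_carrier by blast
  have b: "b \<in> carrier_vec (Suc n)" by (simp add: b_def)
  have b_eq: "b = vCons 1 (0\<^sub>v n)" by (simp add: b_def vCons_unit_eq)
  note Vc [simp] = mult_mat_vec_carrier[OF V(1)]
  have WvC: "W *\<^sub>v vCons c u = vCons (a * (cnj a * c + ip u y)) ((cnj a * c + ip u y) \<cdot>\<^sub>v y + V *\<^sub>v u)"
    if "u \<in> carrier_vec n" for c u
    unfolding W_def V_def using gram_bordered_mult[OF y(1) Z(1) that] .
  \<comment> \<open>The Krylov space of \<open>W\<close> is the first axis plus the Krylov space of
    \<open>V\<close> of one degree less. This inclusion serves for the orthogonality of the
    residual.\<close>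
  have kry1: "\<exists>c u. c \<in> K \<and> u \<in> krylov K V y j \<and> W ^\<^sub>m j *\<^sub>v b = vCons c u" for j
  proof (induction j)
    case 0
    show ?case using W b krylov_zero[OF V(1) y(1)]
      by (intro exI[of _ 1] exI[of _ "0\<^sub>v n"]) (simp add: pow_mult_vec_0 b_eq)
  next
    case (Suc j)
    then obtain c u where cu: "c \<in> K" "u \<in> krylov K V y j" "W ^\<^sub>m j *\<^sub>v b = vCons c u" by blast
    note uc = krylov_carrier[OF cu(2) y(1)] and uK = krylov_vec_in[OF V y cu(2)]
    have t: "cnj a * c + ip u y \<in> K" using a cu(1) uc uK y by (intro K_add K_mult K_ip[of _ n]) auto
    have "W ^\<^sub>m Suc j *\<^sub>v b = vCons (a * (cnj a * c + ip u y)) ((cnj a * c + ip u y) \<cdot>\<^sub>v y + V *\<^sub>v u)"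
      unfolding pow_mult_vec_Suc[OF W b] cu(3) WvC[OF uc] ..
    moreover have "y \<in> krylov K V y (Suc j)"
      using krylov_power[OF V(1) y(1), of 0 "Suc j"] V y by (simp add: pow_mult_vec_0)
    then have "(cnj a * c + ip u y) \<cdot>\<^sub>v y + V *\<^sub>v u \<in> krylov K V y (Suc j)"
      by (intro krylov_add[OF y(1)] krylov_smult[OF y(1)] t krylov_mult[OF V(1) y(1)] cu(2))
    ultimately show ?case using a t by (metis K_mult)
  qed
  have e0_kry: "vCons c (0\<^sub>v n) \<in> krylov K W b (Suc j)" if "c \<in> K" for c j
  proof -
    have "c \<cdot>\<^sub>v b \<in> krylov K W b (Suc j)"
      using krylov_smult[OF b krylov_power[OF W b, of 0 "Suc j"] that] W b by (simp add: pow_mult_vec_0)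
    moreover have "c \<cdot>\<^sub>v b = vCons c (0\<^sub>v n)"
      unfolding b_eq by (rule eq_vecI) (auto simp: less_Suc_eq_0_disj)
    ultimately show ?thesis by simp
  qed
  have vC_add: "vCons c u + vCons c' u' = vCons (c + c') (u + u')" if "u \<in> carrier_vec n" "u' \<in> carrier_vec n" for c c' u u'
    using that by (intro eq_vecI) (auto simp: less_Suc_eq_0_disj)
  have vC_smult: "d \<cdot>\<^sub>v vCons c u = vCons (d * c) (d \<cdot>\<^sub>v u)" for d c u
    by (intro eq_vecI) (auto simp: less_Suc_eq_0_disj)
  \<comment> \<open>The opposite inclusion serves for membership of the approximation. Multiples of
    \<open>W\<close> applied to the first axis, \<open>(a, y)\<close> up to a factor, and of the
    axis itself cancel the unwanted parts.\<close>
  have kry2: "vCons 0 (V ^\<^sub>m j *\<^sub>v y) \<in> krylov K W b (Suc (Suc j))" for j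
  proof (induction j)
    case 0
    have "W *\<^sub>v vCons (1 / cnj a) (0\<^sub>v n) \<in> krylov K W b (Suc (Suc 0))"
      using a by (intro krylov_mult[OF W b] e0_kry) auto
    moreover have "W *\<^sub>v vCons (1 / cnj a) (0\<^sub>v n) = vCons a y"
      using WvC[of "0\<^sub>v n" "1 / cnj a"] a y by (simp add: mult_mat_zero_vec[OF V(1)])
    ultimately have "vCons a y + vCons (- a) (0\<^sub>v n) \<in> krylov K W b (Suc (Suc 0))"
      using a by (intro krylov_add[OF b] e0_kry) auto
    then show ?case using y V by (simp add: vC_add pow_mult_vec_0 del: pow_mat.simps)
  next
    case (Suc j)
    define u where "u = V ^\<^sub>m j *\<^sub>v y"
    have uc: "u \<in> carrier_vec n" "vec_in K u" unfolding u_def using V y vec_in_power[OF V y] by auto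
    define t where "t = ip u y"
    have tK: "t \<in> K" unfolding t_def using uc y K_ip by blast
    have 1: "W *\<^sub>v vCons 0 u \<in> krylov K W b (Suc (Suc (Suc j)))"
      using krylov_mult[OF W b Suc] by (simp add: u_def)
    have W1: "W *\<^sub>v vCons 0 u = vCons (a * t) (t \<cdot>\<^sub>v y + V *\<^sub>v u)"
      using WvC[OF uc(1), of 0] by (simp add: t_def)
    have "W *\<^sub>v vCons (- t / cnj a) (0\<^sub>v n) \<in> krylov K W b (Suc (Suc (Suc j)))"
      using a tK by (intro krylov_mult[OF W b] e0_kry) auto
    moreover have "W *\<^sub>v vCons (- t / cnj a) (0\<^sub>v n) = vCons (- a * t) (- t \<cdot>\<^sub>v y)"
      using WvC[of "0\<^sub>v n" "- t / cnj a"] a y by (simp add: mult_mat_zero_vec[OF V(1)])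
    ultimately have "vCons (a * t) (t \<cdot>\<^sub>v y + V *\<^sub>v u) + vCons (- a * t) (- t \<cdot>\<^sub>v y) \<in> krylov K W b (Suc (Suc (Suc j)))"
      using krylov_add[OF b 1[unfolded W1]] by simp
    moreover have "vCons (a * t) (t \<cdot>\<^sub>v y + V *\<^sub>v u) + vCons (- a * t) (- t \<cdot>\<^sub>v y) = vCons 0 (V *\<^sub>v u)"
      using y uc carrier_vecD[OF Vc[OF uc(1)]]
      by (subst vC_add) (auto intro!: eq_vecI simp del: index_mult_mat_vec)
    ultimately show ?case unfolding pow_mult_vec_Suc[OF V(1) y(1)] u_def by simp
  qed
  have kry3: "vCons c u \<in> krylov K W b (Suc j)" if "c \<in> K" "u \<in> krylov K V y j" for c u j
    using that(2)
  proof (induction j arbitrary: u)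
    case 0
    then show ?case using e0_kry[OF that(1)] y by (simp add: krylov_0)
  next
    case (Suc j)
    then obtain u0 d where u: "u0 \<in> krylov K V y j" "d \<in> K" "u = u0 + d \<cdot>\<^sub>v (V ^\<^sub>m j *\<^sub>v y)"
      by (auto simp: krylov_Suc_iff[OF V(1) y(1)])
    have "vCons c u = vCons c u0 + d \<cdot>\<^sub>v vCons 0 (V ^\<^sub>m j *\<^sub>v y)"
      unfolding u(3) vC_smult using krylov_carrier[OF u(1) y(1)] V y by (simp add: vC_add)
    then show ?case
      using krylov_add[OF b krylov_Suc_mono[OF W b Suc.IH[OF u(1)]] krylov_smult[OF b kry2 u(2)]] by simp
  qed
  obtain f where f: "cg_err K V y k f"
    using cg_err_exists[OF pd[folded V_def] V y] by blast
  then obtain y0 where fc: "f \<in> carrier_vec n" and y0: "y0 \<in> krylov K V y k" "V *\<^sub>v (y0 + f) = y"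
    and orth: "\<And>j. j < k \<Longrightarrow> ip (V *\<^sub>v f) (V ^\<^sub>m j *\<^sub>v y) = 0"
    using y by (auto simp: cg_err_def)
  note y0c = krylov_carrier[OF y0(1) y(1)] and y0K = krylov_vec_in[OF V y y0(1)]
  \<comment> \<open>The first entry of \<open>e\<close> makes \<open>cnj a * c + ip u y\<close>
    vanish, so the residual \<open>W *\<^sub>v e\<close> has first entry 0 and lower part
    \<open>V *\<^sub>v u\<close>. The factor \<open>- 1 / a\<close> matches the right-hand side
    \<open>- y / a\<close> that is left after the first step.\<close>
  define u where "u = (- 1 / a) \<cdot>\<^sub>v f"
  define e where "e = vCons (- ip u y / cnj a) u"
  have uc: "u \<in> carrier_vec n" using fc by (simp add: u_def)
  have ec: "e \<in> carrier_vec (Suc n)" using uc by (simp add: e_def)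
  have Vu: "V *\<^sub>v u = (- 1 / a) \<cdot>\<^sub>v (V *\<^sub>v f)" unfolding u_def using fc by (simp add: mult_mat_vec[OF V(1)])
  have We: "W *\<^sub>v e = vCons 0 (V *\<^sub>v u)"
    unfolding e_def WvC[OF uc] using a y uc carrier_matD[OF V(1)]
    by (auto intro!: eq_vecI simp: less_Suc_eq_0_disj)
  define u1 where "u1 = (- 1 / a) \<cdot>\<^sub>v y0"
  \<comment> \<open>Here the same quantity is made equal to \<open>1 / a\<close>, which gives
    \<open>W *\<^sub>v z\<close> the first entry 1.\<close>
  define z where "z = vCons ((1 / a - ip u1 y) / cnj a) u1"
  have u1c: "u1 \<in> carrier_vec n" using y0c by (simp add: u1_def)
  have "vec_in K u1" unfolding u1_def using y0K a by (intro vec_in_smult) auto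
  then have "ip u1 y \<in> K" using u1c y by (intro K_ip[of _ n])
  then have z_kry: "z \<in> krylov K W b (Suc k)" unfolding z_def u1_def
    using a by (intro kry3 krylov_smult[OF y(1) y0(1)]) (auto simp: u1_def)
  have Wz: "W *\<^sub>v z = vCons 1 ((1 / a) \<cdot>\<^sub>v y + V *\<^sub>v u1)"
    unfolding z_def WvC[OF u1c] using a by simp
  have zc: "z \<in> carrier_vec (Suc n)" using u1c by (simp add: z_def)
  have "W *\<^sub>v (z + e) = b"
  proof -
    have "V *\<^sub>v u1 + V *\<^sub>v u = (- 1 / a) \<cdot>\<^sub>v (V *\<^sub>v (y0 + f))"
      unfolding Vu u1_def using y0c fc
      by (simp add: mult_mat_vec[OF V(1)] mult_add_distrib_mat_vec[OF V(1)] smult_add_distrib_vec[of _ n])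
    then have s: "V *\<^sub>v u1 + V *\<^sub>v u = (- 1 / a) \<cdot>\<^sub>v y" unfolding y0(2) .
    have "W *\<^sub>v (z + e) = vCons 1 ((1 / a) \<cdot>\<^sub>v y + (V *\<^sub>v u1 + V *\<^sub>v u))"
      using zc ec uc u1c y by (simp add: mult_add_distrib_mat_vec[OF W] Wz We vC_add assoc_add_vec[of _ n])
    also have "\<dots> = b"
      unfolding s b_eq using y by (auto intro!: eq_vecI simp: less_Suc_eq_0_disj)
    finally show ?thesis .
  qed
  moreover have "ip (W *\<^sub>v e) (W ^\<^sub>m j *\<^sub>v b) = 0" if j: "j < Suc k" for j
  proof -
    obtain c u' where cu: "u' \<in> krylov K V y j" "W ^\<^sub>m j *\<^sub>v b = vCons c u'" using kry1 by blast
    have "ip (V *\<^sub>v f) u' = 0" using ip_krylov[OF V(1) y(1) Vc[OF fc] _ cu(1)] orth j by simp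
    then show ?thesis unfolding We cu(2) using uc fc krylov_carrier[OF cu(1) y(1)]
      by (simp add: Vu ip_smult_left[of _ n])
  qed
  ultimately have err: "cg_err K W b (Suc k) e"
    unfolding cg_err_def using ec z_kry carrier_vecD[OF b] by metis
  have pdW: "positive_definite W" unfolding W_def using positive_definite_bordered[OF y(1) Z(1) a(1) pd] .
  have "ip (W *\<^sub>v e) e = of_real ((1 / cmod a)\<^sup>2) * ip (V *\<^sub>v f) f"
  proof -
    have "ip (W *\<^sub>v e) e = (- 1 / a) * cnj (- 1 / a) * ip (V *\<^sub>v f) f"
      unfolding We using uc fc by (simp add: e_def Vu) (simp add: u_def ip_simps[of _ n])
    also have "(- 1 / a) * cnj (- 1 / a) = of_real ((cmod (- 1 / a))\<^sup>2)" by (rule complex_norm_square[symmetric])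
    also have "cmod (- 1 / a) = 1 / cmod a" by (simp add: norm_divide)
    finally show ?thesis .
  qed
  then have "Re (ip (W *\<^sub>v e) e) = (1 / cmod a)\<^sup>2 * Re (ip (V *\<^sub>v f) f)" by (simp only: Re_of_real_mult)
  then have 1: "energy_norm W e = energy_norm V f / cmod a"
    by (simp add: energy_norm_def real_sqrt_divide power_divide)
  have "ip (W *\<^sub>v e) (W *\<^sub>v e) = ip (V *\<^sub>v u) (V *\<^sub>v u)"
    unfolding We using uc by simp
  then have "norm2 (W *\<^sub>v e) = norm2 (V *\<^sub>v u)" unfolding ip_self of_real_eq_iff by (simp add: power2_eq_iff_nonneg)
  then have 2: "norm2 (W *\<^sub>v e) = norm2 (V *\<^sub>v f) / cmod a"
    unfolding Vu norm2_smult by (simp add: norm_divide)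
  have "cg_size l K W b (Suc k) = err_size l W e" using cg_err_imp(3)[OF pdW W b err] .
  also have "\<dots> = err_size l V f / cmod a" using 1 2 by (simp add: err_size_def)
  also have "err_size l V f = cg_size l K V y k" using cg_err_imp(3)[OF pd[folded V_def] V(1) y(1) f] by simp
  finally show ?thesis by (simp add: W_def b_def V_def)
qed

lemma cg_size_0:
  assumes pd: "positive_definite W" and W: "W \<in> carrier_mat n n" and x: "x \<in> carrier_vec n"
  shows "cg_size l K W (W *\<^sub>v x) 0 = err_size l W x"
proof (rule cg_err_imp(3)[OF pd W])
  show "cg_err K W (W *\<^sub>v x) 0 x" using W x by (simp add: cg_err_def krylov_0)
qed (use mult_mat_vec_carrier[OF W x] in auto)

text \<open>The squared initial energy is the quadratic form of the inverse matrix at the right-hand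
  side. The Schur complement of the first entry of the bordered Gram matrix is
  \<open>gram Z\<close>, so the lower block of the inverse is the inverse of \<open>gram Z\<close>,
  and a right-hand side with first entry 0 sees only this block.\<close>

lemma cg_size_bordered_0:
  assumes y: "y \<in> carrier_vec n" and Z: "Z \<in> carrier_mat n m" and b: "b \<in> carrier_vec n"
    and a: "a \<noteq> 0" and pd: "positive_definite (gram Z)"
  shows "cg_size 1 K (gram (bordered a y Z)) (vCons 0 b) 0 = cg_size 1 K (gram Z) b 0"
proof -
  note G = gram_carrier[OF Z]
  define f where "f = cramer (gram Z) b"
  have f: "f \<in> carrier_vec n" "gram Z *\<^sub>v f = b"
    unfolding f_def using cramer[OF G det_ne_0_if_positive_definite[OF pd G] b] by auto
  define e where "e = vCons (- ip f y / cnj a) f"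
  have e: "e \<in> carrier_vec (Suc n)" using f by (simp add: e_def)
  have We: "gram (bordered a y Z) *\<^sub>v e = vCons 0 b"
    unfolding e_def gram_bordered_mult[OF y Z f(1)] f(2) using a y b by (auto intro!: eq_vecI simp: less_Suc_eq_0_disj)
  note G' = gram_carrier[OF bordered_carrier[OF Z, of a y]]
  have "cg_size 1 K (gram (bordered a y Z)) (vCons 0 b) 0 = energy_norm (gram (bordered a y Z)) e"
    using cg_size_0[OF positive_definite_bordered[OF y Z a pd] G' e, of 1] by (simp add: We err_size_def)
  also have "\<dots> = energy_norm (gram Z) f"
    unfolding energy_norm_def We f(2) using b f by (simp add: e_def)
  also have "\<dots> = cg_size 1 K (gram Z) b 0"
    using cg_size_0[OF pd G f(1), of 1] by (simp add: f(2) err_size_def)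
  finally show ?thesis .
qed

text \<open>End of the descent: one row is left, the system is the scalar \<open>a * cnj a\<close>,
  and its solution for the right-hand side 1 has squared energy \<open>1 / (cmod a)\<^sup>2\<close>.
  The empty block below is vacuously definite.\<close>

lemma cg_size_bordered_1:
  assumes y: "y \<in> carrier_vec 0" and Z: "Z \<in> carrier_mat 0 m" and a: "a \<noteq> 0"
  shows "positive_definite (gram (bordered a y Z))"
    and "cg_size 1 K (gram (bordered a y Z)) (unit_vec 1 0) 0 = 1 / cmod a"
proof -
  have "positive_definite (gram Z)"
    unfolding positive_definite_gram_iff[OF Z] by (auto intro!: eq_vecI)
  then show pd: "positive_definite (gram (bordered a y Z))" using positive_definite_bordered[OF y Z a] by blast
  define e where "e = vCons (1 / (a * cnj a)) (0\<^sub>v 0 :: complex Matrix.vec)"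
  have e: "e \<in> carrier_vec (Suc 0)" by (simp add: e_def)
  have We: "gram (bordered a y Z) *\<^sub>v e = unit_vec 1 0"
    unfolding e_def gram_bordered_mult[OF y Z zero_carrier_vec] using a y carrier_matD[OF gram_carrier[OF Z]] ip_zero(1)[OF y]
    by (intro eq_vecI) (auto simp: less_Suc_eq_0_disj simp del: zero_vec_zero)
  have "cg_size 1 K (gram (bordered a y Z)) (unit_vec 1 0) 0 = energy_norm (gram (bordered a y Z)) e"
    using cg_size_0[OF pd gram_carrier[OF bordered_carrier[OF Z, of a y]] e, of 1] by (simp add: We err_size_def)
  also have "ip (gram (bordered a y Z) *\<^sub>v e) e = of_real (1 / (cmod a)\<^sup>2)"
    unfolding We using complex_norm_square[of a]
    by (simp add: ip_sum[OF e] e_def mult.commute)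
  then have "energy_norm (gram (bordered a y Z)) e = 1 / cmod a"
    by (simp add: energy_norm_def real_sqrt_divide del: of_real_divide)
  finally show "cg_size 1 K (gram (bordered a y Z)) (unit_vec 1 0) 0 = 1 / cmod a" .
qed

end

section \<open>Gaussian product measures\<close>

abbreviation std_normal :: "real measure" where
  "std_normal \<equiv> density lborel (\<lambda>x. ennreal (std_normal_density x))"

definition gaussian :: "'i set \<Rightarrow> ('i \<Rightarrow> real) measure" where
  "gaussian I = PiM I (\<lambda>_. std_normal)"

lemma prob_space_std_normal: "prob_space std_normal"
  by (rule prob_space_normal_density) simp

lemma product_prob_space_std_normal: "product_prob_space (\<lambda>_. std_normal)"
  by (rule product_prob_spaceI) (rule prob_space_std_normal)

lemma product_sigma_finite_std_normal: "product_sigma_finite (\<lambda>_. std_normal)"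
  using product_prob_space_std_normal by (rule product_prob_space.axioms(1))

lemma sigma_finite_std_normal: "sigma_finite_measure std_normal"
  using prob_space_std_normal by (rule prob_space_imp_sigma_finite)

lemma sets_gaussian [measurable_cong]: "sets (gaussian I) = sets (PiM I (\<lambda>_. borel))"
  unfolding gaussian_def by (intro sets_PiM_cong) auto

lemma space_gaussian: "space (gaussian I) = extensional I"
  by (simp add: gaussian_def space_PiM PiE_UNIV_domain PiE_def Pi_UNIV)

lemma prob_space_gaussian: "prob_space (gaussian I)"
  unfolding gaussian_def by (rule prob_space_PiM) (rule prob_space_std_normal)

lemma emeasure_gaussian_PiE:
  "finite I \<Longrightarrow> (\<And>i. i \<in> I \<Longrightarrow> A i \<in> sets borel) \<Longrightarrow>
    emeasure (gaussian I) (Pi\<^sub>E I A) = (\<Prod>i\<in>I. emeasure std_normal (A i))"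
  unfolding gaussian_def by (rule product_sigma_finite.emeasure_PiM[OF product_sigma_finite_std_normal]) auto

lemma PiE_in_sets_gaussian:
  "finite I \<Longrightarrow> (\<And>i. i \<in> I \<Longrightarrow> A i \<in> sets borel) \<Longrightarrow> Pi\<^sub>E I A \<in> sets (gaussian I)"
  unfolding gaussian_def by (rule sets_PiM_I_finite) auto

lemma gaussian_eqI:
  assumes "finite I" "sets P = sets (gaussian I)"
    and "\<And>A. (\<And>i. i \<in> I \<Longrightarrow> A i \<in> sets borel) \<Longrightarrow>
      emeasure P (Pi\<^sub>E I A) = (\<Prod>i\<in>I. emeasure std_normal (A i))"
  shows "P = gaussian I"
  unfolding gaussian_def
  by (rule product_sigma_finite.PiM_eqI[OF product_sigma_finite_std_normal assms(1)])
     (use assms(2,3) in \<open>auto simp: gaussian_def\<close>)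

lemma gaussian_distr_eqI:
  assumes fin: "finite I" and M: "T \<in> measurable M (gaussian I)"
    and "\<And>A. (\<And>i. i \<in> I \<Longrightarrow> A i \<in> sets borel) \<Longrightarrow>
      emeasure M (T -` Pi\<^sub>E I A \<inter> space M) = (\<Prod>i\<in>I. emeasure std_normal (A i))"
  shows "distr M (gaussian I) T = gaussian I"
proof (rule gaussian_eqI[OF fin])
  fix A :: "'a \<Rightarrow> real set" assume A: "\<And>i. i \<in> I \<Longrightarrow> A i \<in> sets borel"
  show "emeasure (distr M (gaussian I) T) (Pi\<^sub>E I A) = (\<Prod>i\<in>I. emeasure std_normal (A i))"
    using assms(3)[OF A] by (subst emeasure_distr[OF M PiE_in_sets_gaussian[OF fin A]]) auto
qed simp

text \<open>Serves to attach a first row, and then a first column, to a smaller Gaussian matrix.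
  Boxes determine the measure, and a box in \<open>I\<close> pulls back to a product of boxes in
  \<open>J1\<close> and \<open>J2\<close>. The conditions on \<open>g\<close> fix it only on the
  images of \<open>e1\<close> and \<open>e2\<close>, so it may be given by cases on the
  index.\<close>

lemma gaussian_split:
  assumes fin: "finite J1" "finite J2" and inj: "inj_on e1 J1" "inj_on e2 J2"
    and disj: "e1 ` J1 \<inter> e2 ` J2 = {}" and I: "I = e1 ` J1 \<union> e2 ` J2"
    and g1: "\<And>x y j. j \<in> J1 \<Longrightarrow> g x y (e1 j) = x j"
    and g2: "\<And>x y j. j \<in> J2 \<Longrightarrow> g x y (e2 j) = y j"
  shows "distr (gaussian J1 \<Otimes>\<^sub>M gaussian J2) (gaussian I) (\<lambda>(x, y). restrict (g x y) I) = gaussian I"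
    and "(\<lambda>(x, y). restrict (g x y) I) \<in> measurable (gaussian J1 \<Otimes>\<^sub>M gaussian J2) (gaussian I)"
proof -
  have finI: "finite I" using fin I by simp
  interpret G1: prob_space "gaussian J1" by (rule prob_space_gaussian)
  interpret G2: prob_space "gaussian J2" by (rule prob_space_gaussian)
  show meas: "(\<lambda>(x, y). restrict (g x y) I) \<in> measurable (gaussian J1 \<Otimes>\<^sub>M gaussian J2) (gaussian I)"
    unfolding measurable_cong_sets[OF refl sets_gaussian] split_def
  proof (rule measurable_restrict)
    fix i assume "i \<in> I"
    then consider j where "j \<in> J1" "i = e1 j" | j where "j \<in> J2" "i = e2 j" using I by auto
    then show "(\<lambda>x. g (fst x) (snd x) i) \<in> borel_measurable (gaussian J1 \<Otimes>\<^sub>M gaussian J2)"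
    proof cases
      case 1
      then have *: "(\<lambda>x. g (fst x) (snd x) i) = (\<lambda>x. x j) \<circ> fst" by (auto simp: g1 fun_eq_iff)
      have "(\<lambda>x. x j) \<in> borel_measurable (gaussian J1)" using 1 by measurable
      then show ?thesis unfolding * by (rule measurable_comp[OF measurable_fst])
    next
      case 2
      then have *: "(\<lambda>x. g (fst x) (snd x) i) = (\<lambda>x. x j) \<circ> snd" by (auto simp: g2 fun_eq_iff)
      have "(\<lambda>x. x j) \<in> borel_measurable (gaussian J2)" using 2 by measurable
      then show ?thesis unfolding * by (rule measurable_comp[OF measurable_snd])
    qed
  qed
  show "distr (gaussian J1 \<Otimes>\<^sub>M gaussian J2) (gaussian I) (\<lambda>(x, y). restrict (g x y) I) = gaussian I"
  proof (rule gaussian_distr_eqI[OF finI meas])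
    fix A :: "'c \<Rightarrow> real set" assume A: "\<And>i. i \<in> I \<Longrightarrow> A i \<in> sets borel"
    have "(\<lambda>(x, y). restrict (g x y) I) -` Pi\<^sub>E I A \<inter> space (gaussian J1 \<Otimes>\<^sub>M gaussian J2)
        = Pi\<^sub>E J1 (\<lambda>j. A (e1 j)) \<times> Pi\<^sub>E J2 (\<lambda>j. A (e2 j))"
    proof -
      have "restrict (g x y) I \<in> Pi\<^sub>E I A \<longleftrightarrow> (\<forall>j\<in>J1. x j \<in> A (e1 j)) \<and> (\<forall>j\<in>J2. y j \<in> A (e2 j))" for x y
        by (simp add: PiE_def Pi_iff I ball_Un g1 g2)
      then show ?thesis
        unfolding space_pair_measure space_gaussian by (auto simp: PiE_def Pi_iff)
    qed
    also have "emeasure (gaussian J1 \<Otimes>\<^sub>M gaussian J2) \<dots>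
        = emeasure (gaussian J1) (Pi\<^sub>E J1 (\<lambda>j. A (e1 j))) * emeasure (gaussian J2) (Pi\<^sub>E J2 (\<lambda>j. A (e2 j)))"
      using A I by (intro G2.emeasure_pair_measure_Times PiE_in_sets_gaussian fin) auto
    also have "\<dots> = (\<Prod>j\<in>J1. emeasure std_normal (A (e1 j))) * (\<Prod>j\<in>J2. emeasure std_normal (A (e2 j)))"
      using A I fin by (subst (1 2) emeasure_gaussian_PiE) auto
    also have "\<dots> = (\<Prod>i\<in>I. emeasure std_normal (A i))"
      unfolding I using fin disj inj by (subst prod.union_disjoint) (auto simp: prod.reindex)
    finally show "emeasure (gaussian J1 \<Otimes>\<^sub>M gaussian J2)
        ((\<lambda>(x, y). restrict (g x y) I) -` Pi\<^sub>E I A \<inter> space (gaussian J1 \<Otimes>\<^sub>M gaussian J2))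
        = (\<Prod>i\<in>I. emeasure std_normal (A i))" .
  qed
qed

section \<open>Rotations of the plane\<close>

lemma distr_comp_invariant:
  assumes "f \<in> measurable M M" "g \<in> measurable M M" "distr M M f = M" "distr M M g = M"
  shows "distr M M (g \<circ> f) = M"
  using distr_distr[OF assms(2,1)] assms(3,4) by simp

text \<open>When one coordinate is held fixed, a shear is a translation of the other, so Fubini
  reduces the claim to translation invariance on the line.\<close>

lemma lborel_shear:
  "distr (lborel \<Otimes>\<^sub>M lborel) (lborel \<Otimes>\<^sub>M lborel) (\<lambda>(x, y). (x + t * y, y)) = lborel \<Otimes>\<^sub>M (lborel :: real measure)"
  "distr (lborel \<Otimes>\<^sub>M lborel) (lborel \<Otimes>\<^sub>M lborel) (\<lambda>(x, y). (x, y + t * x)) = lborel \<Otimes>\<^sub>M (lborel :: real measure)"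
proof -
  have shift: "(\<integral>\<^sup>+x. f (x + c) \<partial>lborel) = (\<integral>\<^sup>+x. f x \<partial>lborel)" if "f \<in> borel_measurable borel" for f and c :: real
    using that nn_integral_real_affine[of f 1 c] by (simp add: add.commute)
  let ?L = "lborel \<Otimes>\<^sub>M lborel :: (real \<times> real) measure"
  show "distr ?L ?L (\<lambda>(x, y). (x + t * y, y)) = ?L"
  proof (rule measure_eqI)
    let ?S = "\<lambda>(x, y). (x + t * y, y)"
    fix A assume "A \<in> sets (distr ?L ?L ?S)"
    then have A: "A \<in> sets ?L" by simp
    have S: "?S \<in> measurable ?L ?L" by measurable
    have ind: "indicator A \<in> borel_measurable ?L" using A by (rule borel_measurable_indicator)
    have F: "(\<lambda>z. indicator A (?S z) :: ennreal) \<in> borel_measurable ?L"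
      by (rule measurable_compose[OF S ind])
    have "emeasure (distr ?L ?L ?S) A = (\<integral>\<^sup>+z. indicator A z \<partial>distr ?L ?L ?S)"
      using A by simp
    also have "\<dots> = (\<integral>\<^sup>+z. indicator A (?S z) \<partial>?L)"
      by (rule nn_integral_distr[OF S]) (simp add: ind)
    also have "\<dots> = (\<integral>\<^sup>+y. \<integral>\<^sup>+x. indicator A (x + t * y, y) \<partial>lborel \<partial>lborel)"
      using lborel_pair.nn_integral_snd[OF F] by simp
    also have "\<dots> = (\<integral>\<^sup>+y. \<integral>\<^sup>+x. indicator A (x, y) \<partial>lborel \<partial>lborel)"
    proof (rule nn_integral_cong)
      fix y
      have "(\<lambda>x. indicator A (x, y) :: ennreal) \<in> borel_measurable borel"
        using measurable_compose[OF measurable_Pair2' ind, of y] by simp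
      from shift[OF this] show "(\<integral>\<^sup>+x. indicator A (x + t * y, y) \<partial>lborel) = (\<integral>\<^sup>+x. indicator A (x, y) \<partial>lborel :: ennreal)" .
    qed
    also have "\<dots> = emeasure ?L A"
      using lborel_pair.nn_integral_snd[OF ind] A by simp
    finally show "emeasure (distr ?L ?L ?S) A = emeasure ?L A" .
  qed simp
  show "distr ?L ?L (\<lambda>(x, y). (x, y + t * x)) = ?L"
  proof (rule measure_eqI)
    let ?S = "\<lambda>(x, y). (x, y + t * x)"
    fix A assume "A \<in> sets (distr ?L ?L ?S)"
    then have A: "A \<in> sets ?L" by simp
    have S: "?S \<in> measurable ?L ?L" by measurable
    have ind: "indicator A \<in> borel_measurable ?L" using A by (rule borel_measurable_indicator)
    have F: "(\<lambda>z. indicator A (?S z) :: ennreal) \<in> borel_measurable ?L"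
      by (rule measurable_compose[OF S ind])
    have "emeasure (distr ?L ?L ?S) A = (\<integral>\<^sup>+z. indicator A z \<partial>distr ?L ?L ?S)"
      using A by simp
    also have "\<dots> = (\<integral>\<^sup>+z. indicator A (?S z) \<partial>?L)"
      by (rule nn_integral_distr[OF S]) (simp add: ind)
    also have "\<dots> = (\<integral>\<^sup>+x. \<integral>\<^sup>+y. indicator A (x, y + t * x) \<partial>lborel \<partial>lborel)"
      using lborel.nn_integral_fst[OF F] by simp
    also have "\<dots> = (\<integral>\<^sup>+x. \<integral>\<^sup>+y. indicator A (x, y) \<partial>lborel \<partial>lborel)"
    proof (rule nn_integral_cong)
      fix x
      have "(\<lambda>y. indicator A (x, y) :: ennreal) \<in> borel_measurable borel"
        using measurable_compose[OF measurable_Pair1' ind, of x] by simp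
      from shift[OF this] show "(\<integral>\<^sup>+y. indicator A (x, y + t * x) \<partial>lborel) = (\<integral>\<^sup>+y. indicator A (x, y) \<partial>lborel :: ennreal)" .
    qed
    also have "\<dots> = emeasure ?L A"
      using lborel.nn_integral_fst[OF ind] A by simp
    finally show "emeasure (distr ?L ?L ?S) A = emeasure ?L A" .
  qed simp
qed

text \<open>A rotation by an angle other than \<open>\<pi>\<close> is a product of three shears.\<close>

lemma lborel_rotation:
  fixes c s :: real
  assumes cs: "c\<^sup>2 + s\<^sup>2 = 1"
  shows "distr (lborel \<Otimes>\<^sub>M lborel) (lborel \<Otimes>\<^sub>M lborel) (\<lambda>(x, y). (c * x - s * y, s * x + c * y)) = lborel \<Otimes>\<^sub>M lborel"
proof -
  let ?L = "lborel \<Otimes>\<^sub>M lborel :: (real \<times> real) measure"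
  define R where "R c s = (\<lambda>(x, y). (c * x - s * y, s * x + c * y) :: real \<times> real)" for c s :: real
  have Rm: "R c s \<in> measurable ?L ?L" for c s unfolding R_def by measurable
  have main: "distr ?L ?L (R c s) = ?L" if cs: "c\<^sup>2 + s\<^sup>2 = 1" and c: "c \<noteq> -1" for c s
  proof -
    \<comment> \<open>\<open>t\<close> is \<open>- tan (\<theta> / 2)\<close> for the angle with
      \<open>c = cos \<theta>\<close> and \<open>s = sin \<theta>\<close>; this is where
      \<open>c = -1\<close> has to be excluded.\<close>
    define t where "t = - s / (1 + c)"
    have t1: "1 + t * s = c" "t * (1 + c) = - s"
      using c cs by (auto simp: t_def field_simps power2_eq_square add_eq_0_iff)
    then have t2: "t * (2 + t * s) = - s" by (metis (no_types, lifting) ab_semigroup_add_class.add_ac(1) one_add_one)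
    have m: "(\<lambda>(x, y). (x + t * y, y)) \<in> measurable ?L ?L" "(\<lambda>(x, y). (x, y + s * x)) \<in> measurable ?L ?L"
      by measurable
    have "R c s = (\<lambda>(x, y). (x + t * y, y)) \<circ> ((\<lambda>(x, y). (x, y + s * x)) \<circ> (\<lambda>(x, y). (x + t * y, y)))"
    proof
      fix z :: "real \<times> real"
      obtain x y where z: "z = (x, y)" by fastforce
      have "c * x - s * y = (1 + t * s) * x + t * (2 + t * s) * y" unfolding t1 t2 by simp
      moreover have "s * x + c * y = s * x + (1 + t * s) * y" unfolding t1 by simp
      ultimately show "R c s z = ((\<lambda>(x, y). (x + t * y, y)) \<circ> ((\<lambda>(x, y). (x, y + s * x)) \<circ> (\<lambda>(x, y). (x + t * y, y)))) z"
        by (simp add: R_def z algebra_simps)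
    qed
    then show ?thesis
      by (metis (no_types, lifting) m measurable_comp distr_comp_invariant lborel_shear)
  qed
  have "distr ?L ?L (R c s) = ?L"
  proof (cases "c = -1")
    case True
    then have "s = 0" using cs by simp
    \<comment> \<open>The half turn is the square of a quarter turn.\<close>
    have "R c s = R 0 1 \<circ> R 0 1" by (auto simp: R_def True \<open>s = 0\<close>)
    then show ?thesis using main[of 0 1] Rm distr_comp_invariant[of "R 0 1" ?L "R 0 1"] by simp
  qed (use main cs in auto)
  then show ?thesis by (simp add: R_def)
qed

text \<open>The product density depends only on \<open>x\<^sup>2 + y\<^sup>2\<close>, so it is
  constant along rotations, which already preserve Lebesgue measure.\<close>

lemma std_normal_rotation:
  fixes c s :: real
  assumes cs: "c\<^sup>2 + s\<^sup>2 = 1"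
  shows "distr (std_normal \<Otimes>\<^sub>M std_normal) (std_normal \<Otimes>\<^sub>M std_normal)
      (\<lambda>(x, y). (c * x - s * y, s * x + c * y)) = std_normal \<Otimes>\<^sub>M std_normal"
proof -
  let ?L = "lborel \<Otimes>\<^sub>M lborel :: (real \<times> real) measure"
  define T where "T = (\<lambda>(x, y). (c * x - s * y, s * x + c * y) :: real \<times> real)"
  have T: "T \<in> measurable ?L ?L" unfolding T_def by measurable
  define f where "f = (\<lambda>(x, y). ennreal (std_normal_density x) * ennreal (std_normal_density y))"
  have f: "f \<in> borel_measurable ?L" unfolding f_def by measurable
  have N: "std_normal \<Otimes>\<^sub>M std_normal = density ?L f"
    unfolding f_def
    by (rule pair_measure_density) (auto intro: sigma_finite_std_normal lborel.sigma_finite_measure_axioms)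
  have fT: "f (T z) = f z" for z
  proof -
    obtain x y where z: "z = (x, y)" by fastforce
    have "(c * x - s * y)\<^sup>2 + (s * x + c * y)\<^sup>2 = (c\<^sup>2 + s\<^sup>2) * (x\<^sup>2 + y\<^sup>2)"
      by (simp add: power2_eq_square algebra_simps)
    then have q: "(c * x - s * y)\<^sup>2 + (s * x + c * y)\<^sup>2 = x\<^sup>2 + y\<^sup>2" using cs by simp
    have p: "ennreal (std_normal_density u) * ennreal (std_normal_density v)
        = ennreal (exp (- (u\<^sup>2 + v\<^sup>2) / 2) / (sqrt (2 * pi))\<^sup>2)" for u v
      by (simp add: std_normal_density_def exp_add[symmetric] power2_eq_square add_divide_distrib
        ennreal_mult[symmetric])
    show ?thesis unfolding f_def T_def z split p q ..
  qed
  have "distr (density ?L f) ?L T = distr (density ?L (\<lambda>z. f (T z))) ?L T" by (simp add: fT)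
  also have "\<dots> = density (distr ?L ?L T) f" by (rule density_distr[symmetric]) (use f T in auto)
  also have "distr ?L ?L T = ?L" unfolding T_def by (rule lborel_rotation[OF cs])
  finally have "distr (density ?L f) ?L T = density ?L f" .
  then show ?thesis unfolding N T_def[symmetric] by (subst distr_cong[OF refl _ refl, of _ ?L]) auto
qed

section \<open>Linear isometries of Gaussian coordinates\<close>

text \<open>Coordinate maps such as rotations and reflections are given on all functions, whereas
  the product space consists of functions undefined off \<open>I\<close>; hence the
  \<open>restrict\<close>. Accordingly \<open>linear_on\<close> and \<open>isometry_on\<close> look
  only at coordinates in \<open>I\<close>.\<close>

definition preserves :: "'i set \<Rightarrow> (('i \<Rightarrow> real) \<Rightarrow> 'i \<Rightarrow> real) \<Rightarrow> bool" where
  "preserves I T \<longleftrightarrow> (\<lambda>f. restrict (T f) I) \<in> measurable (gaussian I) (gaussian I) \<and>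
     distr (gaussian I) (gaussian I) (\<lambda>f. restrict (T f) I) = gaussian I"

definition linear_on :: "'i set \<Rightarrow> (('i \<Rightarrow> real) \<Rightarrow> 'i \<Rightarrow> real) \<Rightarrow> bool" where
  "linear_on I T \<longleftrightarrow> (\<exists>A. \<forall>f. \<forall>i\<in>I. T f i = (\<Sum>j\<in>I. A i j * f j))"

definition isometry_on :: "'i set \<Rightarrow> (('i \<Rightarrow> real) \<Rightarrow> 'i \<Rightarrow> real) \<Rightarrow> bool" where
  "isometry_on I T \<longleftrightarrow> linear_on I T \<and> (\<forall>f. (\<Sum>i\<in>I. (T f i)\<^sup>2) = (\<Sum>i\<in>I. (f i)\<^sup>2))"

lemma linear_onI:
  assumes fin: "finite I"
    and add: "\<And>f g i. i \<in> I \<Longrightarrow> T (\<lambda>j. f j + g j) i = T f i + T g i"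
    and scale: "\<And>f c i. i \<in> I \<Longrightarrow> T (\<lambda>j. c * f j) i = c * T f i"
    and cong: "\<And>f g i. i \<in> I \<Longrightarrow> (\<And>j. j \<in> I \<Longrightarrow> f j = g j) \<Longrightarrow> T f i = T g i"
  shows "linear_on I T"
proof -
  define e where "e j = (\<lambda>i. if i = j then 1 else 0 :: real)" for j :: 'a
  have *: "T (\<lambda>i. if i \<in> J then f i else 0) i = (\<Sum>j\<in>J. T (e j) i * f j)"
    if "finite J" "i \<in> I" for J f i
    using that
  proof (induction J rule: finite_induct)
    case empty
    show ?case using scale[of i 0 "\<lambda>_. 0"] empty by simp
  next
    case (insert k J)
    have "(\<lambda>i. if i \<in> insert k J then f i else 0) = (\<lambda>i. f k * e k i + (if i \<in> J then f i else 0))"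
      using insert(2) by (auto simp: e_def fun_eq_iff)
    then show ?case using insert add[of i] scale[of i] by (simp add: mult.commute)
  qed
  have main: "T f i = (\<Sum>j\<in>I. T (e j) i * f j)" if "i \<in> I" for f i
    using *[OF fin that, of f] cong[OF that, of f "\<lambda>i. if i \<in> I then f i else 0"] by simp
  show ?thesis unfolding linear_on_def
    by (intro exI[of _ "\<lambda>i j. T (e j) i"] allI ballI) (rule main)
qed

lemma linear_on_cong:
  assumes "linear_on I T" "i \<in> I" "\<And>j. j \<in> I \<Longrightarrow> f j = g j"
  shows "T f i = T g i"
proof -
  obtain A where A: "\<And>f. T f i = (\<Sum>j\<in>I. A i j * f j)"
    using assms(1,2) unfolding linear_on_def by blast
  show ?thesis unfolding A using assms(3) by (intro sum.cong) auto
qed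

lemma linear_on_comp:
  assumes "linear_on I S" "linear_on I T"
  shows "linear_on I (\<lambda>f. S (T f))"
proof -
  obtain A B where A: "\<And>f i. i \<in> I \<Longrightarrow> S f i = (\<Sum>j\<in>I. A i j * f j)"
    and B: "\<And>f i. i \<in> I \<Longrightarrow> T f i = (\<Sum>j\<in>I. B i j * f j)"
    using assms unfolding linear_on_def by metis
  have "S (T f) i = (\<Sum>k\<in>I. (\<Sum>j\<in>I. A i j * B j k) * f k)" if "i \<in> I" for f i
    unfolding A[OF that] using B
    by (simp add: sum_distrib_left sum_distrib_right mult.assoc) (rule sum.swap)
  then show ?thesis unfolding linear_on_def by (intro exI[of _ "\<lambda>i k. \<Sum>j\<in>I. A i j * B j k"]) blast
qed

lemma isometry_on_comp:
  assumes "isometry_on I S" "isometry_on I T"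
  shows "isometry_on I (\<lambda>f. S (T f))"
proof -
  have "linear_on I (\<lambda>f. S (T f))" using assms linear_on_comp unfolding isometry_on_def by blast
  then show ?thesis using assms unfolding isometry_on_def by simp
qed

lemma measurable_linear_on:
  assumes "linear_on I T"
  shows "(\<lambda>f. restrict (T f) I) \<in> measurable (gaussian I) (gaussian I)"
proof -
  obtain A where A: "\<And>f i. i \<in> I \<Longrightarrow> T f i = (\<Sum>j\<in>I. A i j * f j)"
    using assms unfolding linear_on_def by metis
  show ?thesis
    unfolding measurable_cong_sets[OF refl sets_gaussian]
    by (rule measurable_restrict) (use A in \<open>auto simp: cong: measurable_cong\<close>)
qed

lemma preserves_comp:
  assumes S: "preserves I S" "linear_on I S" and T: "preserves I T"
  shows "preserves I (\<lambda>f. S (T f))"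
proof -
  have eq: "(\<lambda>f. restrict (S (T f)) I) = (\<lambda>f. restrict (S f) I) \<circ> (\<lambda>f. restrict (T f) I)"
    unfolding o_def by (intro ext restrict_ext linear_on_cong[OF S(2)]) auto
  show ?thesis using S(1) T measurable_comp distr_comp_invariant unfolding preserves_def eq by blast
qed

lemma preserves_cong:
  assumes "preserves I S" "\<And>f i. i \<in> I \<Longrightarrow> T f i = S f i"
  shows "preserves I T"
proof -
  have "(\<lambda>f. restrict (T f) I) = (\<lambda>f. restrict (S f) I)" using assms(2) by (auto simp: fun_eq_iff)
  then show ?thesis using assms(1) by (simp add: preserves_def)
qed

lemma emeasure_gaussian_insert:
  assumes "finite I" "i \<notin> I" "A \<in> sets (gaussian (insert i I))"
  shows "emeasure (gaussian (insert i I)) A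
    = (\<integral>\<^sup>+f. \<integral>\<^sup>+x. indicator A (f(i := x)) \<partial>std_normal \<partial>gaussian I)"
proof -
  have "emeasure (gaussian (insert i I)) A = (\<integral>\<^sup>+f. indicator A f \<partial>gaussian (insert i I))"
    using assms(3) by simp
  also have "\<dots> = (\<integral>\<^sup>+f. \<integral>\<^sup>+x. indicator A (f(i := x)) \<partial>std_normal \<partial>gaussian I)"
    unfolding gaussian_def using assms(3)
    by (intro product_sigma_finite.product_nn_integral_insert[OF product_sigma_finite_std_normal assms(1,2)])
       (simp add: gaussian_def)
  finally show ?thesis .
qed

definition givens :: "'i \<Rightarrow> 'i \<Rightarrow> real \<Rightarrow> real \<Rightarrow> ('i \<Rightarrow> real) \<Rightarrow> 'i \<Rightarrow> real" where
  "givens a b c s f = f(a := c * f a - s * f b, b := s * f a + c * f b)"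

lemma isometry_on_givens:
  assumes fin: "finite I" and ab: "a \<in> I" "b \<in> I" "a \<noteq> b" and cs: "c\<^sup>2 + s\<^sup>2 = 1"
  shows "isometry_on I (givens a b c s)"
  unfolding isometry_on_def
proof
  show "linear_on I (givens a b c s)"
    by (rule linear_onI[OF fin]) (use ab in \<open>auto simp: givens_def algebra_simps\<close>)
  have I: "I = insert a (insert b (I - {a, b}))" using ab by auto
  show "\<forall>f. (\<Sum>i\<in>I. (givens a b c s f i)\<^sup>2) = (\<Sum>i\<in>I. (f i)\<^sup>2)"
  proof
    fix f :: "'a \<Rightarrow> real"
    have "(c * f a - s * f b)\<^sup>2 + (s * f a + c * f b)\<^sup>2 = (c\<^sup>2 + s\<^sup>2) * ((f a)\<^sup>2 + (f b)\<^sup>2)"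
      by (simp add: power2_eq_square algebra_simps)
    then have q: "(c * f a - s * f b)\<^sup>2 + (s * f a + c * f b)\<^sup>2 = (f a)\<^sup>2 + (f b)\<^sup>2" using cs by simp
    have "(\<Sum>i\<in>I - {a, b}. (givens a b c s f i)\<^sup>2) = (\<Sum>i\<in>I - {a, b}. (f i)\<^sup>2)"
      by (intro sum.cong) (auto simp: givens_def)
    then show "(\<Sum>i\<in>I. (givens a b c s f i)\<^sup>2) = (\<Sum>i\<in>I. (f i)\<^sup>2)"
      using fin ab q by (subst (1 2) I) (simp add: givens_def add.assoc[symmetric])
  qed
qed

text \<open>Fubini isolates the coordinates \<open>a\<close> and \<open>b\<close>, where the plane
  rotation preserves the product of two normal laws; the other coordinates stay as they are.\<close>

lemma preserves_givens:
  assumes fin: "finite I" and ab: "a \<in> I" "b \<in> I" "a \<noteq> b" and cs: "c\<^sup>2 + s\<^sup>2 = 1"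
  shows "preserves I (givens a b c s)"
proof -
  define J where "J = I - {a, b}"
  have I: "I = insert a (insert b J)" and J: "finite J" "b \<notin> J" "a \<notin> insert b J"
    using ab fin by (auto simp: J_def)
  define T where "T f = restrict (givens a b c s f) I" for f
  have lin: "linear_on I (givens a b c s)" using isometry_on_givens[OF assms] by (simp add: isometry_on_def)
  have T: "T \<in> measurable (gaussian I) (gaussian I)"
    unfolding T_def[abs_def] by (rule measurable_linear_on[OF lin])
  interpret N: prob_space std_normal by (rule prob_space_std_normal)
  interpret NN: pair_prob_space std_normal std_normal ..
  have "distr (gaussian I) (gaussian I) T = gaussian I"
  proof (rule gaussian_distr_eqI[OF fin T])
    fix A :: "'a \<Rightarrow> real set" assume A: "\<And>i. i \<in> I \<Longrightarrow> A i \<in> sets borel"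
    have Aab [measurable]: "A a \<in> sets borel" "A b \<in> sets borel" using A ab by auto
    define B where "B = T -` Pi\<^sub>E I A \<inter> space (gaussian I)"
    have B: "B \<in> sets (gaussian I)"
      unfolding B_def by (rule measurable_sets[OF T PiE_in_sets_gaussian[OF fin A]])
    \<comment> \<open>Of the two inner variables the outer one is \<open>y\<close>, for coordinate
      \<open>b\<close>. In the order \<open>(y, x)\<close> the rotation has the opposite angle,
      hence \<open>- s\<close>.\<close>
    have ind: "indicator B (f(b := y, a := x)) = indicator (Pi\<^sub>E J A) f *
        (indicator (A b \<times> A a) (c * y - (- s) * x, (- s) * y + c * x) :: ennreal)"
      if "f \<in> space (gaussian J)" for f x y
    proof -
      have "f \<in> extensional J" using that by (simp add: space_gaussian)
      then have "f(b := y, a := x) \<in> B \<longleftrightarrow> f \<in> Pi\<^sub>E J A \<and> c * x - s * y \<in> A a \<and> s * x + c * y \<in> A b"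
        unfolding B_def T_def space_gaussian using ab(3) J
        by (auto simp: I givens_def PiE_def Pi_iff extensional_def)
      then show ?thesis by (auto simp: indicator_def algebra_simps)
    qed
    have "emeasure (gaussian I) B = (\<integral>\<^sup>+g. \<integral>\<^sup>+x. indicator B (g(a := x)) \<partial>std_normal \<partial>gaussian (insert b J))"
      using J B unfolding I by (intro emeasure_gaussian_insert) auto
    also have "\<dots> = (\<integral>\<^sup>+f. \<integral>\<^sup>+y. \<integral>\<^sup>+x. indicator B (f(b := y, a := x)) \<partial>std_normal \<partial>std_normal \<partial>gaussian J)"
      unfolding gaussian_def
    proof (rule product_sigma_finite.product_nn_integral_insert[OF product_sigma_finite_std_normal J(1,2)])
      have [measurable]: "B \<in> sets (PiM (insert a (insert b J)) (\<lambda>_. std_normal))"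
        using B unfolding I gaussian_def .
      have "(\<lambda>z. (fst z)(a := snd z)) \<in> measurable (PiM (insert b J) (\<lambda>_. std_normal) \<Otimes>\<^sub>M std_normal) (PiM (insert a (insert b J)) (\<lambda>_. std_normal))"
        by (rule measurable_fun_upd[where J = "insert b J"]) auto
      then show "(\<lambda>g. \<integral>\<^sup>+x. indicator B (g(a := x)) \<partial>std_normal) \<in> borel_measurable (PiM (insert b J) (\<lambda>_. std_normal))"
        by (intro N.borel_measurable_nn_integral) (simp add: split_def, measurable)
    qed
    also have "\<dots> = (\<integral>\<^sup>+f. indicator (Pi\<^sub>E J A) f *
        (\<integral>\<^sup>+y. \<integral>\<^sup>+x. indicator (A b \<times> A a) (c * y - (- s) * x, (- s) * y + c * x) \<partial>std_normal \<partial>std_normal) \<partial>gaussian J)"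
    proof (intro nn_integral_cong)
      fix f assume f: "f \<in> space (gaussian J)"
      show "(\<integral>\<^sup>+y. \<integral>\<^sup>+x. indicator B (f(b := y, a := x)) \<partial>std_normal \<partial>std_normal)
          = indicator (Pi\<^sub>E J A) f *
            (\<integral>\<^sup>+y. \<integral>\<^sup>+x. indicator (A b \<times> A a) (c * y - (- s) * x, (- s) * y + c * x) \<partial>std_normal \<partial>std_normal)"
        unfolding ind[OF f] by (auto split: split_indicator)
    qed
    also have "(\<integral>\<^sup>+y. \<integral>\<^sup>+x. indicator (A b \<times> A a) (c * y - (- s) * x, (- s) * y + c * x) \<partial>std_normal \<partial>std_normal)
        = (\<integral>\<^sup>+z. indicator (A b \<times> A a) ((\<lambda>(y, x). (c * y - (- s) * x, (- s) * y + c * x)) z) \<partial>(std_normal \<Otimes>\<^sub>M std_normal))"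
      by (subst N.nn_integral_fst[symmetric]) (auto simp: split_def)
    also have "\<dots> = (\<integral>\<^sup>+z. indicator (A b \<times> A a) z \<partial>distr (std_normal \<Otimes>\<^sub>M std_normal) (std_normal \<Otimes>\<^sub>M std_normal)
        (\<lambda>(y, x). (c * y - (- s) * x, (- s) * y + c * x)))"
      by (subst nn_integral_distr) auto
    also have "\<dots> = emeasure std_normal (A b) * emeasure std_normal (A a)"
      using cs by (subst std_normal_rotation) (auto simp: N.emeasure_pair_measure_Times)
    also have "(\<integral>\<^sup>+f. indicator (Pi\<^sub>E J A) f * (emeasure std_normal (A b) * emeasure std_normal (A a)) \<partial>gaussian J)
        = emeasure (gaussian J) (Pi\<^sub>E J A) * (emeasure std_normal (A b) * emeasure std_normal (A a))"
      using PiE_in_sets_gaussian[OF J(1), of A] A I by (subst nn_integral_multc) auto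
    also have "\<dots> = (\<Prod>i\<in>I. emeasure std_normal (A i))"
      using J A by (subst emeasure_gaussian_PiE) (auto simp: I mult_ac)
    finally show "emeasure (gaussian I) (T -` Pi\<^sub>E I A \<inter> space (gaussian I)) = (\<Prod>i\<in>I. emeasure std_normal (A i))"
      by (simp add: B_def)
  qed
  then show ?thesis using T by (simp add: preserves_def T_def[abs_def])
qed

lemma std_normal_symmetric:
  assumes A: "A \<in> sets borel"
  shows "emeasure std_normal {x. - x \<in> A} = emeasure std_normal A"
proof -
  have m: "(\<lambda>x. ennreal (std_normal_density x) * indicator A x) \<in> borel_measurable borel"
    using A by measurable
  have "{x. - x \<in> A} = uminus -` A \<inter> space borel" by auto
  also have "\<dots> \<in> sets borel" using A by (intro measurable_sets[OF borel_measurable_uminus]) auto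
  finally have A': "{x. - x \<in> A} \<in> sets borel" .
  have "emeasure std_normal {x. - x \<in> A} = (\<integral>\<^sup>+x. ennreal (std_normal_density x) * indicator {x. - x \<in> A} x \<partial>lborel)"
    using A' by (simp add: emeasure_density)
  also have "\<dots> = (\<integral>\<^sup>+x. ennreal (std_normal_density (- x)) * indicator A (- x) \<partial>lborel)"
    by (intro nn_integral_cong) (auto simp: std_normal_density_def indicator_def)
  also have "\<dots> = (\<integral>\<^sup>+x. ennreal (std_normal_density x) * indicator A x \<partial>distr lborel borel uminus)"
    using m by (subst nn_integral_distr) auto
  also have "\<dots> = emeasure std_normal A" using A by (simp add: lborel_distr_uminus emeasure_density)
  finally show ?thesis .
qed

text \<open>Fubini splits off coordinate \<open>a\<close>, and a sign there is harmless because the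
  normal law is symmetric. The induction for isometries applies it twice: to a reflection of the
  other coordinates, with \<sigma> = 1, and to the isometry that fixes \<open>a\<close> up to
  sign.\<close>

lemma preserves_extend:
  assumes fin: "finite J" "a \<notin> J" and S: "preserves J S" "linear_on J S"
    and T: "linear_on (insert a J) T" "\<And>f i. i \<in> J \<Longrightarrow> T f i = S f i"
      "\<And>f. T f a = \<sigma> * f a" and \<sigma>: "\<sigma> = 1 \<or> \<sigma> = (-1::real)"
  shows "preserves (insert a J) T"
proof -
  let ?I = "insert a J"
  define T' where "T' f = restrict (T f) ?I" for f
  define S' where "S' f = restrict (S f) J" for f
  have T'm: "T' \<in> measurable (gaussian ?I) (gaussian ?I)"
    unfolding T'_def[abs_def] by (rule measurable_linear_on[OF T(1)])
  have S'm: "S' \<in> measurable (gaussian J) (gaussian J)" and S'd: "distr (gaussian J) (gaussian J) S' = gaussian J"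
    using S(1) unfolding preserves_def S'_def[abs_def] by auto
  have "distr (gaussian ?I) (gaussian ?I) T' = gaussian ?I"
  proof (rule gaussian_distr_eqI[OF _ T'm])
    fix A :: "'a \<Rightarrow> real set" assume A: "\<And>i. i \<in> ?I \<Longrightarrow> A i \<in> sets borel"
    define B where "B = T' -` Pi\<^sub>E ?I A \<inter> space (gaussian ?I)"
    define C where "C = S' -` Pi\<^sub>E J A \<inter> space (gaussian J)"
    define D where "D = {x. \<sigma> * x \<in> A a}"
    have B: "B \<in> sets (gaussian ?I)"
      unfolding B_def using fin by (intro measurable_sets[OF T'm PiE_in_sets_gaussian[OF _ A]]) auto
    have PJ: "Pi\<^sub>E J A \<in> sets (gaussian J)" using A by (intro PiE_in_sets_gaussian fin) auto
    have C: "C \<in> sets (gaussian J)" unfolding C_def by (rule measurable_sets[OF S'm PJ])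
    have eC: "emeasure (gaussian J) C = emeasure (gaussian J) (Pi\<^sub>E J A)"
      unfolding C_def using emeasure_distr[OF S'm PJ] S'd by simp
    have D: "D \<in> sets std_normal" "emeasure std_normal D = emeasure std_normal (A a)"
    proof -
      have "D = (\<lambda>x. \<sigma> * x) -` A a \<inter> space borel" by (auto simp: D_def)
      also have "\<dots> \<in> sets borel" using A by (intro measurable_sets[of _ borel borel]) auto
      finally show "D \<in> sets std_normal" by simp
      show "emeasure std_normal D = emeasure std_normal (A a)"
        using \<sigma> std_normal_symmetric[of "A a"] A by (auto simp: D_def)
    qed
    have ind: "indicator B (f(a := x)) = (indicator C f * indicator D x :: ennreal)"
      if "f \<in> space (gaussian J)" for f x
    proof -
      have fe: "f \<in> extensional J" using that by (simp add: space_gaussian)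
      have "S (f(a := x)) i = S f i" if "i \<in> J" for i
        using fin by (intro linear_on_cong[OF S(2) that]) auto
      then have "T' (f(a := x)) \<in> Pi\<^sub>E ?I A \<longleftrightarrow> S' f \<in> Pi\<^sub>E J A \<and> \<sigma> * x \<in> A a"
        unfolding T'_def S'_def using T(2,3) fin by (auto simp: PiE_def Pi_iff)
      moreover have "f(a := x) \<in> extensional ?I" using fe by (auto simp: extensional_def)
      ultimately show ?thesis
        using that by (auto simp: B_def C_def D_def space_gaussian indicator_def)
    qed
    have "emeasure (gaussian ?I) B = (\<integral>\<^sup>+f. \<integral>\<^sup>+x. indicator C f * indicator D x \<partial>std_normal \<partial>gaussian J)"
      using emeasure_gaussian_insert[OF fin B] by (simp add: ind cong: nn_integral_cong)
    also have "\<dots> = emeasure (gaussian J) C * emeasure std_normal D"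
      using C D(1) by (simp add: nn_integral_cmult nn_integral_multc)
    also have "\<dots> = (\<Prod>i\<in>?I. emeasure std_normal (A i))"
      unfolding eC D(2) using A fin by (subst emeasure_gaussian_PiE) (auto simp: mult.commute)
    finally show "emeasure (gaussian ?I) (T' -` Pi\<^sub>E ?I A \<inter> space (gaussian ?I)) = (\<Prod>i\<in>?I. emeasure std_normal (A i))"
      by (simp add: B_def)
  qed (use fin in auto)
  then show ?thesis using T'm by (simp add: preserves_def T'_def[abs_def])
qed

lemma preserves_id: "preserves I (\<lambda>f. f)"
proof -
  have "restrict f I = f" if "f \<in> space (gaussian I)" for f
    using that by (simp add: space_gaussian extensional_restrict)
  then show ?thesis
    unfolding preserves_def
    by (auto intro!: measurable_cong[THEN iffD2, OF _ measurable_ident_sets] distr_cong[THEN trans, OF refl refl _ distr_id])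
qed

text \<open>Polarisation of the norm identity, applied to \<open>f + g\<close>.\<close>

lemma isometry_on_inner:
  assumes "isometry_on I T"
  shows "(\<Sum>i\<in>I. T f i * T g i) = (\<Sum>i\<in>I. f i * g i)"
proof -
  obtain A where A: "\<And>f i. i \<in> I \<Longrightarrow> T f i = (\<Sum>j\<in>I. A i j * f j)"
    using assms unfolding isometry_on_def linear_on_def by metis
  have n: "(\<Sum>i\<in>I. (T f i)\<^sup>2) = (\<Sum>i\<in>I. (f i)\<^sup>2)" for f
    using assms by (simp add: isometry_on_def)
  have "T (\<lambda>j. f j + g j) i = T f i + T g i" if "i \<in> I" for i
    by (simp add: A[OF that] algebra_simps sum.distrib)
  then have "(\<Sum>i\<in>I. (T f i + T g i)\<^sup>2) = (\<Sum>i\<in>I. (f i + g i)\<^sup>2)"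
    using n[of "\<lambda>j. f j + g j"] by simp
  then have "(\<Sum>i\<in>I. (T f i)\<^sup>2) + (\<Sum>i\<in>I. (T g i)\<^sup>2) + 2 * (\<Sum>i\<in>I. T f i * T g i)
      = (\<Sum>i\<in>I. (f i)\<^sup>2) + (\<Sum>i\<in>I. (g i)\<^sup>2) + 2 * (\<Sum>i\<in>I. f i * g i)"
    by (simp add: power2_sum sum.distrib sum_distrib_left mult.assoc)
  then show ?thesis by (simp add: n)
qed

text \<open>The reflection in the hyperplane orthogonal to \<open>u\<close>. If \<open>u\<close>
  vanishes on \<open>J\<close>, the convention \<open>x / 0 = 0\<close> makes it the identity, which
  covers a vector already in its final position.\<close>

definition reflect :: "'i set \<Rightarrow> ('i \<Rightarrow> real) \<Rightarrow> ('i \<Rightarrow> real) \<Rightarrow> 'i \<Rightarrow> real" where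
  "reflect J u f i = f i - 2 * (\<Sum>j\<in>J. u j * f j) / (\<Sum>j\<in>J. (u j)\<^sup>2) * u i"

lemma reflect:
  assumes fin: "finite J"
  shows "isometry_on J (reflect J u)" and "reflect J u (reflect J u f) i = f i"
proof -
  define q where "q = (\<Sum>j\<in>J. (u j)\<^sup>2)"
  define p where "p f = (\<Sum>j\<in>J. u j * f j)" for f
  have R: "reflect J u f i = f i - 2 * p f / q * u i" for f i by (simp add: reflect_def p_def q_def)
  have lin: "linear_on J (reflect J u)"
    by (rule linear_onI[OF fin])
       (auto simp: reflect_def sum.distrib sum_distrib_left add_divide_distrib algebra_simps cong: sum.cong)
  have u0: "p f = 0" if "q = 0" for f
  proof -
    have "\<forall>j\<in>J. u j = 0" using that fin by (simp add: q_def sum_nonneg_eq_0_iff)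
    then show ?thesis by (simp add: p_def)
  qed
  have pR: "p (reflect J u f) = - p f" for f
  proof (cases "q = 0")
    case False
    have "p (\<lambda>i. f i - k * u i) = p f - k * q" for k
      by (simp add: p_def q_def right_diff_distrib sum_subtractf sum_distrib_left power2_eq_square ac_simps)
    from this[of "2 * p f / q"] show ?thesis using False by (simp add: R[abs_def])
  qed (simp add: u0)
  show "reflect J u (reflect J u f) i = f i"
    unfolding R[of "reflect J u f"] pR by (simp add: R)
  have "(\<Sum>i\<in>J. (reflect J u f i)\<^sup>2) = (\<Sum>i\<in>J. (f i)\<^sup>2)" for f
  proof -
    have "(\<Sum>i\<in>J. (reflect J u f i)\<^sup>2)
        = (\<Sum>i\<in>J. (f i)\<^sup>2 - (4 * p f / q) * (u i * f i) + (2 * p f / q)\<^sup>2 * (u i)\<^sup>2)"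
      unfolding R by (intro sum.cong) (auto simp: power2_eq_square algebra_simps)
    also have "\<dots> = (\<Sum>i\<in>J. (f i)\<^sup>2) - (4 * p f / q) * p f + (2 * p f / q)\<^sup>2 * q"
      by (simp add: sum.distrib sum_subtractf sum_distrib_left p_def q_def)
    also have "\<dots> = (\<Sum>i\<in>J. (f i)\<^sup>2)" by (simp add: power2_eq_square)
    finally show ?thesis .
  qed
  with lin show "isometry_on J (reflect J u)" by (simp add: isometry_on_def)
qed

text \<open>Two vectors of equal norm are exchanged by the reflection along their difference
  \<open>u\<close>: equality of the norms gives \<open>q = 2 * p\<close> for the squared norm
  \<open>q\<close> of \<open>u\<close> and its inner product \<open>p\<close> with \<open>w\<close>,
  so exactly \<open>u\<close> is subtracted from \<open>w\<close>.\<close>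

lemma reflect_to_axis:
  assumes fin: "finite J" and b: "b \<in> J" and r: "r\<^sup>2 = (\<Sum>j\<in>J. (w j)\<^sup>2)" and i: "i \<in> J"
  defines "u \<equiv> \<lambda>j. w j - (if j = b then r else 0)"
  shows "reflect J u w i = (if i = b then r else 0)"
proof -
  define q where "q = (\<Sum>j\<in>J. (u j)\<^sup>2)"
  define p where "p = (\<Sum>j\<in>J. u j * w j)"
  have sb: "(\<Sum>j\<in>J. (if j = b then r else 0) * w j) = r * w b"
    using fin b by (simp add: if_distrib[of "\<lambda>x. x * _"] cong: if_cong)
  have p: "p = r\<^sup>2 - r * w b"
    unfolding p_def u_def left_diff_distrib sum_subtractf sb using r by (simp add: power2_eq_square)
  have "q = (\<Sum>j\<in>J. (w j)\<^sup>2 - 2 * ((if j = b then r else 0) * w j) + (if j = b then r\<^sup>2 else 0))"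
    unfolding q_def u_def by (intro sum.cong) (auto simp: power2_eq_square algebra_simps)
  also have "\<dots> = r\<^sup>2 - 2 * (r * w b) + r\<^sup>2"
    unfolding sum.distrib sum_subtractf sum_distrib_left[symmetric] sb using r fin b by simp
  finally have q: "q = 2 * p" using p by simp
  have R: "reflect J u w i = w i - 2 * p / q * u i" by (simp add: reflect_def p_def q_def)
  show ?thesis
  proof (cases "q = 0")
    case True
    then have "u i = 0" using fin i by (simp add: q_def sum_nonneg_eq_0_iff)
    then show ?thesis unfolding R by (simp add: u_def)
  next
    case False
    then have "2 * p / q = 1" using q by simp
    then show ?thesis unfolding R by (simp add: u_def)
  qed
qed

text \<open>By induction on the dimension: after a reflection of the remaining coordinates and a rotation in a
  coordinate plane the isometry fixes the coordinate \<open>a\<close> up to sign.\<close>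

theorem preserves_isometry:
  assumes "finite I" "isometry_on I T"
  shows "preserves I T"
  using assms
proof (induction I arbitrary: T rule: finite_induct)
  case empty
  interpret G: prob_space "gaussian {} :: ('a \<Rightarrow> real) measure" by (rule prob_space_gaussian)
  have lin: "linear_on {} T" by (simp add: linear_on_def)
  have "distr (gaussian {}) (gaussian {}) (\<lambda>f. restrict (T f) {}) = gaussian {}"
  proof (rule gaussian_distr_eqI[OF _ measurable_linear_on[OF lin]])
    fix A :: "'a \<Rightarrow> real set"
    have "(\<lambda>f. restrict (T f) {}) -` Pi\<^sub>E {} A \<inter> space (gaussian {}) = space (gaussian {})" by auto
    then show "emeasure (gaussian {}) ((\<lambda>f. restrict (T f) {}) -` Pi\<^sub>E {} A \<inter> space (gaussian {}))
        = (\<Prod>i\<in>{}. emeasure std_normal (A i))" by (simp add: G.emeasure_space_1)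
  qed simp
  then show ?case using measurable_linear_on[OF lin] by (simp add: preserves_def)
next
  case (insert a J)
  let ?I = "insert a J"
  have finI: "finite ?I" using insert by simp
  define e where "e = (\<lambda>i. if i = a then 1 else 0 :: real)"
  define w where "w = T e"
  have se: "(\<Sum>i\<in>?I. g i * e i) = g a" for g
    using insert(1,2) by (simp add: e_def if_distrib[of "\<lambda>x. _ * x"] cong: if_cong)
  have "(\<Sum>i\<in>?I. (w i)\<^sup>2) = (\<Sum>i\<in>?I. e i * e i)"
    using insert.prems unfolding w_def by (simp add: isometry_on_def power2_eq_square)
  then have w1: "(\<Sum>i\<in>?I. (w i)\<^sup>2) = 1" unfolding se by (simp add: e_def)
  define r where "r = sqrt (\<Sum>i\<in>J. (w i)\<^sup>2)"
  have r: "0 \<le> r" "r\<^sup>2 = (\<Sum>i\<in>J. (w i)\<^sup>2)" by (simp_all add: r_def sum_nonneg)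
  have wr: "(w a)\<^sup>2 + r\<^sup>2 = 1" using w1 insert(1,2) r by simp
  \<comment> \<open>\<open>\<rho>\<close> brings the image \<open>w\<close> of the axis back to the
    axis, up to sign. Since \<open>T\<close> is recovered as \<open>\<rho>'\<close> after
    \<open>T'\<close>, where \<open>T'\<close> is \<open>\<rho>\<close> after \<open>T\<close>, only
    the left inverse \<open>\<rho>'\<close> has to be known to preserve the measure.\<close>
  obtain \<rho> \<rho>' \<sigma> where \<rho>: "isometry_on ?I \<rho>" "preserves ?I \<rho>'" "linear_on ?I \<rho>'"
      "\<And>f i. i \<in> ?I \<Longrightarrow> \<rho>' (\<rho> f) i = f i"
    and \<sigma>: "\<sigma> = 1 \<or> \<sigma> = (-1::real)" "\<And>i. i \<in> ?I \<Longrightarrow> \<rho> w i = \<sigma> * e i"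
  proof (cases "r = 0")
    \<comment> \<open>Then \<open>w\<close> is already plus or minus the axis vector. The sign is
      kept because \<open>J\<close> may be empty, leaving no plane in which to rotate.\<close>
    case True
    have idl: "linear_on ?I (\<lambda>f. f)" by (rule linear_onI[OF finI]) auto
    have "\<forall>i\<in>J. w i = 0" using r True insert(1) by (simp add: sum_nonneg_eq_0_iff)
    moreover have "w a = 1 \<or> w a = -1" using wr True by (simp add: power2_eq_1_iff)
    ultimately show ?thesis
      using insert(2) idl by (intro that[of "\<lambda>f. f" "\<lambda>f. f" "w a"]) (auto simp: isometry_on_def preserves_id e_def)
  next
    case False
    then have "J \<noteq> {}" using r by auto
    then obtain b where b: "b \<in> J" by auto
    have ab: "a \<noteq> b" using b insert(2) by auto
    define u where "u = (\<lambda>j. w j - (if j = b then r else 0))"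
    define H where "H f i = (if i \<in> J then reflect J u f i else f i)" for f i
    note rf = reflect[OF insert(1), of u]
    have Hlin: "linear_on ?I H"
    proof (rule linear_onI[OF finI])
      have l: "linear_on J (reflect J u)" using rf(1) by (simp add: isometry_on_def)
      fix f g :: "'a \<Rightarrow> real" and c i assume i: "i \<in> ?I"
      show "H (\<lambda>j. f j + g j) i = H f i + H g i" "H (\<lambda>j. c * f j) i = c * H f i"
        by (auto simp: H_def reflect_def sum.distrib sum_distrib_left add_divide_distrib algebra_simps)
      assume "\<And>j. j \<in> ?I \<Longrightarrow> f j = g j"
      then show "H f i = H g i" using i linear_on_cong[OF l, of i f g] by (auto simp: H_def)
    qed
    have HH: "H (H f) i = f i" for f i
    proof (cases "i \<in> J")
      case True
      have "H (H f) i = reflect J u (reflect J u f) i"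
        using True linear_on_cong[of J "reflect J u" i "H f" "reflect J u f"] rf(1)
        by (auto simp: H_def isometry_on_def)
      then show ?thesis using rf(2) by simp
    qed (simp add: H_def)
    have Hiso: "isometry_on ?I H"
      unfolding isometry_on_def
    proof (intro conjI allI Hlin)
      fix f
      have "(\<Sum>i\<in>J. (H f i)\<^sup>2) = (\<Sum>i\<in>J. (f i)\<^sup>2)"
        using rf(1) by (simp add: H_def isometry_on_def)
      then show "(\<Sum>i\<in>?I. (H f i)\<^sup>2) = (\<Sum>i\<in>?I. (f i)\<^sup>2)" using insert(1,2) by (simp add: H_def)
    qed
    have Hpres: "preserves ?I H"
      by (rule preserves_extend[OF insert(1,2) insert.IH[OF rf(1)] _ Hlin, where \<sigma> = 1])
         (use rf(1) insert(2) in \<open>auto simp: isometry_on_def H_def\<close>)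
    have abI: "a \<in> ?I" "b \<in> ?I" using b by auto
    have cs: "(w a)\<^sup>2 + (- r)\<^sup>2 = 1" "(w a)\<^sup>2 + r\<^sup>2 = 1" using wr by auto
    note g1 = isometry_on_givens[OF finI abI ab cs(1)]
    note g2 = isometry_on_givens[OF finI abI ab cs(2)] preserves_givens[OF finI abI ab cs(2)]
    show ?thesis
    \<comment> \<open>The reflection \<open>H\<close> collects the part of \<open>w\<close> in
      \<open>J\<close> at \<open>b\<close>, and the rotation in the plane of \<open>a\<close> and
      \<open>b\<close> moves it to \<open>a\<close>. The inverse consists of the opposite rotation
      and of \<open>H\<close> again.\<close>
    proof (rule that[of "\<lambda>f. givens a b (w a) (- r) (H f)" "\<lambda>f. H (givens a b (w a) r f)" 1])
      show "isometry_on ?I (\<lambda>f. givens a b (w a) (- r) (H f))" by (rule isometry_on_comp[OF g1 Hiso])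
      show "preserves ?I (\<lambda>f. H (givens a b (w a) r f))" by (rule preserves_comp[OF Hpres Hlin g2(2)])
      show "linear_on ?I (\<lambda>f. H (givens a b (w a) r f))"
        using g2(1) by (intro linear_on_comp[OF Hlin]) (simp add: isometry_on_def)
      have gg: "givens a b (w a) r (givens a b (w a) (- r) f) = f" for f
      proof
        fix i
        have "w a * (w a * f a + r * f b) - r * (w a * f b - r * f a) = ((w a)\<^sup>2 + r\<^sup>2) * f a"
          "r * (w a * f a + r * f b) + w a * (w a * f b - r * f a) = ((w a)\<^sup>2 + r\<^sup>2) * f b"
          by (simp_all add: power2_eq_square algebra_simps)
        then show "givens a b (w a) r (givens a b (w a) (- r) f) i = f i"
          using ab wr by (simp add: givens_def)
      qed
      show "H (givens a b (w a) r (givens a b (w a) (- r) (H f))) i = f i" for f i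
        unfolding gg HH ..
      have Hw: "H w i = (if i = b then r else 0)" if "i \<in> J" for i
        using reflect_to_axis[OF insert(1) b r(2) that] that by (simp add: H_def u_def)
      have Hwa: "H w a = w a" using insert(2) by (simp add: H_def)
      show "givens a b (w a) (- r) (H w) i = 1 * e i" if "i \<in> ?I" for i
        using that ab b wr insert(2) Hw[OF b] Hw[of i] Hwa
        by (auto simp: givens_def e_def power2_eq_square)
    qed simp
  qed
  define T' where "T' f = \<rho> (T f)" for f
  have T': "isometry_on ?I T'" unfolding T'_def[abs_def] by (rule isometry_on_comp[OF \<rho>(1) insert.prems])
  have T'e: "T' e i = \<sigma> * e i" if "i \<in> ?I" for i using \<sigma>(2)[OF that] by (simp add: T'_def w_def)
  \<comment> \<open>Inner products are preserved and \<open>T'\<close> maps the axis to \<sigma>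
    times itself; pairing with the axis therefore reads off coordinate \<open>a\<close>.\<close>
  have T'a: "T' f a = \<sigma> * f a" for f
  proof -
    have "(\<Sum>i\<in>?I. T' f i * T' e i) = (\<Sum>i\<in>?I. f i * e i)" by (rule isometry_on_inner[OF T'])
    also have "(\<Sum>i\<in>?I. T' f i * T' e i) = (\<Sum>i\<in>?I. (\<sigma> * T' f i) * e i)"
      by (intro sum.cong) (auto simp: T'e)
    finally have "\<sigma> * T' f a = f a" unfolding se .
    then show ?thesis using \<sigma>(1) by auto
  qed
  obtain A where A: "\<And>f i. i \<in> ?I \<Longrightarrow> T' f i = (\<Sum>j\<in>?I. A i j * f j)"
    using T' unfolding isometry_on_def linear_on_def by metis
  \<comment> \<open>The image of the axis has no component in \<open>J\<close>, so column
    \<open>a\<close> of the matrix vanishes there and \<open>T'\<close> restricts to an isometry on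
    \<open>J\<close>.\<close>
  have Aa: "A i a = 0" if "i \<in> J" for i
    using A[of i e] T'e[of i] that insert(2) unfolding se by (auto simp: e_def)
  have AJ: "T' f i = (\<Sum>j\<in>J. A i j * f j)" if "i \<in> J" for f i
    using A[of i f] Aa[OF that] that insert(1,2) by simp
  have linJ: "linear_on J T'" unfolding linear_on_def using AJ by (intro exI[of _ A]) simp
  have isoJ: "isometry_on J T'"
    unfolding isometry_on_def
  proof (intro conjI linJ allI)
    fix f :: "'a \<Rightarrow> real"
    define f0 where "f0 = f(a := 0)"
    have "(\<Sum>i\<in>?I. (T' f0 i)\<^sup>2) = (\<Sum>i\<in>?I. (f0 i)\<^sup>2)" using T' by (simp add: isometry_on_def)
    then have "(\<Sum>i\<in>J. (T' f0 i)\<^sup>2) = (\<Sum>i\<in>J. (f0 i)\<^sup>2)"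
      using insert(1,2) by (simp add: T'a) (simp add: f0_def)
    moreover have "T' f0 i = T' f i" if "i \<in> J" for i
      using insert(2) by (intro linear_on_cong[OF linJ that]) (auto simp: f0_def)
    moreover have "f0 i = f i" if "i \<in> J" for i using that insert(2) by (auto simp: f0_def)
    ultimately show "(\<Sum>i\<in>J. (T' f i)\<^sup>2) = (\<Sum>i\<in>J. (f i)\<^sup>2)" by simp
  qed
  have "preserves ?I T'"
    by (rule preserves_extend[OF insert(1,2) insert.IH[OF isoJ] linJ, where \<sigma> = \<sigma>])
       (use T' T'a \<sigma>(1) in \<open>auto simp: isometry_on_def\<close>)
  then have "preserves ?I (\<lambda>f. \<rho>' (T' f))" by (rule preserves_comp[OF \<rho>(2,3)])
  then show ?case
    by (rule preserves_cong) (simp add: T'_def \<rho>(4))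
qed

section \<open>Concentration of chi-squared sums\<close>

text \<open>Chebyshev: the centred squares are uncorrelated with mean 0 and variance
  \<open>3 - 2 + 1 = 2\<close>, from the second moment 1 and the fourth moment 3.\<close>

lemma chi_square_concentration:
  fixes J :: "'a set"
  assumes fin: "finite J" and t: "0 < t"
  shows "measure (gaussian J) {f \<in> space (gaussian J). t \<le> \<bar>(\<Sum>i\<in>J. (f i)\<^sup>2) - real (card J)\<bar>} \<le> 2 * real (card J) / t\<^sup>2"
proof -
  interpret G: prob_space "gaussian J" by (rule prob_space_gaussian)
  interpret N: prob_space std_normal by (rule prob_space_std_normal)
  define u where "u x = x\<^sup>2 - 1" for x :: real
  have m2: "has_bochner_integral std_normal (\<lambda>x. x ^ 2) 1" and m4: "has_bochner_integral std_normal (\<lambda>x. x ^ 4) 3"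
  proof -
    have "has_bochner_integral std_normal (\<lambda>x. x ^ (2 * k)) (fact (2 * k) / (2 ^ k * fact k))" for k
      using std_normal_moment_even[of k]
      by (subst has_bochner_integral_density) (auto simp: std_normal_density_def)
    from this[of 1] this[of 2] show "has_bochner_integral std_normal (\<lambda>x. x ^ 2) 1"
      "has_bochner_integral std_normal (\<lambda>x. x ^ 4) 3" by (simp_all add: fact_numeral)
  qed
  have "integral\<^sup>L std_normal (\<lambda>x. 1 :: real) = measure std_normal (space std_normal) *\<^sub>R 1"
    by (rule lebesgue_integral_const)
  then have "integral\<^sup>L std_normal (\<lambda>x. 1 :: real) = 1"
    unfolding N.prob_space real_scaleR_def by (simp only: mult_1_right)
  with N.integrable_const have one: "has_bochner_integral std_normal (\<lambda>x. 1 :: real) 1"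
    unfolding has_bochner_integral_iff by blast
  have "u = (\<lambda>x. x\<^sup>2 - 1)" by (simp add: u_def fun_eq_iff)
  then have u1: "has_bochner_integral std_normal u 0"
    using has_bochner_integral_diff[OF m2 one] by (simp only: diff_self)
  have u2: "has_bochner_integral std_normal (\<lambda>x. u x * u x) 2"
  proof -
    have "has_bochner_integral std_normal (\<lambda>x. x ^ 4 - 2 * x ^ 2 + 1) (3 - 2 * 1 + 1)"
      by (intro has_bochner_integral_add has_bochner_integral_diff m4 one has_bochner_integral_mult_right m2)
    moreover have "(\<lambda>x. u x * u x) = (\<lambda>x. x ^ 4 - 2 * x ^ 2 + 1)"
      by (simp add: u_def fun_eq_iff power2_eq_square power4_eq_xxxx algebra_simps)
    moreover have "3 - 2 * 1 + 1 = (2 :: real)" by simp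
    ultimately show ?thesis by (simp only:)
  qed
  \<comment> \<open>Means of functions of one or two coordinates are means of a product over all of
    \<open>J\<close> whose other factors are the constant 1.\<close>
  have prod: "has_bochner_integral (gaussian J) (\<lambda>f. \<Prod>i\<in>J. h i (f i)) (\<Prod>i\<in>J. I i)"
    if "\<And>i. i \<in> J \<Longrightarrow> has_bochner_integral std_normal (h i) (I i)"
    for h :: "'a \<Rightarrow> real \<Rightarrow> real" and I
    using that product_sigma_finite.product_integral_prod[OF product_sigma_finite_std_normal fin, of h]
      product_sigma_finite.product_integrable_prod[OF product_sigma_finite_std_normal fin, of h]
    by (auto simp: has_bochner_integral_iff gaussian_def)
  have Eu: "has_bochner_integral (gaussian J) (\<lambda>f. u (f i)) 0" if i: "i \<in> J" for i
  proof -
    have "has_bochner_integral (gaussian J) (\<lambda>f. \<Prod>j\<in>J. (if j = i then u else (\<lambda>_. 1)) (f j)) (\<Prod>j\<in>J. if j = i then 0 else 1)"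
      by (rule prod) (use u1 one in auto)
    moreover have "(\<Prod>j\<in>J. (if j = i then u else (\<lambda>_. 1)) (f j)) = u (f i)" for f
      using fin i by (simp add: if_distrib[of "\<lambda>g. g _"] cong: if_cong)
    moreover have "(\<Prod>j\<in>J. if j = i then 0 else 1) = (0::real)" using fin i by simp
    ultimately show ?thesis by simp
  qed
  have Euu: "has_bochner_integral (gaussian J) (\<lambda>f. u (f i) * u (f j)) (if i = j then 2 else 0)"
    if ij: "i \<in> J" "j \<in> J" for i j
  proof (cases "i = j")
    case True
    have "has_bochner_integral (gaussian J) (\<lambda>f. \<Prod>j\<in>J. (if j = i then (\<lambda>x. u x * u x) else (\<lambda>_. 1)) (f j)) (\<Prod>j\<in>J. if j = i then 2 else 1)"
      by (rule prod) (use u2 one in auto)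
    moreover have "(\<Prod>j\<in>J. (if j = i then (\<lambda>x. u x * u x) else (\<lambda>_. 1)) (f j)) = u (f i) * u (f i)" for f
      using fin ij by (simp add: if_distrib[of "\<lambda>g. g _"] cong: if_cong)
    moreover have "(\<Prod>j\<in>J. if j = i then 2 else 1) = (2::real)" using fin ij by simp
    ultimately show ?thesis using True by simp
  next
    case False
    have "has_bochner_integral (gaussian J) (\<lambda>f. \<Prod>k\<in>J. (if k = i \<or> k = j then u else (\<lambda>_. 1)) (f k)) (\<Prod>k\<in>J. if k = i \<or> k = j then 0 else 1)"
      by (rule prod) (use u1 one in auto)
    moreover have "(\<Prod>k\<in>J. (if k = i \<or> k = j then u else (\<lambda>_. 1)) (f k)) = u (f i) * u (f j)" for f
    proof -
      have "(\<Prod>k\<in>J. (if k = i \<or> k = j then u else (\<lambda>_. 1)) (f k)) = (\<Prod>k\<in>{i, j}. u (f k))"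
        using fin ij by (intro prod.mono_neutral_cong_right) auto
      then show ?thesis using False by simp
    qed
    moreover have "(\<Prod>k\<in>J. if k = i \<or> k = j then 0 else 1) = (0::real)" using fin ij by auto
    ultimately show ?thesis using False by simp
  qed
  define X where "X f = (\<Sum>i\<in>J. u (f i))" for f
  have X: "X f = (\<Sum>i\<in>J. (f i)\<^sup>2) - real (card J)" for f by (simp add: X_def u_def sum_subtractf)
  have EX: "has_bochner_integral (gaussian J) X 0"
    unfolding X_def[abs_def] using has_bochner_integral_sum[of J "gaussian J" "\<lambda>i f. u (f i)" "\<lambda>_. 0"] Eu by simp
  have "has_bochner_integral (gaussian J) (\<lambda>f. \<Sum>i\<in>J. \<Sum>j\<in>J. u (f i) * u (f j)) (\<Sum>i\<in>J. \<Sum>j\<in>J. if i = j then 2 else 0)"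
    by (intro has_bochner_integral_sum Euu)
  moreover have "(\<Sum>i\<in>J. \<Sum>j\<in>J. if i = j then 2 else 0) = 2 * real (card J)" using fin by simp
  moreover have "(\<Sum>i\<in>J. \<Sum>j\<in>J. u (f i) * u (f j)) = (X f)\<^sup>2" for f
    by (simp add: X_def power2_eq_square sum_product)
  ultimately have EX2: "has_bochner_integral (gaussian J) (\<lambda>f. (X f)\<^sup>2) (2 * real (card J))" by simp
  have "measure (gaussian J) {f \<in> space (gaussian J). t \<le> \<bar>X f - integral\<^sup>L (gaussian J) X\<bar>}
      \<le> (LINT f|gaussian J. (X f - integral\<^sup>L (gaussian J) X)\<^sup>2) / t\<^sup>2"
    using EX EX2 t by (intro G.Chebyshev_inequality) (auto simp: has_bochner_integral_iff)
  then show ?thesis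
    using EX EX2 by (simp add: has_bochner_integral_iff X)
qed

section \<open>Measurability\<close>

text \<open>Measurability is stated for the entries, in agreement with \<open>indep_mat_vec\<close>,
  and with dimensions fixed on the whole space.\<close>

definition mat_family :: "'a measure \<Rightarrow> nat \<Rightarrow> nat \<Rightarrow> ('a \<Rightarrow> complex Matrix.mat) \<Rightarrow> bool" where
  "mat_family M n m A \<longleftrightarrow> (\<forall>\<omega>\<in>space M. A \<omega> \<in> carrier_mat n m) \<and>
     (\<forall>i<n. \<forall>j<m. (\<lambda>\<omega>. A \<omega> $$ (i, j)) \<in> borel_measurable M)"

definition vec_family :: "'a measure \<Rightarrow> nat \<Rightarrow> ('a \<Rightarrow> complex Matrix.vec) \<Rightarrow> bool" where
  "vec_family M n v \<longleftrightarrow> (\<forall>\<omega>\<in>space M. v \<omega> \<in> carrier_vec n) \<and>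
     (\<forall>i<n. (\<lambda>\<omega>. v \<omega> $ i) \<in> borel_measurable M)"

lemma borel_measurable_cnj: "f \<in> borel_measurable M \<Longrightarrow> (\<lambda>\<omega>. cnj (f \<omega>)) \<in> borel_measurable M"
  by (rule borel_measurable_continuous_on[OF continuous_on_cnj[OF continuous_on_id]])

lemma measurable_congI:
  assumes "g \<in> measurable M N" "\<And>\<omega>. \<omega> \<in> space M \<Longrightarrow> f \<omega> = g \<omega>"
  shows "f \<in> measurable M N"
  using assms(1) by (subst measurable_cong[OF assms(2)])

lemma mat_familyI:
  assumes "\<And>\<omega>. \<omega> \<in> space M \<Longrightarrow> A \<omega> \<in> carrier_mat n m"
    and "\<And>i j. i < n \<Longrightarrow> j < m \<Longrightarrow> F i j \<in> borel_measurable M"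
    and "\<And>\<omega> i j. \<omega> \<in> space M \<Longrightarrow> i < n \<Longrightarrow> j < m \<Longrightarrow> A \<omega> $$ (i, j) = F i j \<omega>"
  shows "mat_family M n m A"
  unfolding mat_family_def
proof (intro conjI ballI allI impI)
  show "(\<lambda>\<omega>. A \<omega> $$ (i, j)) \<in> borel_measurable M" if "i < n" "j < m" for i j
    using assms(2)[OF that] by (rule measurable_congI) (rule assms(3)[OF _ that])
qed (rule assms(1))

lemma vec_familyI:
  assumes "\<And>\<omega>. \<omega> \<in> space M \<Longrightarrow> v \<omega> \<in> carrier_vec n"
    and "\<And>i. i < n \<Longrightarrow> F i \<in> borel_measurable M"
    and "\<And>\<omega> i. \<omega> \<in> space M \<Longrightarrow> i < n \<Longrightarrow> v \<omega> $ i = F i \<omega>"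
  shows "vec_family M n v"
  unfolding vec_family_def
proof (intro conjI ballI allI impI)
  show "(\<lambda>\<omega>. v \<omega> $ i) \<in> borel_measurable M" if "i < n" for i
    using assms(2)[OF that] by (rule measurable_congI) (rule assms(3)[OF _ that])
qed (rule assms(1))

lemma mat_family_carrier: "mat_family M n m A \<Longrightarrow> \<omega> \<in> space M \<Longrightarrow> A \<omega> \<in> carrier_mat n m"
  by (simp add: mat_family_def)

lemma vec_family_carrier: "vec_family M n v \<Longrightarrow> \<omega> \<in> space M \<Longrightarrow> v \<omega> \<in> carrier_vec n"
  by (simp add: vec_family_def)

lemma mat_family_entry: "mat_family M n m A \<Longrightarrow> i < n \<Longrightarrow> j < m \<Longrightarrow> (\<lambda>\<omega>. A \<omega> $$ (i, j)) \<in> borel_measurable M"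
  by (simp add: mat_family_def)

lemma vec_family_entry: "vec_family M n v \<Longrightarrow> i < n \<Longrightarrow> (\<lambda>\<omega>. v \<omega> $ i) \<in> borel_measurable M"
  by (simp add: vec_family_def)

lemma mat_family_mult:
  assumes A: "mat_family M n m A" and B: "mat_family M m k B"
  shows "mat_family M n k (\<lambda>\<omega>. A \<omega> * B \<omega>)"
proof (rule mat_familyI[where F = "\<lambda>i j \<omega>. \<Sum>l<m. A \<omega> $$ (i, l) * B \<omega> $$ (l, j)"])
  show "A \<omega> * B \<omega> \<in> carrier_mat n k" if "\<omega> \<in> space M" for \<omega>
    using mat_family_carrier[OF A that] mat_family_carrier[OF B that] by simp
  show "(A \<omega> * B \<omega>) $$ (i, j) = (\<Sum>l<m. A \<omega> $$ (i, l) * B \<omega> $$ (l, j))"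
    if "\<omega> \<in> space M" "i < n" "j < k" for \<omega> i j
    using mult_mat_sum[OF mat_family_carrier[OF A that(1)] mat_family_carrier[OF B that(1)] that(2,3)] .
qed (auto intro!: borel_measurable_sum borel_measurable_times mat_family_entry[OF A] mat_family_entry[OF B])

lemma mat_family_adjoint:
  assumes A: "mat_family M n m A"
  shows "mat_family M m n (\<lambda>\<omega>. mat_adjoint (A \<omega>))"
  by (rule mat_familyI[where F = "\<lambda>i j \<omega>. cnj (A \<omega> $$ (j, i))"])
     (use mat_family_carrier[OF A] in \<open>auto intro!: borel_measurable_cnj mat_family_entry[OF A] simp: carrier_matD[OF mat_family_carrier[OF A]]\<close>)

lemma mat_family_gram: "mat_family M n m X \<Longrightarrow> mat_family M n n (\<lambda>\<omega>. gram (X \<omega>))"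
  unfolding gram_def by (intro mat_family_mult mat_family_adjoint)

lemma vec_family_mult:
  assumes A: "mat_family M n m A" and v: "vec_family M m v"
  shows "vec_family M n (\<lambda>\<omega>. A \<omega> *\<^sub>v v \<omega>)"
proof (rule vec_familyI[where F = "\<lambda>i \<omega>. \<Sum>j<m. A \<omega> $$ (i, j) * v \<omega> $ j"])
  show "A \<omega> *\<^sub>v v \<omega> \<in> carrier_vec n" if "\<omega> \<in> space M" for \<omega>
    using mult_mat_vec_carrier[OF mat_family_carrier[OF A that] vec_family_carrier[OF v that]] .
  show "(A \<omega> *\<^sub>v v \<omega>) $ i = (\<Sum>j<m. A \<omega> $$ (i, j) * v \<omega> $ j)" if "\<omega> \<in> space M" "i < n" for \<omega> i
    using mult_mat_vec_sum[OF mat_family_carrier[OF A that(1)] vec_family_carrier[OF v that(1)] that(2)] .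
qed (auto intro!: borel_measurable_sum borel_measurable_times mat_family_entry[OF A] vec_family_entry[OF v])

lemma vec_family_add:
  assumes u: "vec_family M n u" and v: "vec_family M n v"
  shows "vec_family M n (\<lambda>\<omega>. u \<omega> + v \<omega>)"
  by (rule vec_familyI[where F = "\<lambda>i \<omega>. u \<omega> $ i + v \<omega> $ i"])
     (use vec_family_carrier[OF u] vec_family_carrier[OF v] in
       \<open>auto intro!: borel_measurable_add vec_family_entry[OF u] vec_family_entry[OF v] simp: carrier_vecD[OF vec_family_carrier[OF u]] carrier_vecD[OF vec_family_carrier[OF v]]\<close>)

lemma vec_family_diff:
  assumes u: "vec_family M n u" and v: "vec_family M n v"
  shows "vec_family M n (\<lambda>\<omega>. u \<omega> - v \<omega>)"
  by (rule vec_familyI[where F = "\<lambda>i \<omega>. u \<omega> $ i - v \<omega> $ i"])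
     (use vec_family_carrier[OF u] vec_family_carrier[OF v] in
       \<open>auto intro!: borel_measurable_diff vec_family_entry[OF u] vec_family_entry[OF v] simp: carrier_vecD[OF vec_family_carrier[OF u]] carrier_vecD[OF vec_family_carrier[OF v]]\<close>)

lemma vec_family_smult:
  assumes c: "c \<in> borel_measurable M" and v: "vec_family M n v"
  shows "vec_family M n (\<lambda>\<omega>. c \<omega> \<cdot>\<^sub>v v \<omega>)"
  by (rule vec_familyI[where F = "\<lambda>i \<omega>. c \<omega> * v \<omega> $ i"])
     (use vec_family_carrier[OF v] in
       \<open>auto intro!: borel_measurable_times c vec_family_entry[OF v] simp: carrier_vecD[OF vec_family_carrier[OF v]]\<close>)

lemma borel_measurable_ip:
  assumes u: "vec_family M n u" and v: "vec_family M n v"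
  shows "(\<lambda>\<omega>. ip (u \<omega>) (v \<omega>)) \<in> borel_measurable M"
proof -
  have "(\<lambda>\<omega>. \<Sum>i<n. u \<omega> $ i * cnj (v \<omega> $ i)) \<in> borel_measurable M"
    by (intro borel_measurable_sum borel_measurable_times borel_measurable_cnj vec_family_entry[OF u] vec_family_entry[OF v]) auto
  then show ?thesis
    by (rule measurable_congI) (rule ip_sum[OF vec_family_carrier[OF v]])
qed

lemma borel_measurable_det:
  assumes A: "mat_family M n n A"
  shows "(\<lambda>\<omega>. Determinant.det (A \<omega>)) \<in> borel_measurable M"
proof -
  have "(\<lambda>\<omega>. \<Sum>p\<in>{p. p permutes {0..<n}}. signof p * (\<Prod>i = 0..<n. A \<omega> $$ (i, p i))) \<in> borel_measurable M"
  proof (intro borel_measurable_sum borel_measurable_times borel_measurable_const borel_measurable_prod)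
    fix p i assume "p \<in> {p. p permutes {0..<n}}" "i \<in> {0..<n}"
    then have "i < n" "p i < n" using permutes_in_image[of p "{0..<n}" i] by auto
    then show "(\<lambda>\<omega>. A \<omega> $$ (i, p i)) \<in> borel_measurable M" by (rule mat_family_entry[OF A])
  qed
  then show ?thesis
    by (rule measurable_congI) (rule det_def'[OF mat_family_carrier[OF A]])
qed

lemma mat_family_delete:
  assumes A: "mat_family M n n A" and ij: "i < n" "j < n"
  shows "mat_family M (n - 1) (n - 1) (\<lambda>\<omega>. mat_delete (A \<omega>) i j)"
proof (rule mat_familyI[where F = "\<lambda>i' j' \<omega>. A \<omega> $$ (if i' < i then i' else Suc i', if j' < j then j' else Suc j')"])
  show "mat_delete (A \<omega>) i j \<in> carrier_mat (n - 1) (n - 1)" if "\<omega> \<in> space M" for \<omega>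
    using mat_delete_carrier[OF mat_family_carrier[OF A that]] .
  show "(\<lambda>\<omega>. A \<omega> $$ (if i' < i then i' else Suc i', if j' < j then j' else Suc j')) \<in> borel_measurable M"
    if "i' < n - 1" "j' < n - 1" for i' j'
    using that by (intro mat_family_entry[OF A]) auto
  show "mat_delete (A \<omega>) i j $$ (i', j') = A \<omega> $$ (if i' < i then i' else Suc i', if j' < j then j' else Suc j')"
    if "\<omega> \<in> space M" "i' < n - 1" "j' < n - 1" for \<omega> i' j'
    using mat_family_carrier[OF A that(1)] that by (auto simp: mat_delete_def)
qed

lemma mat_family_adj_mat:
  assumes A: "mat_family M n n A"
  shows "mat_family M n n (\<lambda>\<omega>. adj_mat (A \<omega>))"
proof (rule mat_familyI[where F = "\<lambda>i j \<omega>. (-1) ^ (j + i) * Determinant.det (mat_delete (A \<omega>) j i)"])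
  show "adj_mat (A \<omega>) \<in> carrier_mat n n" if "\<omega> \<in> space M" for \<omega>
    using adj_mat(1)[OF mat_family_carrier[OF A that]] .
  show "(\<lambda>\<omega>. (-1) ^ (j + i) * Determinant.det (mat_delete (A \<omega>) j i)) \<in> borel_measurable M"
    if "i < n" "j < n" for i j
    using borel_measurable_det[OF mat_family_delete[OF A that(2,1)]] by (intro borel_measurable_times) auto
  show "adj_mat (A \<omega>) $$ (i, j) = (-1) ^ (j + i) * Determinant.det (mat_delete (A \<omega>) j i)"
    if "\<omega> \<in> space M" "i < n" "j < n" for \<omega> i j
    using mat_family_carrier[OF A that(1)] that by (auto simp: adj_mat_def cofactor_def)
qed

lemma vec_family_cramer:
  assumes W: "mat_family M n n W" and b: "vec_family M n b"
  shows "vec_family M n (\<lambda>\<omega>. cramer (W \<omega>) (b \<omega>))"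
  unfolding cramer_def
  by (intro vec_family_smult vec_family_mult[OF mat_family_adj_mat[OF W] b] borel_measurable_divide
      borel_measurable_det[OF W] borel_measurable_const)

lemma vec_family_cong:
  assumes "vec_family M n u" "\<And>\<omega>. \<omega> \<in> space M \<Longrightarrow> v \<omega> = u \<omega>"
  shows "vec_family M n v"
  by (rule vec_familyI[where F = "\<lambda>i \<omega>. u \<omega> $ i"])
     (use assms vec_family_carrier[OF assms(1)] vec_family_entry[OF assms(1)] in auto)

lemma vec_family_power:
  assumes W: "mat_family M n n W" and b: "vec_family M n b"
  shows "vec_family M n (\<lambda>\<omega>. W \<omega> ^\<^sub>m j *\<^sub>v b \<omega>)"
proof (induction j)
  case 0
  show ?case
    by (rule vec_family_cong[OF b]) (rule pow_mult_vec_0[OF mat_family_carrier[OF W] vec_family_carrier[OF b]])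
next
  case (Suc j)
  show ?case
    by (rule vec_family_cong[OF vec_family_mult[OF W Suc]])
       (rule pow_mult_vec_Suc[OF mat_family_carrier[OF W] vec_family_carrier[OF b]])
qed

lemma vec_family_wproj:
  assumes W: "mat_family M n n W" and b: "vec_family M n b"
  shows "vec_family M n u \<Longrightarrow> vec_family M n (\<lambda>\<omega>. wproj (W \<omega>) (b \<omega>) k (u \<omega>))"
proof (induction k arbitrary: u)
  case 0
  show ?case
    by (rule vec_familyI[where F = "\<lambda>_ _. 0"]) (auto dest!: vec_family_carrier[OF b])
next
  case (Suc k)
  note v = vec_family_power[OF W b, of k]
  note p = vec_family_diff[OF v Suc.IH[OF v]]
  show ?case
    unfolding wproj.simps Let_def
    by (intro vec_family_add[OF Suc.IH[OF Suc.prems] vec_family_smult[OF _ p]] borel_measurable_divide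
        borel_measurable_ip[OF vec_family_mult[OF W Suc.prems] p] borel_measurable_ip[OF vec_family_mult[OF W p] p])
qed

lemma borel_measurable_err_size:
  assumes W: "mat_family M n n W" and e: "vec_family M n e"
  shows "(\<lambda>\<omega>. err_size l (W \<omega>) (e \<omega>)) \<in> borel_measurable M"
proof -
  note We = vec_family_mult[OF W e]
  have 1: "(\<lambda>\<omega>. energy_norm (W \<omega>) (e \<omega>)) \<in> borel_measurable M"
    unfolding energy_norm_def
    by (intro measurable_compose[OF _ borel_measurable_sqrt] measurable_compose[OF _ borel_measurable_Re] borel_measurable_ip[OF We e])
  have eq: "norm2 v = sqrt (Re (ip v v))" for v by (simp add: ip_self)
  have 2: "(\<lambda>\<omega>. norm2 (W \<omega> *\<^sub>v e \<omega>)) \<in> borel_measurable M"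
    unfolding eq
    by (intro measurable_compose[OF _ borel_measurable_sqrt] measurable_compose[OF _ borel_measurable_Re] borel_measurable_ip[OF We We])
  show ?thesis unfolding err_size_def using 1 2 by (cases "l = 1") auto
qed

text \<open>Definiteness is part of the event, so a probability close to 1 also shows that the
  algorithm is defined.\<close>

definition size_event :: "nat \<Rightarrow> complex set \<Rightarrow> nat \<Rightarrow> real set \<Rightarrow> complex Matrix.mat \<Rightarrow> complex Matrix.vec \<Rightarrow> bool" where
  "size_event l K k A W b \<longleftrightarrow> positive_definite W \<and> cg_size l K W b k \<in> A"

text \<open>A version of the same event that is measurable without any condition on \<open>W\<close> and \<open>b\<close>.\<close>

definition formula_event :: "nat \<Rightarrow> nat \<Rightarrow> real set \<Rightarrow> complex Matrix.mat \<Rightarrow> complex Matrix.vec \<Rightarrow> bool" where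
  "formula_event l k A W b \<longleftrightarrow> Determinant.det W \<noteq> 0 \<and>
     err_size l W (cramer W b - wproj W b k (cramer W b)) \<in> A"

lemma sets_formula_event:
  assumes W: "mat_family M n n W" and b: "vec_family M n b" and A: "A \<in> sets borel"
  shows "{\<omega> \<in> space M. formula_event l k A (W \<omega>) (b \<omega>)} \<in> sets M"
proof -
  define e where "e \<omega> = cramer (W \<omega>) (b \<omega>) - wproj (W \<omega>) (b \<omega>) k (cramer (W \<omega>) (b \<omega>))" for \<omega>
  have e: "vec_family M n e"
    unfolding e_def[abs_def] using vec_family_cramer[OF W b] vec_family_wproj[OF W b] vec_family_diff by blast
  have "{\<omega> \<in> space M. formula_event l k A (W \<omega>) (b \<omega>)}
      = ((\<lambda>\<omega>. Determinant.det (W \<omega>)) -` (- {0}) \<inter> space M) \<inter> ((\<lambda>\<omega>. err_size l (W \<omega>) (e \<omega>)) -` A \<inter> space M)"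
    unfolding formula_event_def e_def by auto
  also have "\<dots> \<in> sets M"
    using measurable_sets[OF borel_measurable_det[OF W], of "- {0}"]
      measurable_sets[OF borel_measurable_err_size[OF W e] A] by auto
  finally show ?thesis .
qed

lemma (in conj_subfield) size_event_iff_formula_event:
  assumes W: "W \<in> carrier_mat n n" "mat_in K W" and det: "positive_definite W \<longleftrightarrow> Determinant.det W \<noteq> 0"
    and b: "b \<in> carrier_vec n" "vec_in K b"
  shows "size_event l K k A W b \<longleftrightarrow> formula_event l k A W b"
  unfolding size_event_def formula_event_def det[symmetric]
proof (rule conj_cong[OF refl])
  assume pd: "positive_definite W"
  show "cg_size l K W b k \<in> A \<longleftrightarrow> err_size l W (cramer W b - wproj W b k (cramer W b)) \<in> A"
    unfolding cg_err_imp(3)[OF pd W(1) b(1) cg_err_exists[OF pd W b]] ..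
qed

lemma (in conj_subfield) sets_size_event:
  assumes W: "mat_family M n n W" "\<And>\<omega>. \<omega> \<in> space M \<Longrightarrow> mat_in K (W \<omega>)"
    and det: "\<And>\<omega>. \<omega> \<in> space M \<Longrightarrow> positive_definite (W \<omega>) \<longleftrightarrow> Determinant.det (W \<omega>) \<noteq> 0"
    and b: "vec_family M n b" "\<And>\<omega>. \<omega> \<in> space M \<Longrightarrow> vec_in K (b \<omega>)"
    and A: "A \<in> sets borel"
  shows "{\<omega> \<in> space M. size_event l K k A (W \<omega>) (b \<omega>)} \<in> sets M"
proof -
  have "{\<omega> \<in> space M. size_event l K k A (W \<omega>) (b \<omega>)} = {\<omega> \<in> space M. formula_event l k A (W \<omega>) (b \<omega>)}"
    by (intro Collect_cong conj_cong refl size_event_iff_formula_event[OF mat_family_carrier[OF W(1)] W(2) det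
          vec_family_carrier[OF b(1)] b(2)])
  then show ?thesis using sets_formula_event[OF W(1) b(1) A] by simp
qed

section \<open>Gaussian matrices\<close>

definition gidx :: "nat \<Rightarrow> nat \<Rightarrow> nat \<Rightarrow> (nat \<times> nat \<times> nat) set" where
  "gidx \<beta> n m = {..<\<beta>} \<times> {..<n} \<times> {..<m}"

text \<open>\<open>rmat\<close> and \<open>parts\<close> pass between the real coordinates that
  carry the Gaussian law and matrices; \<open>rmat\<close> undoes \<open>parts\<close> on matrices
  over the scalars.\<close>

definition rmat :: "nat \<Rightarrow> nat \<Rightarrow> nat \<Rightarrow> (nat \<times> nat \<times> nat \<Rightarrow> real) \<Rightarrow> complex Matrix.mat" where
  "rmat \<beta> n m f = Matrix.mat n m (\<lambda>(i, j). Complex (f (0, i, j)) (if \<beta> = 2 then f (1, i, j) else 0))"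

definition rvec :: "nat \<Rightarrow> nat \<Rightarrow> (nat \<times> nat \<Rightarrow> real) \<Rightarrow> complex Matrix.vec" where
  "rvec \<beta> n f = Matrix.vec n (\<lambda>i. Complex (f (0, i)) (if \<beta> = 2 then f (1, i) else 0))"

definition parts :: "complex Matrix.mat \<Rightarrow> nat \<times> nat \<times> nat \<Rightarrow> real" where
  "parts A = (\<lambda>(p, i, j). if p = 0 then Re (A $$ (i, j)) else Im (A $$ (i, j)))"

definition rowcons :: "complex Matrix.vec \<Rightarrow> complex Matrix.mat \<Rightarrow> complex Matrix.mat" where
  "rowcons x Y = Matrix.mat (Suc (dim_row Y)) (dim_col Y) (\<lambda>(i, j). case i of 0 \<Rightarrow> x $ j | Suc i \<Rightarrow> Y $$ (i, j))"

definition colcons :: "complex Matrix.vec \<Rightarrow> complex Matrix.mat \<Rightarrow> complex Matrix.mat" where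
  "colcons y Z = Matrix.mat (dim_row Z) (Suc (dim_col Z)) (\<lambda>(i, j). case j of 0 \<Rightarrow> y $ i | Suc j \<Rightarrow> Z $$ (i, j))"

lemma rowcons_carrier: "Y \<in> carrier_mat n m \<Longrightarrow> rowcons x Y \<in> carrier_mat (Suc n) m"
  by (auto simp: rowcons_def)

lemma rowcons_colcons:
  "Z \<in> carrier_mat n m \<Longrightarrow> rowcons (a \<cdot>\<^sub>v unit_vec (Suc m) 0) (colcons y Z) = bordered a y Z"
  by (rule eq_matI) (auto simp: rowcons_def colcons_def bordered_def less_Suc_eq_0_disj split: nat.splits)

text \<open>A row \<open>x\<close> times the adjoint of \<open>U\<close> is the conjugate of
  \<open>U\<close> applied to the conjugate of \<open>x\<close>. Hence a Householder matrix that is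
  to move the row to the axis must be chosen for the conjugate row.\<close>

lemma rowcons_mult:
  assumes x: "x \<in> carrier_vec m" and Y: "Y \<in> carrier_mat n m" and U: "U \<in> carrier_mat m m"
  shows "rowcons x Y * mat_adjoint U = rowcons (conjugate (U *\<^sub>v conjugate x)) (Y * mat_adjoint U)"
proof (rule eq_matI)
  note U' = adjoint_carrier[OF U]
  fix i j
  assume "i < dim_row (rowcons (conjugate (U *\<^sub>v conjugate x)) (Y * mat_adjoint U))"
    "j < dim_col (rowcons (conjugate (U *\<^sub>v conjugate x)) (Y * mat_adjoint U))"
  then have ij: "i < Suc n" "j < m" using Y U by (auto simp: rowcons_def)
  have *: "(rowcons x Y * mat_adjoint U) $$ (i, j) = (\<Sum>k<m. rowcons x Y $$ (i, k) * mat_adjoint U $$ (k, j))"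
    by (rule mult_mat_sum[OF rowcons_carrier[OF Y] U' ij])
  show "(rowcons x Y * mat_adjoint U) $$ (i, j) = rowcons (conjugate (U *\<^sub>v conjugate x)) (Y * mat_adjoint U) $$ (i, j)"
  proof (cases i)
    case 0
    have "(U *\<^sub>v conjugate x) $ j = (\<Sum>k<m. U $$ (j, k) * cnj (x $ k))"
      using x by (subst mult_mat_vec_sum[OF U _ ij(2)]) auto
    then show ?thesis unfolding * using 0 Y U ij x
      by (auto simp: rowcons_def mult.commute simp del: index_mult_mat_vec index_mult_mat(1) intro!: sum.cong)
  next
    case (Suc i')
    then have "(Y * mat_adjoint U) $$ (i', j) = (\<Sum>k<m. Y $$ (i', k) * mat_adjoint U $$ (k, j))"
      using ij by (intro mult_mat_sum[OF Y U']) auto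
    then show ?thesis unfolding * using Suc Y U ij
      by (auto simp: rowcons_def simp del: index_mult_mat(1) intro!: sum.cong)
  qed
qed (use Y U in \<open>auto simp: rowcons_def\<close>)

lemma measure_preserves:
  assumes T: "preserves I T" and Q: "{f \<in> space (gaussian I). Q f} \<in> sets (gaussian I)"
    and Q': "\<And>f. f \<in> space (gaussian I) \<Longrightarrow> Q' f \<longleftrightarrow> Q (restrict (T f) I)"
  shows "measure (gaussian I) {f \<in> space (gaussian I). Q' f} = measure (gaussian I) {f \<in> space (gaussian I). Q f}"
proof -
  define S where "S f = restrict (T f) I" for f
  have S: "S \<in> measurable (gaussian I) (gaussian I)" "distr (gaussian I) (gaussian I) S = gaussian I"
    using T unfolding preserves_def S_def[abs_def] by auto
  have "{f \<in> space (gaussian I). Q' f} = S -` {f \<in> space (gaussian I). Q f} \<inter> space (gaussian I)"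
    using Q' measurable_space[OF S(1)] by (auto simp: S_def)
  then show ?thesis using measure_distr[OF S(1) Q] S(2) by simp
qed

lemma measure_distr_event:
  assumes S: "S \<in> measurable M N" "distr M N S = N" and Q: "{f \<in> space N. Q f} \<in> sets N"
    and Q': "\<And>z. z \<in> space M \<Longrightarrow> Q' z \<longleftrightarrow> Q (S z)"
  shows "measure N {f \<in> space N. Q f} = measure M {z \<in> space M. Q' z}"
    and "{z \<in> space M. Q' z} \<in> sets M"
proof -
  have *: "{z \<in> space M. Q' z} = S -` {f \<in> space N. Q f} \<inter> space M"
    using Q' measurable_space[OF S(1)] by auto
  then show "measure N {f \<in> space N. Q f} = measure M {z \<in> space M. Q' z}"
    using measure_distr[OF S(1) Q] S(2) by simp
  show "{z \<in> space M. Q' z} \<in> sets M" unfolding * by (rule measurable_sets[OF S(1) Q])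
qed

text \<open>Takes the place of conditioning on the first component. A lower bound on the sections is
  enough because all probabilities are to tend to 1.\<close>

lemma measure_pair_ge:
  assumes M: "prob_space M" and N: "prob_space N" and E: "E \<in> sets (M \<Otimes>\<^sub>M N)" and G: "G \<in> sets M"
    and c: "0 \<le> c" "\<And>x. x \<in> G \<Longrightarrow> c \<le> measure N (Pair x -` E)"
  shows "measure M G * c \<le> measure (M \<Otimes>\<^sub>M N) E"
proof -
  interpret M: prob_space M by (rule M)
  interpret N: prob_space N by (rule N)
  interpret P: pair_prob_space M N ..
  have "ennreal (measure M G * c) = (\<integral>\<^sup>+x. ennreal c * indicator G x \<partial>M)"
    using G c(1) by (simp add: nn_integral_cmult_indicator M.emeasure_eq_measure ennreal_mult mult.commute)
  also have "\<dots> \<le> (\<integral>\<^sup>+x. emeasure N (Pair x -` E) \<partial>M)"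
    using c(2) by (intro nn_integral_mono) (auto simp: N.emeasure_eq_measure ennreal_leI split: split_indicator)
  also have "\<dots> = ennreal (measure (M \<Otimes>\<^sub>M N) E)"
    using N.emeasure_pair_measure_alt[OF E] by (simp add: P.emeasure_eq_measure)
  finally show ?thesis by simp
qed

lemma norm2_sq: "v \<in> carrier_vec n \<Longrightarrow> (norm2 v)\<^sup>2 = (\<Sum>i<n. (cmod (v $ i))\<^sup>2)"
  by (simp add: norm2_def L2_set_def sum_nonneg)

lemma norm2_unitary:
  assumes U: "U \<in> carrier_mat n n" "mat_adjoint U * U = 1\<^sub>m n" and v: "v \<in> carrier_vec n"
  shows "norm2 (U *\<^sub>v v) = norm2 v"
proof -
  have "ip (U *\<^sub>v v) (U *\<^sub>v v) = ip v ((mat_adjoint U * U) *\<^sub>v v)"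
    using ip_adjoint[OF U(1) v] U(1) v by (simp add: assoc_mult_mat_vec[OF adjoint_carrier[OF U(1)] U(1) v])
  then show ?thesis
    unfolding U(2) using v by (simp add: ip_self of_real_eq_iff power2_eq_iff_nonneg del: of_real_power)
qed

text \<open>The squared Frobenius norm. By \<open>sum_gidx\<close> it is the squared Euclidean norm
  of the real coordinates, through which unitary factors become isometries of the coordinate
  space.\<close>

definition frob :: "nat \<Rightarrow> nat \<Rightarrow> complex Matrix.mat \<Rightarrow> real" where
  "frob n m A = (\<Sum>i<n. \<Sum>j<m. (cmod (A $$ (i, j)))\<^sup>2)"

lemma frob_unitary:
  assumes U: "U \<in> carrier_mat n n" "mat_adjoint U * U = 1\<^sub>m n" and A: "A \<in> carrier_mat n m"
  shows "frob n m (U * A) = frob n m A"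
proof -
  have *: "frob n m B = (\<Sum>j<m. (norm2 (col B j))\<^sup>2)" if "B \<in> carrier_mat n m" for B
    unfolding frob_def using that
    by (subst sum.swap) (auto simp: norm2_sq[of _ n] intro!: sum.cong)
  have "col (U * A) j = U *\<^sub>v col A j" if "j < m" for j
    using U(1) A that by (intro eq_vecI) auto
  then show ?thesis
    using A U(1) norm2_unitary[OF U] by (simp add: * mult_carrier_mat[OF U(1) A])
qed

lemma frob_adjoint: "A \<in> carrier_mat n m \<Longrightarrow> frob m n (mat_adjoint A) = frob n m A"
  unfolding frob_def by (subst sum.swap) (auto intro!: sum.cong)

section \<open>Gaussian matrices over the real or complex scalars\<close>

locale wishart_beta =
  fixes \<beta> :: nat
  assumes beta: "\<beta> \<in> {1, 2}"
begin

abbreviation "K \<equiv> scalars \<beta>"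

sublocale conj_subfield K by (rule conj_subfield_scalars)

lemma K_iff: "x \<in> K \<longleftrightarrow> \<beta> = 2 \<or> Im x = 0"
  using beta by (auto simp: scalars_def complex_is_Real_iff)

lemma beta_lessThan: "{..<\<beta>} = (if \<beta> = 2 then {0, 1} else {0})"
  using beta by auto

lemma finite_gidx [simp]: "finite (gidx \<beta> n m)"
  by (simp add: gidx_def)

lemma gidx_0: "i < n \<Longrightarrow> j < m \<Longrightarrow> (0, i, j) \<in> gidx \<beta> n m"
  and gidx_1: "i < n \<Longrightarrow> j < m \<Longrightarrow> \<beta> = 2 \<Longrightarrow> (Suc 0, i, j) \<in> gidx \<beta> n m"
  using beta by (auto simp: gidx_def)

lemma rmat_carrier [simp]: "rmat \<beta> n m f \<in> carrier_mat n m"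
  by (simp add: rmat_def)

lemma rvec_carrier [simp]: "rvec \<beta> n f \<in> carrier_vec n"
  by (simp add: rvec_def)

lemma rmat_in [simp]: "mat_in K (rmat \<beta> n m f)"
  by (auto simp: mat_in_def rmat_def K_iff)

lemma rvec_in [simp]: "vec_in K (rvec \<beta> n f)"
  by (auto simp: vec_in_def rvec_def K_iff)

lemma rmat_dims [simp]: "dim_row (rmat \<beta> n m f) = n" "dim_col (rmat \<beta> n m f) = m"
  by (simp_all add: rmat_def)

lemma rmat_cong:
  assumes "\<And>q. q \<in> gidx \<beta> n m \<Longrightarrow> f q = g q"
  shows "rmat \<beta> n m f = rmat \<beta> n m g"
proof (rule eq_matI)
  fix i j assume "i < dim_row (rmat \<beta> n m g)" "j < dim_col (rmat \<beta> n m g)"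
  then have ij: "i < n" "j < m" by auto
  have "f (0, i, j) = g (0, i, j)" by (intro assms gidx_0 ij)
  moreover have "\<beta> = 2 \<Longrightarrow> f (Suc 0, i, j) = g (Suc 0, i, j)" by (intro assms gidx_1 ij)
  ultimately show "rmat \<beta> n m f $$ (i, j) = rmat \<beta> n m g $$ (i, j)" using ij by (simp add: rmat_def)
qed simp_all

lemma rmat_parts:
  assumes "A \<in> carrier_mat n m" "mat_in K A"
  shows "rmat \<beta> n m (parts A) = A"
  by (rule eq_matI) (use assms in \<open>auto simp: rmat_def parts_def complex_eq_iff mat_in_def K_iff\<close>)

lemma rmat_restrict_parts:
  assumes "A \<in> carrier_mat n m" "mat_in K A"
  shows "rmat \<beta> n m (restrict (parts A) (gidx \<beta> n m)) = A"
  using rmat_cong[of n m "restrict (parts A) (gidx \<beta> n m)" "parts A"] rmat_parts[OF assms] by simp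

lemma sum_gidx: "(\<Sum>q\<in>gidx \<beta> n m. (f q)\<^sup>2) = frob n m (rmat \<beta> n m f)"
proof -
  have "(\<Sum>q\<in>gidx \<beta> n m. (f q)\<^sup>2) = (\<Sum>p<\<beta>. \<Sum>i<n. \<Sum>j<m. (f (p, i, j))\<^sup>2)"
    by (simp add: gidx_def sum.cartesian_product' split_def)
  also have "\<dots> = (\<Sum>i<n. \<Sum>j<m. \<Sum>p<\<beta>. (f (p, i, j))\<^sup>2)"
    by (rule trans[OF sum.swap]) (intro sum.cong refl sum.swap)
  also have "\<dots> = frob n m (rmat \<beta> n m f)"
    unfolding frob_def by (intro sum.cong refl) (auto simp: rmat_def cmod_power2 beta_lessThan)
  finally show ?thesis .
qed

lemma rmat_add: "rmat \<beta> n m (\<lambda>q. f q + g q) = rmat \<beta> n m f + rmat \<beta> n m g"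
  by (rule eq_matI) (auto simp: rmat_def complex_eq_iff)

lemma rmat_scale: "rmat \<beta> n m (\<lambda>q. c * f q) = complex_of_real c \<cdot>\<^sub>m rmat \<beta> n m f"
  by (rule eq_matI) (auto simp: rmat_def complex_eq_iff)

text \<open>A linear map keeping the Frobenius norm is an isometry of the real coordinates, so
  \<open>preserves_isometry\<close> applies. Stability of \<open>K\<close> is what lets
  \<open>rmat\<close> recover the image from its \<open>parts\<close>.\<close>

lemma preserves_parts:
  assumes F: "\<And>A. A \<in> carrier_mat n m \<Longrightarrow> F A \<in> carrier_mat n m"
    "\<And>A. A \<in> carrier_mat n m \<Longrightarrow> mat_in K A \<Longrightarrow> mat_in K (F A)"
    and add: "\<And>A B. A \<in> carrier_mat n m \<Longrightarrow> B \<in> carrier_mat n m \<Longrightarrow> F (A + B) = F A + F B"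
    and scale: "\<And>A c. A \<in> carrier_mat n m \<Longrightarrow> F (c \<cdot>\<^sub>m A) = c \<cdot>\<^sub>m F A"
    and frob: "\<And>A. A \<in> carrier_mat n m \<Longrightarrow> frob n m (F A) = frob n m A"
  shows "preserves (gidx \<beta> n m) (\<lambda>f. parts (F (rmat \<beta> n m f)))"
proof (rule preserves_isometry)
  let ?T = "\<lambda>f. parts (F (rmat \<beta> n m f))"
  have lin: "linear_on (gidx \<beta> n m) ?T"
  proof (rule linear_onI)
    fix f g :: "nat \<times> nat \<times> nat \<Rightarrow> real" and c q assume q: "q \<in> gidx \<beta> n m"
    obtain p i j where q': "q = (p, i, j)" "i < n" "j < m" using q by (auto simp: gidx_def)
    note FA = F(1)[OF rmat_carrier]
    show "?T (\<lambda>j. f j + g j) q = ?T f q + ?T g q"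
      using q'(2,3) carrier_matD[OF FA[of f]] carrier_matD[OF FA[of g]]
      by (simp add: rmat_add add parts_def q'(1))
    show "?T (\<lambda>j. c * f j) q = c * ?T f q"
      using q'(2,3) carrier_matD[OF FA[of f]] by (simp add: rmat_scale scale parts_def q'(1))
    assume "\<And>j. j \<in> gidx \<beta> n m \<Longrightarrow> f j = g j"
    then show "?T f q = ?T g q" using rmat_cong[of n m f g] by simp
  qed simp
  have "(\<Sum>q\<in>gidx \<beta> n m. (?T f q)\<^sup>2) = (\<Sum>q\<in>gidx \<beta> n m. (f q)\<^sup>2)" for f
    unfolding sum_gidx by (simp add: rmat_parts F frob)
  with lin show "isometry_on (gidx \<beta> n m) ?T" by (simp add: isometry_on_def)
qed simp

lemma preserves_left:
  assumes U: "U \<in> carrier_mat n n" "mat_in K U" "mat_adjoint U * U = 1\<^sub>m n"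
  shows "preserves (gidx \<beta> n m) (\<lambda>f. parts (U * rmat \<beta> n m f))"
proof (rule preserves_parts)
  fix A :: "complex Matrix.mat" assume A: "A \<in> carrier_mat n m"
  show "U * A \<in> carrier_mat n m" by (rule mult_carrier_mat[OF U(1) A])
  show "mat_in K (U * A)" if "mat_in K A" by (rule mat_in_mult[OF U(1) A U(2) that])
  show "U * (A + B) = U * A + U * B" if "B \<in> carrier_mat n m" for B
    by (rule mult_add_distrib_mat[OF U(1) A that])
  show "U * (c \<cdot>\<^sub>m A) = c \<cdot>\<^sub>m (U * A)" for c by (rule mult_smult_distrib[OF U(1) A])
  show "frob n m (U * A) = frob n m A" by (rule frob_unitary[OF U(1,3) A])
qed

lemma preserves_right:
  assumes V: "V \<in> carrier_mat m m" "mat_in K V" "V * mat_adjoint V = 1\<^sub>m m"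
  shows "preserves (gidx \<beta> n m) (\<lambda>f. parts (rmat \<beta> n m f * V))"
proof (rule preserves_parts)
  fix A :: "complex Matrix.mat" assume A: "A \<in> carrier_mat n m"
  show "A * V \<in> carrier_mat n m" using A V(1) by simp
  show "mat_in K (A * V)" if "mat_in K A" using mat_in_mult[OF A V(1) that V(2)] .
  show "(A + B) * V = A * V + B * V" if "B \<in> carrier_mat n m" for B
    using add_mult_distrib_mat[OF A that V(1)] .
  show "(c \<cdot>\<^sub>m A) * V = c \<cdot>\<^sub>m (A * V)" for c using mult_smult_assoc_mat[OF A V(1)] .
  have "frob n m (A * V) = frob m n (mat_adjoint V * mat_adjoint A)"
    using frob_adjoint[of "A * V" n m] A V(1) adjoint_mult[OF A V(1)] by simp
  also have "\<dots> = frob m n (mat_adjoint A)"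
    using V by (intro frob_unitary[OF adjoint_carrier[OF V(1)] _ adjoint_carrier[OF A]]) simp
  finally show "frob n m (A * V) = frob n m A" using frob_adjoint[OF A] by simp
qed

lemma borel_measurable_Complex:
  assumes "f \<in> borel_measurable M" "g \<in> borel_measurable M"
  shows "(\<lambda>\<omega>. Complex (f \<omega>) (g \<omega>)) \<in> borel_measurable M"
  unfolding Complex_eq using assms by measurable

lemma mat_family_rmat:
  assumes "\<And>q. q \<in> gidx \<beta> n m \<Longrightarrow> (\<lambda>\<omega>. F \<omega> q) \<in> borel_measurable M"
  shows "mat_family M n m (\<lambda>\<omega>. rmat \<beta> n m (F \<omega>))"
proof (rule mat_familyI[where F = "\<lambda>i j \<omega>. Complex (F \<omega> (0, i, j)) (if \<beta> = 2 then F \<omega> (1, i, j) else 0)"])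
  show "(\<lambda>\<omega>. Complex (F \<omega> (0, i, j)) (if \<beta> = 2 then F \<omega> (1, i, j) else 0)) \<in> borel_measurable M"
    if ij: "i < n" "j < m" for i j
  proof (cases "\<beta> = 2")
    case True
    show ?thesis using borel_measurable_Complex[OF assms[OF gidx_0[OF ij]] assms[OF gidx_1[OF ij True]]] True by simp
  next
    case False
    show ?thesis using borel_measurable_Complex[OF assms[OF gidx_0[OF ij]] borel_measurable_const, of 0] False by simp
  qed
qed (simp_all add: rmat_def)

lemma vec_family_rvec:
  assumes "\<And>q. q \<in> {..<\<beta>} \<times> {..<n} \<Longrightarrow> (\<lambda>\<omega>. F \<omega> q) \<in> borel_measurable M"
  shows "vec_family M n (\<lambda>\<omega>. rvec \<beta> n (F \<omega>))"
proof (rule vec_familyI[where F = "\<lambda>i \<omega>. Complex (F \<omega> (0, i)) (if \<beta> = 2 then F \<omega> (1, i) else 0)"])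
  show "(\<lambda>\<omega>. Complex (F \<omega> (0, i)) (if \<beta> = 2 then F \<omega> (1, i) else 0)) \<in> borel_measurable M" if "i < n" for i
    using that beta by (cases "\<beta> = 2") (auto intro!: borel_measurable_Complex assms)
qed (auto simp: rvec_def)

lemma measurable_gaussian_component: "q \<in> I \<Longrightarrow> (\<lambda>f. f q) \<in> borel_measurable (gaussian I)"
  by measurable

lemma sets_gram_event:
  assumes X: "mat_family M n m X" "\<And>\<omega>. \<omega> \<in> space M \<Longrightarrow> mat_in K (X \<omega>)"
    and b: "b \<in> carrier_vec n" "vec_in K b" and A: "A \<in> sets borel"
  shows "{\<omega> \<in> space M. size_event l K k A (gram (X \<omega>)) b} \<in> sets M"
proof (rule sets_size_event[OF mat_family_gram[OF X(1)] _ _ _ _ A])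
  fix \<omega> assume \<omega>: "\<omega> \<in> space M"
  note Xc = mat_family_carrier[OF X(1) \<omega>]
  show "mat_in K (gram (X \<omega>))"
    unfolding gram_def by (intro mat_in_mult[OF Xc adjoint_carrier[OF Xc]] X(2) mat_in_adjoint \<omega>)
  show "positive_definite (gram (X \<omega>)) \<longleftrightarrow> Determinant.det (gram (X \<omega>)) \<noteq> 0"
    by (rule positive_definite_gram_iff_det[OF Xc])
  show "vec_in K b" by (rule b)
next
  show "vec_family M n (\<lambda>_. b)" using b by (simp add: vec_family_def)
qed

section \<open>Probabilities for the unnormalised system\<close>

text \<open>Here \<open>b\<close> is fixed; a random right-hand side is reduced to this case by
  independence in \<open>prob_sys_event\<close>.\<close>

definition prob_size :: "nat \<Rightarrow> nat \<Rightarrow> nat \<Rightarrow> nat \<Rightarrow> real set \<Rightarrow> complex Matrix.vec \<Rightarrow> real" where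
  "prob_size l k n m A b = measure (gaussian (gidx \<beta> n m))
     {f \<in> space (gaussian (gidx \<beta> n m)). size_event l K k A (gram (rmat \<beta> n m f)) b}"

text \<open>The law of a chi variable with \<open>\<beta> * j\<close> degrees of freedom.\<close>

definition prob_norm :: "nat \<Rightarrow> real set \<Rightarrow> real" where
  "prob_norm j G = measure (gaussian ({..<\<beta>} \<times> {..<j}))
     {x \<in> space (gaussian ({..<\<beta>} \<times> {..<j})). norm2 (rvec \<beta> j x) \<in> G}"

lemma sets_rmat_event:
  assumes "b \<in> carrier_vec n" "vec_in K b" "A \<in> sets borel"
  shows "{f \<in> space (gaussian (gidx \<beta> n m)). size_event l K k A (gram (rmat \<beta> n m f)) b} \<in> sets (gaussian (gidx \<beta> n m))"
proof (rule sets_gram_event[OF _ rmat_in assms])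
  show "mat_family (gaussian (gidx \<beta> n m)) n m (\<lambda>f. rmat \<beta> n m f)"
    by (rule mat_family_rmat) (rule measurable_gaussian_component)
qed

text \<open>\<open>cg_size_unitary\<close> starts from a definite Gram matrix, so the two directions
  use \<open>U\<close> and its adjoint.\<close>

lemma size_event_unitary:
  assumes X: "X \<in> carrier_mat n m" "mat_in K X" and b: "b \<in> carrier_vec n" "vec_in K b"
    and U: "U \<in> carrier_mat n n" "mat_in K U" "mat_adjoint U * U = 1\<^sub>m n" "U * mat_adjoint U = 1\<^sub>m n"
  shows "size_event l K k A (gram (U * X)) (U *\<^sub>v b) \<longleftrightarrow> size_event l K k A (gram X) b"
proof -
  note U' = adjoint_carrier[OF U(1)]
  have UX: "U * X \<in> carrier_mat n m" "mat_in K (U * X)" using U X mat_in_mult[OF U(1) X(1)] by auto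
  have Ub: "U *\<^sub>v b \<in> carrier_vec n" "vec_in K (U *\<^sub>v b)"
    using U b vec_in_mult[OF U(1) b(1)] mult_mat_vec_carrier[OF U(1)] by auto
  have inv: "mat_adjoint U * (U * X) = X" "mat_adjoint U *\<^sub>v (U *\<^sub>v b) = b"
    using U X b by (simp_all flip: assoc_mult_mat[OF U' U(1) X(1)] assoc_mult_mat_vec[OF U' U(1) b(1)])
  have UU': "mat_adjoint (mat_adjoint U) * mat_adjoint U = 1\<^sub>m n" "mat_adjoint U * mat_adjoint (mat_adjoint U) = 1\<^sub>m n"
    using U(3,4) by simp_all
  show ?thesis
    unfolding size_event_def
  proof (intro iffI conjI; elim conjE)
    assume "positive_definite (gram X)" and A: "cg_size l K (gram X) b k \<in> A"
    note 1 = cg_size_unitary[OF X this(1) b U(1,3,4)]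
    show "positive_definite (gram (U * X))" by (rule 1(1))
    show "cg_size l K (gram (U * X)) (U *\<^sub>v b) k \<in> A" unfolding 1(2) by (rule A)
  next
    assume "positive_definite (gram (U * X))" and A: "cg_size l K (gram (U * X)) (U *\<^sub>v b) k \<in> A"
    note 1 = cg_size_unitary[OF UX this(1) Ub U' UU', unfolded inv]
    show "positive_definite (gram X)" by (rule 1(1))
    show "cg_size l K (gram X) b k \<in> A" unfolding 1(2) by (rule A)
  qed
qed

lemma prob_size_unitary:
  assumes b: "b \<in> carrier_vec n" "vec_in K b" and A: "A \<in> sets borel"
    and U: "U \<in> carrier_mat n n" "mat_in K U" "mat_adjoint U * U = 1\<^sub>m n" "U * mat_adjoint U = 1\<^sub>m n"
  shows "prob_size l k n m A (U *\<^sub>v b) = prob_size l k n m A b"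
proof -
  have Ub: "U *\<^sub>v b \<in> carrier_vec n" "vec_in K (U *\<^sub>v b)" using U b vec_in_mult[OF U(1) b(1)] mult_mat_vec_carrier[OF U(1)] by auto
  have UX: "U * rmat \<beta> n m f \<in> carrier_mat n m" "mat_in K (U * rmat \<beta> n m f)" for f
    using U mat_in_mult[OF U(1) rmat_carrier] by auto
  have "measure (gaussian (gidx \<beta> n m)) {f \<in> space (gaussian (gidx \<beta> n m)). size_event l K k A (gram (rmat \<beta> n m f)) b}
      = measure (gaussian (gidx \<beta> n m)) {f \<in> space (gaussian (gidx \<beta> n m)). size_event l K k A (gram (rmat \<beta> n m f)) (U *\<^sub>v b)}"
    by (rule measure_preserves[OF preserves_left[OF U(1-3)] sets_rmat_event[OF Ub A]])
       (simp add: rmat_restrict_parts[OF UX] size_event_unitary[OF rmat_carrier rmat_in b U])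
  then show ?thesis by (simp add: prob_size_def)
qed

text \<open>A Householder matrix takes \<open>b\<close> to the first unit vector times a factor of
  modulus 1, and by homogeneity this factor does not change the size.\<close>

lemma prob_size_unit_vec:
  assumes b: "b \<in> carrier_vec n" "vec_in K b" "norm2 b = 1" and n: "0 < n" and A: "A \<in> sets borel"
  shows "prob_size l k n m A b = prob_size l k n m A (unit_vec n 0)"
proof -
  obtain U a where U: "U \<in> carrier_mat n n" "mat_in K U" "mat_adjoint U * U = 1\<^sub>m n" "U * mat_adjoint U = 1\<^sub>m n"
    and Ub: "U *\<^sub>v b = a \<cdot>\<^sub>v unit_vec n 0" and a: "a \<in> K" "cmod a = 1"
    using householder[OF b(1,2) n] b(3) by metis
  have e: "unit_vec n 0 \<in> carrier_vec n" "vec_in K (unit_vec n 0)" by (auto simp: vec_in_def)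
  have "cg_size l K (gram (rmat \<beta> n m f)) (a \<cdot>\<^sub>v unit_vec n 0) k = cg_size l K (gram (rmat \<beta> n m f)) (unit_vec n 0) k"
    if "positive_definite (gram (rmat \<beta> n m f))" for f
  proof -
    have "mat_in K (gram (rmat \<beta> n m f))"
      unfolding gram_def by (intro mat_in_mult[OF rmat_carrier adjoint_carrier[OF rmat_carrier]] rmat_in mat_in_adjoint)
    then show ?thesis using cg_size_smult[OF that gram_carrier[OF rmat_carrier] _ e] a by simp
  qed
  then have "size_event l K k A (gram (rmat \<beta> n m f)) (a \<cdot>\<^sub>v unit_vec n 0)
      \<longleftrightarrow> size_event l K k A (gram (rmat \<beta> n m f)) (unit_vec n 0)" for f
    unfolding size_event_def by (intro conj_cong refl) simp
  then have "prob_size l k n m A (a \<cdot>\<^sub>v unit_vec n 0) = prob_size l k n m A (unit_vec n 0)"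
    unfolding prob_size_def by presburger
  then show ?thesis using prob_size_unitary[OF b(1,2) A U] Ub by simp
qed

lemma norm2_rvec: "(norm2 (rvec \<beta> j x))\<^sup>2 = (\<Sum>q\<in>{..<\<beta>} \<times> {..<j}. (x q)\<^sup>2)"
proof -
  have "(\<Sum>q\<in>{..<\<beta>} \<times> {..<j}. (x q)\<^sup>2) = (\<Sum>i<j. \<Sum>p<\<beta>. (x (p, i))\<^sup>2)"
    unfolding sum.cartesian_product' by (rule sum.swap)
  also have "\<dots> = (\<Sum>i<j. (cmod (rvec \<beta> j x $ i))\<^sup>2)"
    by (intro sum.cong refl) (auto simp: rvec_def cmod_power2 beta_lessThan)
  finally show ?thesis by (simp add: norm2_sq[OF rvec_carrier])
qed

lemma sets_norm_event:
  assumes "G \<in> sets borel"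
  shows "{x \<in> space (gaussian ({..<\<beta>} \<times> {..<j})). norm2 (rvec \<beta> j x) \<in> G} \<in> sets (gaussian ({..<\<beta>} \<times> {..<j}))"
proof -
  let ?M = "gaussian ({..<\<beta>} \<times> {..<j})"
  have "norm2 (rvec \<beta> j x) = sqrt (\<Sum>q\<in>{..<\<beta>} \<times> {..<j}. (x q)\<^sup>2)" for x
    unfolding norm2_rvec[symmetric] by simp
  moreover have "(\<lambda>x. sqrt (\<Sum>q\<in>{..<\<beta>} \<times> {..<j}. (x q)\<^sup>2)) \<in> borel_measurable ?M"
    by (intro measurable_compose[OF _ borel_measurable_sqrt] borel_measurable_sum borel_measurable_power
        measurable_gaussian_component)
  ultimately have "(\<lambda>x. norm2 (rvec \<beta> j x)) \<in> borel_measurable ?M" by simp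
  from measurable_sets[OF this assms] show ?thesis by (simp add: vimage_def Int_def conj_commute)
qed

text \<open>Conditionally on the first row, a rotation of the columns reduces to the case of a bordered matrix.\<close>

lemma prob_size_bordered:
  assumes b: "b \<in> carrier_vec (Suc n)" "vec_in K b" and A: "A \<in> sets borel" and G: "G \<in> sets borel" and \<eta>: "0 \<le> \<eta>"
    and inner: "\<And>a. a \<in> K \<Longrightarrow> cmod a \<in> G \<Longrightarrow>
      \<eta> \<le> measure (gaussian ({..<\<beta>} \<times> {..<n}) \<Otimes>\<^sub>M gaussian (gidx \<beta> n m))
        {z \<in> space (gaussian ({..<\<beta>} \<times> {..<n}) \<Otimes>\<^sub>M gaussian (gidx \<beta> n m)).
          size_event l K k A (gram (bordered a (rvec \<beta> n (fst z)) (rmat \<beta> n m (snd z)))) b}"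
  shows "prob_norm (Suc m) G * \<eta> \<le> prob_size l k (Suc n) (Suc m) A b"
proof -
  let ?R = "gaussian ({..<\<beta>} \<times> {..<Suc m})" and ?Y = "gaussian (gidx \<beta> n (Suc m))"
  let ?C = "gaussian ({..<\<beta>} \<times> {..<n})" and ?Z = "gaussian (gidx \<beta> n m)"
  define P where "P X \<longleftrightarrow> size_event l K k A (gram X) b" for X
  define g1 where "g1 x Y = (\<lambda>(p::nat, i, j::nat). (case i of 0 \<Rightarrow> x (p, j) | Suc i \<Rightarrow> Y (p, i, j)) :: real)" for x Y
  have split1: "distr (?R \<Otimes>\<^sub>M ?Y) (gaussian (gidx \<beta> (Suc n) (Suc m))) (\<lambda>(x, y). restrict (g1 x y) (gidx \<beta> (Suc n) (Suc m)))
      = gaussian (gidx \<beta> (Suc n) (Suc m))"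
    "(\<lambda>(x, y). restrict (g1 x y) (gidx \<beta> (Suc n) (Suc m))) \<in> measurable (?R \<Otimes>\<^sub>M ?Y) (gaussian (gidx \<beta> (Suc n) (Suc m)))"
  proof -
    have *: "finite ({..<\<beta>} \<times> {..<Suc m})" "finite (gidx \<beta> n (Suc m))"
      "inj_on (\<lambda>(p, j). (p, 0, j)) ({..<\<beta>} \<times> {..<Suc m})" "inj_on (\<lambda>(p, i, j). (p, Suc i, j)) (gidx \<beta> n (Suc m))"
      "(\<lambda>(p, j). (p, 0, j)) ` ({..<\<beta>} \<times> {..<Suc m}) \<inter> (\<lambda>(p, i, j). (p, Suc i, j)) ` gidx \<beta> n (Suc m) = {}"
      "gidx \<beta> (Suc n) (Suc m) = (\<lambda>(p, j). (p, 0, j)) ` ({..<\<beta>} \<times> {..<Suc m}) \<union> (\<lambda>(p, i, j). (p, Suc i, j)) ` gidx \<beta> n (Suc m)"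
      by (auto simp: gidx_def inj_on_def image_iff less_Suc_eq_0_disj)
    show "distr (?R \<Otimes>\<^sub>M ?Y) (gaussian (gidx \<beta> (Suc n) (Suc m))) (\<lambda>(x, y). restrict (g1 x y) (gidx \<beta> (Suc n) (Suc m)))
      = gaussian (gidx \<beta> (Suc n) (Suc m))"
      by (rule gaussian_split(1)[OF *]) (auto simp: g1_def)
    show "(\<lambda>(x, y). restrict (g1 x y) (gidx \<beta> (Suc n) (Suc m))) \<in> measurable (?R \<Otimes>\<^sub>M ?Y) (gaussian (gidx \<beta> (Suc n) (Suc m)))"
      by (rule gaussian_split(2)[OF *]) (auto simp: g1_def)
  qed
  have r1: "rmat \<beta> (Suc n) (Suc m) (restrict (g1 x Y) (gidx \<beta> (Suc n) (Suc m))) = rowcons (rvec \<beta> (Suc m) x) (rmat \<beta> n (Suc m) Y)" for x Y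
  proof -
    have "rmat \<beta> (Suc n) (Suc m) (restrict (g1 x Y) (gidx \<beta> (Suc n) (Suc m))) = rmat \<beta> (Suc n) (Suc m) (g1 x Y)"
      by (rule rmat_cong) simp
    also have "\<dots> = rowcons (rvec \<beta> (Suc m) x) (rmat \<beta> n (Suc m) Y)"
      by (rule eq_matI) (auto simp: rmat_def rowcons_def rvec_def g1_def less_Suc_eq_0_disj)
    finally show ?thesis .
  qed
  define g2 where "g2 x Y = (\<lambda>(p::nat, i::nat, j). (case j of 0 \<Rightarrow> x (p, i) | Suc j \<Rightarrow> Y (p, i, j)) :: real)" for x Y
  have split2: "distr (?C \<Otimes>\<^sub>M ?Z) ?Y (\<lambda>(x, y). restrict (g2 x y) (gidx \<beta> n (Suc m))) = ?Y"
    "(\<lambda>(x, y). restrict (g2 x y) (gidx \<beta> n (Suc m))) \<in> measurable (?C \<Otimes>\<^sub>M ?Z) ?Y"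
  proof -
    have *: "finite ({..<\<beta>} \<times> {..<n})" "finite (gidx \<beta> n m)"
      "inj_on (\<lambda>(p, i). (p, i, 0)) ({..<\<beta>} \<times> {..<n})" "inj_on (\<lambda>(p, i, j). (p, i, Suc j)) (gidx \<beta> n m)"
      "(\<lambda>(p, i). (p, i, 0)) ` ({..<\<beta>} \<times> {..<n}) \<inter> (\<lambda>(p, i, j). (p, i, Suc j)) ` gidx \<beta> n m = {}"
      "gidx \<beta> n (Suc m) = (\<lambda>(p, i). (p, i, 0)) ` ({..<\<beta>} \<times> {..<n}) \<union> (\<lambda>(p, i, j). (p, i, Suc j)) ` gidx \<beta> n m"
      by (auto simp: gidx_def inj_on_def image_iff less_Suc_eq_0_disj)
    show "distr (?C \<Otimes>\<^sub>M ?Z) ?Y (\<lambda>(x, y). restrict (g2 x y) (gidx \<beta> n (Suc m))) = ?Y"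
      by (rule gaussian_split(1)[OF *]) (auto simp: g2_def)
    show "(\<lambda>(x, y). restrict (g2 x y) (gidx \<beta> n (Suc m))) \<in> measurable (?C \<Otimes>\<^sub>M ?Z) ?Y"
      by (rule gaussian_split(2)[OF *]) (auto simp: g2_def)
  qed
  have r2: "rmat \<beta> n (Suc m) (restrict (g2 y Z) (gidx \<beta> n (Suc m))) = colcons (rvec \<beta> n y) (rmat \<beta> n m Z)" for y Z
  proof -
    have "rmat \<beta> n (Suc m) (restrict (g2 y Z) (gidx \<beta> n (Suc m))) = rmat \<beta> n (Suc m) (g2 y Z)"
      by (rule rmat_cong) simp
    also have "\<dots> = colcons (rvec \<beta> n y) (rmat \<beta> n m Z)"
      by (rule eq_matI) (auto simp: rmat_def colcons_def rvec_def g2_def less_Suc_eq_0_disj)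
    finally show ?thesis .
  qed
  have fam: "mat_family ?Y (Suc n) (Suc m) (\<lambda>Y. rowcons x (rmat \<beta> n (Suc m) Y))" for x
  proof -
    note R = mat_family_rmat[of n "Suc m" "\<lambda>Y. Y" ?Y, OF measurable_gaussian_component]
    show ?thesis
    proof (rule mat_familyI[where F = "\<lambda>i j Y. case i of 0 \<Rightarrow> x $ j | Suc i \<Rightarrow> rmat \<beta> n (Suc m) Y $$ (i, j)"])
      show "(\<lambda>Y. case i of 0 \<Rightarrow> x $ j | Suc i \<Rightarrow> rmat \<beta> n (Suc m) Y $$ (i, j)) \<in> borel_measurable ?Y"
        if "i < Suc n" "j < Suc m" for i j
        using that mat_family_entry[OF R] by (cases i) auto
    qed (auto simp: rowcons_def split: nat.splits)
  qed
  have inK: "mat_in K (rowcons x (rmat \<beta> n (Suc m) Y))" if "vec_in K x" "x \<in> carrier_vec (Suc m)" for x Y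
    using that rmat_in[of n "Suc m" Y] by (auto simp: mat_in_def rowcons_def vec_in_def rmat_def split: nat.splits)
  have sets1: "{f \<in> space (gaussian (gidx \<beta> (Suc n) (Suc m))). P (rmat \<beta> (Suc n) (Suc m) f)} \<in> sets (gaussian (gidx \<beta> (Suc n) (Suc m)))"
    unfolding P_def by (rule sets_rmat_event[OF b A])
  note m1 = measure_distr_event[OF split1(2,1) sets1, of "\<lambda>z. P (rowcons (rvec \<beta> (Suc m) (fst z)) (rmat \<beta> n (Suc m) (snd z)))"]
  have m1': "prob_size l k (Suc n) (Suc m) A b = measure (?R \<Otimes>\<^sub>M ?Y) {z \<in> space (?R \<Otimes>\<^sub>M ?Y). P (rowcons (rvec \<beta> (Suc m) (fst z)) (rmat \<beta> n (Suc m) (snd z)))}"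
    "{z \<in> space (?R \<Otimes>\<^sub>M ?Y). P (rowcons (rvec \<beta> (Suc m) (fst z)) (rmat \<beta> n (Suc m) (snd z)))} \<in> sets (?R \<Otimes>\<^sub>M ?Y)"
    using m1 by (auto simp: prob_size_def P_def r1 split_def)
  have key: "\<eta> \<le> measure ?Y {Y \<in> space ?Y. P (rowcons (rvec \<beta> (Suc m) x) (rmat \<beta> n (Suc m) Y))}"
    if x: "norm2 (rvec \<beta> (Suc m) x) \<in> G" for x
  proof -
    define v where "v = rvec \<beta> (Suc m) x"
    have v: "v \<in> carrier_vec (Suc m)" "vec_in K v" by (simp_all add: v_def)
    \<comment> \<open>Conjugation is needed since the columns are rotated by an adjoint, see
      \<open>rowcons_mult\<close>; the norm of the row is unaffected.\<close>
    have cv: "conjugate v \<in> carrier_vec (Suc m)" "vec_in K (conjugate v)" "norm2 (conjugate v) = norm2 v"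
      using v by (auto simp: vec_in_def norm2_def intro!: L2_set_cong)
    obtain U a where U: "U \<in> carrier_mat (Suc m) (Suc m)" "mat_in K U" "mat_adjoint U * U = 1\<^sub>m (Suc m)" "U * mat_adjoint U = 1\<^sub>m (Suc m)"
      and Uv: "U *\<^sub>v conjugate v = a \<cdot>\<^sub>v unit_vec (Suc m) 0" and a: "a \<in> K" "cmod a = norm2 v"
      by (rule householder[OF cv(1,2) zero_less_Suc, unfolded cv(3)])
    note U' = adjoint_carrier[OF U(1)] and UK' = mat_in_adjoint[OF U(2)]
    have UU': "mat_adjoint U * mat_adjoint (mat_adjoint U) = 1\<^sub>m (Suc m)" using U(3) by simp
    have cUv: "conjugate (U *\<^sub>v conjugate v) = cnj a \<cdot>\<^sub>v unit_vec (Suc m) 0"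
      unfolding Uv by (rule eq_vecI) (auto simp: unit_vec_def)
    have e: "cnj a \<cdot>\<^sub>v unit_vec (Suc m) 0 \<in> carrier_vec (Suc m)" "vec_in K (cnj a \<cdot>\<^sub>v unit_vec (Suc m) 0)"
      using a by (auto simp: vec_in_def)
    have gram_eq: "gram (rowcons v Y) = gram (rowcons (cnj a \<cdot>\<^sub>v unit_vec (Suc m) 0) (Y * mat_adjoint U))"
      if Y: "Y \<in> carrier_mat n (Suc m)" for Y
    proof -
      have "gram (rowcons v Y) = gram (rowcons v Y * mat_adjoint U)"
        by (rule gram_mult_unitary[OF rowcons_carrier[OF Y] U' UU', symmetric])
      then show ?thesis unfolding rowcons_mult[OF v(1) Y U(1)] cUv .
    qed
    have sets2: "{Y \<in> space ?Y. P (rowcons (cnj a \<cdot>\<^sub>v unit_vec (Suc m) 0) (rmat \<beta> n (Suc m) Y))} \<in> sets ?Y"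
      unfolding P_def by (rule sets_gram_event[OF fam _ b A]) (rule inK[OF e(2,1)])
    have YU: "rmat \<beta> n (Suc m) Y * mat_adjoint U \<in> carrier_mat n (Suc m)" "mat_in K (rmat \<beta> n (Suc m) Y * mat_adjoint U)" for Y
      by (rule mult_carrier_mat[OF rmat_carrier U'], rule mat_in_mult[OF rmat_carrier U' rmat_in UK'])
    \<comment> \<open>The rotation leaves the Gram matrix unchanged, and its effect on the other
      rows is absorbed by the invariance of their law.\<close>
    have "measure ?Y {Y \<in> space ?Y. P (rowcons v (rmat \<beta> n (Suc m) Y))}
        = measure ?Y {Y \<in> space ?Y. P (rowcons (cnj a \<cdot>\<^sub>v unit_vec (Suc m) 0) (rmat \<beta> n (Suc m) Y))}"
    proof (rule measure_preserves[OF preserves_right[OF U' UK' UU'] sets2, of "\<lambda>Y. P (rowcons v (rmat \<beta> n (Suc m) Y))"])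
      fix Y
      show "P (rowcons v (rmat \<beta> n (Suc m) Y)) \<longleftrightarrow> P (rowcons (cnj a \<cdot>\<^sub>v unit_vec (Suc m) 0)
          (rmat \<beta> n (Suc m) (restrict (parts (rmat \<beta> n (Suc m) Y * mat_adjoint U)) (gidx \<beta> n (Suc m)))))"
        unfolding rmat_restrict_parts[OF YU] P_def gram_eq[OF rmat_carrier] ..
    qed
    also have "\<dots> = measure (?C \<Otimes>\<^sub>M ?Z) {z \<in> space (?C \<Otimes>\<^sub>M ?Z). P (bordered (cnj a) (rvec \<beta> n (fst z)) (rmat \<beta> n m (snd z)))}"
      by (rule measure_distr_event(1)[OF split2(2,1) sets2,
            of "\<lambda>z. P (bordered (cnj a) (rvec \<beta> n (fst z)) (rmat \<beta> n m (snd z)))"])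
         (simp only: r2 split_def rowcons_colcons[OF rmat_carrier])
    also have "\<dots> \<ge> \<eta>"
      unfolding P_def using inner[of "cnj a"] a x by (simp add: v_def)
    finally show ?thesis by (simp add: v_def)
  qed
  \<comment> \<open>Integration over the first row; the bound on a section depends on that row only
    through its norm lying in \<open>G\<close>.\<close>
  have "measure ?R {x \<in> space ?R. norm2 (rvec \<beta> (Suc m) x) \<in> G} * \<eta>
      \<le> measure (?R \<Otimes>\<^sub>M ?Y) {z \<in> space (?R \<Otimes>\<^sub>M ?Y). P (rowcons (rvec \<beta> (Suc m) (fst z)) (rmat \<beta> n (Suc m) (snd z)))}"
  proof (rule measure_pair_ge[OF prob_space_gaussian prob_space_gaussian m1'(2) sets_norm_event[OF G] \<eta>])
    fix x assume x: "x \<in> {x \<in> space ?R. norm2 (rvec \<beta> (Suc m) x) \<in> G}"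
    then have "Pair x -` {z \<in> space (?R \<Otimes>\<^sub>M ?Y). P (rowcons (rvec \<beta> (Suc m) (fst z)) (rmat \<beta> n (Suc m) (snd z)))}
        = {Y \<in> space ?Y. P (rowcons (rvec \<beta> (Suc m) x) (rmat \<beta> n (Suc m) Y))}"
      by (auto simp: space_pair_measure)
    then show "\<eta> \<le> measure ?Y (Pair x -` {z \<in> space (?R \<Otimes>\<^sub>M ?Y). P (rowcons (rvec \<beta> (Suc m) (fst z)) (rmat \<beta> n (Suc m) (snd z)))})"
      using key x by simp
  qed
  then show ?thesis unfolding m1'(1) prob_norm_def .
qed

lemma sets_bordered_event:
  assumes a: "a \<in> K" and b: "b \<in> carrier_vec (Suc n)" "vec_in K b" and A: "A \<in> sets borel"
  shows "{z \<in> space (gaussian ({..<\<beta>} \<times> {..<n}) \<Otimes>\<^sub>M gaussian (gidx \<beta> n m)).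
          size_event l K k A (gram (bordered a (rvec \<beta> n (fst z)) (rmat \<beta> n m (snd z)))) b}
      \<in> sets (gaussian ({..<\<beta>} \<times> {..<n}) \<Otimes>\<^sub>M gaussian (gidx \<beta> n m))"
proof (rule sets_gram_event[OF _ _ b A])
  let ?P = "gaussian ({..<\<beta>} \<times> {..<n}) \<Otimes>\<^sub>M gaussian (gidx \<beta> n m)"
  have R: "mat_family ?P n m (\<lambda>z. rmat \<beta> n m (snd z))"
    by (intro mat_family_rmat measurable_compose[OF measurable_snd] measurable_gaussian_component)
  have r: "vec_family ?P n (\<lambda>z. rvec \<beta> n (fst z))"
    by (intro vec_family_rvec measurable_compose[OF measurable_fst] measurable_gaussian_component)
  show "mat_family ?P (Suc n) (Suc m) (\<lambda>z. bordered a (rvec \<beta> n (fst z)) (rmat \<beta> n m (snd z)))"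
  proof (rule mat_familyI[where F = "\<lambda>i j z. case i of 0 \<Rightarrow> (case j of 0 \<Rightarrow> a | Suc j \<Rightarrow> 0)
      | Suc i \<Rightarrow> (case j of 0 \<Rightarrow> rvec \<beta> n (fst z) $ i | Suc j \<Rightarrow> rmat \<beta> n m (snd z) $$ (i, j))"])
    show "(\<lambda>z. case i of 0 \<Rightarrow> (case j of 0 \<Rightarrow> a | Suc j \<Rightarrow> 0)
      | Suc i \<Rightarrow> (case j of 0 \<Rightarrow> rvec \<beta> n (fst z) $ i | Suc j \<Rightarrow> rmat \<beta> n m (snd z) $$ (i, j))) \<in> borel_measurable ?P"
      if "i < Suc n" "j < Suc m" for i j
      using that mat_family_entry[OF R] vec_family_entry[OF r] by (cases i; cases j) auto
  qed (auto simp: bordered_def split: nat.splits)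
  fix z
  show "mat_in K (bordered a (rvec \<beta> n (fst z)) (rmat \<beta> n m (snd z)))"
    using a rmat_in[of n m "snd z"] rvec_in[of n "fst z"]
    by (auto simp: mat_in_def bordered_def vec_in_def rmat_def rvec_def split: nat.splits)
qed

text \<open>\<open>s\<close> is the norm of the first row, \<open>t\<close> the norm of the column
  \<open>y\<close>, and \<open>v\<close> the size at step \<open>k\<close> for the lower block with
  normalised right-hand side. By \<open>cg_size_bordered_Suc\<close> and homogeneity the new size is
  \<open>t * v / s\<close>. Independence of the three gives the product.\<close>

lemma prob_size_Suc:
  assumes A: "A \<in> sets borel" "A' \<in> sets borel" and G: "G1 \<in> sets borel" "G2 \<in> sets borel"
    "G1 \<subseteq> {0<..}" "G2 \<subseteq> {0<..}" and n: "0 < n"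
    and sub: "\<And>s t v. s \<in> G1 \<Longrightarrow> t \<in> G2 \<Longrightarrow> v \<in> A \<Longrightarrow> t * v / s \<in> A'"
  shows "prob_norm (Suc m) G1 * (prob_norm n G2 * prob_size l k n m A (unit_vec n 0))
      \<le> prob_size l (Suc k) (Suc n) (Suc m) A' (unit_vec (Suc n) 0)"
proof (rule prob_size_bordered[OF _ _ A(2) G(1)])
  show "unit_vec (Suc n) 0 \<in> carrier_vec (Suc n)" "vec_in K (unit_vec (Suc n) 0)" by (auto simp: vec_in_def)
  have e: "vec_in K (unit_vec (Suc n) 0)" by (auto simp: vec_in_def)
  show "0 \<le> prob_norm n G2 * prob_size l k n m A (unit_vec n 0)" by (simp add: prob_norm_def prob_size_def)
  fix a assume a: "a \<in> K" "cmod a \<in> G1"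
  then have a0: "a \<noteq> 0" using G(3) by auto
  let ?C = "gaussian ({..<\<beta>} \<times> {..<n})" and ?Z = "gaussian (gidx \<beta> n m)"
  let ?E = "{z \<in> space (?C \<Otimes>\<^sub>M ?Z). size_event l K (Suc k) A' (gram (bordered a (rvec \<beta> n (fst z)) (rmat \<beta> n m (snd z)))) (unit_vec (Suc n) 0)}"
  have "measure ?C {y \<in> space ?C. norm2 (rvec \<beta> n y) \<in> G2} * prob_size l k n m A (unit_vec n 0) \<le> measure (?C \<Otimes>\<^sub>M ?Z) ?E"
  proof (rule measure_pair_ge[OF prob_space_gaussian prob_space_gaussian _ sets_norm_event[OF G(2)]])
    show E: "?E \<in> sets (?C \<Otimes>\<^sub>M ?Z)" by (rule sets_bordered_event[OF a(1) _ e A(2)]) simp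
    show "0 \<le> prob_size l k n m A (unit_vec n 0)" by (simp add: prob_size_def)
    fix y assume y: "y \<in> {y \<in> space ?C. norm2 (rvec \<beta> n y) \<in> G2}"
    define t where "t = norm2 (rvec \<beta> n y)"
    have t: "t \<in> G2" "0 < t" using y G(4) by (auto simp: t_def)
    \<comment> \<open>For fixed \<open>y\<close> the lower system depends on the direction
      \<open>u\<close> and the length \<open>t\<close> only, and by unitary invariance the
      probability is the same for every direction.\<close>
    define u where "u = of_real (1 / t) \<cdot>\<^sub>v rvec \<beta> n y"
    have u: "u \<in> carrier_vec n" "vec_in K u" unfolding u_def by (simp, intro vec_in_smult K_real rvec_in)
    have nu: "norm2 u = 1" using t(2) unfolding u_def norm2_smult t_def[symmetric] by (simp add: norm_divide)
    have yu: "rvec \<beta> n y = of_real t \<cdot>\<^sub>v u" using t(2) by (simp add: u_def smult_smult_assoc)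
    have "prob_size l k n m A (unit_vec n 0) = prob_size l k n m A u"
      by (rule prob_size_unit_vec[OF u nu n A(1), symmetric])
    also have "\<dots> \<le> measure ?Z (Pair y -` ?E)"
      unfolding prob_size_def
    proof (rule finite_measure.finite_measure_mono)
      show "finite_measure ?Z" using prob_space_gaussian prob_space.finite_measure by blast
      show "Pair y -` ?E \<in> sets ?Z" by (rule sets_Pair1[OF E])
      show "{f \<in> space ?Z. size_event l K k A (gram (rmat \<beta> n m f)) u} \<subseteq> Pair y -` ?E"
      proof
        fix f assume f: "f \<in> {f \<in> space ?Z. size_event l K k A (gram (rmat \<beta> n m f)) u}"
        let ?V = "gram (rmat \<beta> n m f)"
        have pd: "positive_definite ?V" and cs: "cg_size l K ?V u k \<in> A" using f by (auto simp: size_event_def)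
        have VK: "mat_in K ?V"
          unfolding gram_def by (intro mat_in_mult[OF rmat_carrier adjoint_carrier[OF rmat_carrier]] rmat_in mat_in_adjoint)
        have "cg_size l K (gram (bordered a (rvec \<beta> n y) (rmat \<beta> n m f))) (unit_vec (Suc n) 0) (Suc k)
            = cg_size l K ?V (rvec \<beta> n y) k / cmod a"
          by (rule cg_size_bordered_Suc[OF rvec_carrier rvec_in rmat_carrier rmat_in a0 a(1) pd])
        also have "cg_size l K ?V (rvec \<beta> n y) k = t * cg_size l K ?V u k"
          unfolding yu using cg_size_smult[OF pd gram_carrier[OF rmat_carrier] VK u] t(2) by simp
        also have "t * cg_size l K ?V u k / cmod a \<in> A'" by (rule sub[OF a(2) t(1) cs])
        finally show "f \<in> Pair y -` ?E"
          using f y positive_definite_bordered[OF rvec_carrier rmat_carrier a0 pd]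
          by (auto simp: size_event_def space_pair_measure)
      qed
    qed
    finally show "prob_size l k n m A (unit_vec n 0) \<le> measure ?Z (Pair y -` ?E)" .
  qed
  then show "prob_norm n G2 * prob_size l k n m A (unit_vec n 0) \<le> measure (?C \<Otimes>\<^sub>M ?Z) ?E"
    unfolding prob_norm_def .
qed

text \<open>By unitary invariance the right-hand side may be any unit vector. For one with first
  entry 0 the initial energy is that of the smaller system, so all that is asked of the first row is
  to be nonzero.\<close>

lemma prob_size_0_Suc:
  assumes A: "A \<in> sets borel" and n: "0 < n"
  shows "prob_norm (Suc m) {0<..} * prob_size 1 0 n m A (unit_vec n 0) \<le> prob_size 1 0 (Suc n) (Suc m) A (unit_vec (Suc n) 0)"
proof -
  define b where "b = vCons 0 (unit_vec n 0 :: complex Matrix.vec)"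
  have e: "vec_in K (unit_vec n 0)" by (auto simp: vec_in_def)
  have b: "b \<in> carrier_vec (Suc n)" "vec_in K b" using e by (auto simp: b_def vec_in_vCons)
  have "ip b b = 1" unfolding b_def using n by (simp add: scalar_prod_left_unit)
  then have "complex_of_real ((norm2 b)\<^sup>2) = of_real (1\<^sup>2)" by (simp add: ip_self)
  then have "(norm2 b)\<^sup>2 = 1" unfolding of_real_eq_iff by simp
  then have nb: "norm2 b = 1" using norm2_nonneg[of b] by (auto simp: power2_eq_1_iff)
  have "prob_norm (Suc m) {0<..} * prob_size 1 0 n m A (unit_vec n 0) \<le> prob_size 1 0 (Suc n) (Suc m) A b"
  proof (rule prob_size_bordered[OF b A])
    show "0 \<le> prob_size 1 0 n m A (unit_vec n 0)" by (simp add: prob_size_def)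
    fix a assume a: "a \<in> K" "cmod a \<in> {0<..}"
    then have a0: "a \<noteq> 0" by auto
    let ?C = "gaussian ({..<\<beta>} \<times> {..<n})" and ?Z = "gaussian (gidx \<beta> n m)"
    let ?E = "{z \<in> space (?C \<Otimes>\<^sub>M ?Z). size_event 1 K 0 A (gram (bordered a (rvec \<beta> n (fst z)) (rmat \<beta> n m (snd z)))) b}"
    interpret C: prob_space ?C by (rule prob_space_gaussian)
    have "measure ?C (space ?C) * prob_size 1 0 n m A (unit_vec n 0) \<le> measure (?C \<Otimes>\<^sub>M ?Z) ?E"
    proof (rule measure_pair_ge[OF prob_space_gaussian prob_space_gaussian _ sets.top])
      show E: "?E \<in> sets (?C \<Otimes>\<^sub>M ?Z)" by (rule sets_bordered_event[OF a(1) b A])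
      show "0 \<le> prob_size 1 0 n m A (unit_vec n 0)" by (simp add: prob_size_def)
      fix y assume y: "y \<in> space ?C"
      show "prob_size 1 0 n m A (unit_vec n 0) \<le> measure ?Z (Pair y -` ?E)"
        unfolding prob_size_def
      proof (rule finite_measure.finite_measure_mono)
        show "finite_measure ?Z" using prob_space_gaussian prob_space.finite_measure by blast
        show "Pair y -` ?E \<in> sets ?Z" by (rule sets_Pair1[OF E])
        show "{f \<in> space ?Z. size_event 1 K 0 A (gram (rmat \<beta> n m f)) (unit_vec n 0)} \<subseteq> Pair y -` ?E"
          using y positive_definite_bordered[OF rvec_carrier rmat_carrier a0]
            cg_size_bordered_0[OF rvec_carrier rmat_carrier _ a0, of "unit_vec n 0" n]
          by (auto simp: size_event_def space_pair_measure b_def)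
      qed
    qed
    then show "prob_size 1 0 n m A (unit_vec n 0) \<le> measure (?C \<Otimes>\<^sub>M ?Z) ?E"
      using C.prob_space by simp
  qed auto
  then show ?thesis using prob_size_unit_vec[OF b nb _ A] by simp
qed

text \<open>By \<open>cg_size_bordered_1\<close> the initial energy norm of a one-row system is the
  reciprocal of the norm of that row, which has \<open>m + 1\<close> entries.\<close>

lemma prob_size_0_1:
  assumes A: "A \<in> sets borel" and G: "G \<in> sets borel" "G \<subseteq> {0<..}" and sub: "\<And>s. s \<in> G \<Longrightarrow> 1 / s \<in> A"
  shows "prob_norm (Suc m) G \<le> prob_size 1 0 1 (Suc m) A (unit_vec 1 0)"
proof -
  have "prob_norm (Suc m) G * 1 \<le> prob_size 1 0 (Suc 0) (Suc m) A (unit_vec (Suc 0) 0)"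
  proof (rule prob_size_bordered[OF _ _ A G(1)])
    show "vec_in K (unit_vec (Suc 0) 0)" by (auto simp: vec_in_def)
    fix a assume a: "a \<in> K" "cmod a \<in> G"
    then have a0: "a \<noteq> 0" using G(2) by auto
    let ?P = "gaussian ({..<\<beta>} \<times> {..<0}) \<Otimes>\<^sub>M gaussian (gidx \<beta> 0 m)"
    interpret C: prob_space "gaussian ({..<\<beta>} \<times> {..<0::nat})" by (rule prob_space_gaussian)
    interpret Z: prob_space "gaussian (gidx \<beta> 0 m)" by (rule prob_space_gaussian)
    interpret P: pair_prob_space "gaussian ({..<\<beta>} \<times> {..<0::nat})" "gaussian (gidx \<beta> 0 m)" ..
    have "size_event 1 K 0 A (gram (bordered a (rvec \<beta> 0 (fst z)) (rmat \<beta> 0 m (snd z)))) (unit_vec (Suc 0) 0)" for z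
      using cg_size_bordered_1[OF rvec_carrier rmat_carrier a0, of "fst z" m "snd z"] sub[OF a(2)] by (simp add: size_event_def)
    then have "{z \<in> space ?P. size_event 1 K 0 A (gram (bordered a (rvec \<beta> 0 (fst z)) (rmat \<beta> 0 m (snd z)))) (unit_vec (Suc 0) 0)} = space ?P"
      by blast
    then show "1 \<le> measure ?P {z \<in> space ?P. size_event 1 K 0 A (gram (bordered a (rvec \<beta> 0 (fst z)) (rmat \<beta> 0 m (snd z)))) (unit_vec (Suc 0) 0)}"
      using P.prob_space by simp
  qed auto
  then show ?thesis by simp
qed

end

section \<open>Limits in probability\<close>

lemma emeasure_std_normal_singleton: "emeasure std_normal {x} = 0"
proof -
  have "emeasure std_normal {x} = (\<integral>\<^sup>+y. ennreal (std_normal_density y) * indicator {x} y \<partial>lborel)"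
    by (rule emeasure_density) auto
  also have "\<dots> = 0"
    by (subst nn_integral_0_iff_AE) (auto intro!: AE_I[of _ _ "{x}"])
  finally show ?thesis .
qed

lemma tendsto_eventually_eq:
  assumes "(f \<longlongrightarrow> a) F" "\<forall>\<^sub>F i in F. f i = g i" "a = b"
  shows "(g \<longlongrightarrow> b) F"
  using Lim_transform_eventually[OF assms(1,2)] assms(3) by simp

text \<open>Coordinatewise form of continuity. The radius is divided by 4 because the distance of
  tuples is at most the sum of the four coordinate distances.\<close>

lemma eps_delta4:
  fixes h :: "real \<times> real \<times> real \<times> real \<Rightarrow> real"
  assumes h: "isCont h (a, b, c, e)" and \<epsilon>: "0 < \<epsilon>"
  obtains \<delta> where "0 < \<delta>" "\<And>x y z r. \<bar>x - a\<bar> < \<delta> \<Longrightarrow> \<bar>y - b\<bar> < \<delta> \<Longrightarrow> \<bar>z - c\<bar> < \<delta> \<Longrightarrow> \<bar>r - e\<bar> < \<delta> \<Longrightarrow>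
    \<bar>h (x, y, z, r) - h (a, b, c, e)\<bar> < \<epsilon>"
proof -
  obtain \<delta> where \<delta>: "0 < \<delta>" "\<And>p. dist p (a, b, c, e) < \<delta> \<Longrightarrow> dist (h p) (h (a, b, c, e)) < \<epsilon>"
    using h \<epsilon> unfolding continuous_at_eps_delta by metis
  have d2: "dist (u, v) (u', v') \<le> dist u u' + dist v v'" for u u' :: "'x::metric_space" and v v' :: "'y::metric_space"
    using sqrt_sum_squares_le_sum_abs[of "dist u u'" "dist v v'"] by (simp add: dist_Pair_Pair)
  show ?thesis
  proof (rule that[of "\<delta> / 4"])
    fix x y z r assume *: "\<bar>x - a\<bar> < \<delta> / 4" "\<bar>y - b\<bar> < \<delta> / 4" "\<bar>z - c\<bar> < \<delta> / 4" "\<bar>r - e\<bar> < \<delta> / 4"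
    have "dist (x, y, z, r) (a, b, c, e) \<le> \<bar>x - a\<bar> + (\<bar>y - b\<bar> + (\<bar>z - c\<bar> + \<bar>r - e\<bar>))"
      using d2[of x "(y, z, r)" a "(b, c, e)"] d2[of y "(z, r)" b "(c, e)"] d2[of z r c e]
      by (simp add: dist_real_def)
    also have "\<dots> < \<delta>" using * by simp
    finally show "\<bar>h (x, y, z, r) - h (a, b, c, e)\<bar> < \<epsilon>" using \<delta>(2) by (simp add: dist_real_def)
  qed (use \<delta> in simp)
qed

section \<open>Convergence of the sizes at a fixed step\<close>

context wishart_beta
begin

lemma beta_pos: "0 < \<beta>" using beta by auto

lemma prob_norm_le_1: "prob_norm j G \<le> 1"
  unfolding prob_norm_def by (rule prob_space.prob_le_1[OF prob_space_gaussian])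

lemma prob_size_le_1: "prob_size l k n m A b \<le> 1"
  unfolding prob_size_def by (rule prob_space.prob_le_1[OF prob_space_gaussian])

lemma prob_norm_pos: "prob_norm (Suc j) {0<..} = 1"
proof -
  let ?I = "{..<\<beta>} \<times> {..<Suc j}"
  let ?M = "gaussian ?I"
  interpret prob_space ?M by (rule prob_space_gaussian)
  \<comment> \<open>The norm vanishes only if the coordinate \<open>(0, 0)\<close> does, which is
    already a null event.\<close>
  define A where "A q = (if q = (0, 0) then {0} else UNIV :: real set)" for q :: "nat \<times> nat"
  have q0: "(0, 0) \<in> ?I" using beta_pos by auto
  have As: "A q \<in> sets borel" for q by (simp add: A_def)
  have "emeasure ?M (Pi\<^sub>E ?I A) = (\<Prod>q\<in>?I. emeasure std_normal (A q))"
    by (rule emeasure_gaussian_PiE) (auto simp: As)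
  also have "\<dots> = 0"
    using q0 emeasure_std_normal_singleton[of 0] by (intro prod_zero) (auto simp: A_def intro!: bexI[of _ "(0, 0)"])
  finally have null: "emeasure ?M (Pi\<^sub>E ?I A) = 0" .
  have "AE x in ?M. 0 < norm2 (rvec \<beta> (Suc j) x)"
  proof (rule AE_I[OF _ null PiE_in_sets_gaussian])
    show "{x \<in> space ?M. \<not> 0 < norm2 (rvec \<beta> (Suc j) x)} \<subseteq> Pi\<^sub>E ?I A"
    proof
      fix x assume x: "x \<in> {x \<in> space ?M. \<not> 0 < norm2 (rvec \<beta> (Suc j) x)}"
      then have "(norm2 (rvec \<beta> (Suc j) x))\<^sup>2 = 0" using norm2_nonneg[of "rvec \<beta> (Suc j) x"] by auto
      then have "(\<Sum>q\<in>?I. (x q)\<^sup>2) = 0" by (simp only: norm2_rvec)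
      then have "\<forall>q\<in>?I. x q = 0" by (subst (asm) sum_nonneg_eq_0_iff) auto
      then show "x \<in> Pi\<^sub>E ?I A" using x by (auto simp: space_gaussian A_def PiE_def)
    qed
  qed (auto simp: As)
  then have "prob {x \<in> space ?M. norm2 (rvec \<beta> (Suc j) x) \<in> {0<..}} = 1"
    using sets_norm_event[of "{0<..}" "Suc j"] by (subst prob_Collect_eq_1) auto
  then show ?thesis by (simp add: prob_norm_def)
qed

text \<open>For nonnegative \<open>s\<close> and \<open>c\<close> one has
  \<open>(s - c)\<^sup>2 \<le> \<bar>s\<^sup>2 - c\<^sup>2\<bar>\<close>, so concentration of the
  squared norm suffices. A deviation by \<epsilon> forces one by \<open>\<epsilon>\<^sup>2\<close>
  in the squares; \<open>close\<close> accounts for half of it, and Chebyshev with the other half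
  gives the constant 8 and the fourth power.\<close>

lemma prob_norm_ge:
  assumes t: "0 < t" and c: "0 \<le> c" and \<epsilon>: "0 < \<epsilon>" and close: "\<bar>real (\<beta> * J) / t\<^sup>2 - c\<^sup>2\<bar> \<le> \<epsilon>\<^sup>2 / 2"
  shows "1 - 8 / \<epsilon> ^ 4 * (real (\<beta> * J) / t\<^sup>2 * (1 / t\<^sup>2)) \<le> prob_norm J {s. \<bar>s / t - c\<bar> < \<epsilon>}"
proof -
  let ?I = "{..<\<beta>} \<times> {..<J}"
  let ?M = "gaussian ?I"
  let ?G = "{s. \<bar>s / t - c\<bar> < \<epsilon>}"
  interpret prob_space ?M by (rule prob_space_gaussian)
  have G: "?G \<in> sets borel" by measurable
  note E = sets_norm_event[OF G, of J]
  define a where "a = \<epsilon>\<^sup>2 / 2 * t\<^sup>2"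
  have a: "0 < a" using t \<epsilon> by (simp add: a_def)
  have F: "{x \<in> space ?M. a \<le> \<bar>(\<Sum>q\<in>?I. (x q)\<^sup>2) - real (card ?I)\<bar>} \<in> sets ?M"
  proof -
    have "(\<lambda>x. \<bar>(\<Sum>q\<in>?I. (x q)\<^sup>2) - real (card ?I)\<bar>) \<in> borel_measurable ?M"
      by (intro borel_measurable_abs borel_measurable_diff borel_measurable_sum borel_measurable_power
          measurable_gaussian_component borel_measurable_const)
    from measurable_sets[OF this, of "{a..}"] show ?thesis by (simp add: vimage_def Int_def conj_commute)
  qed
  have "space ?M - {x \<in> space ?M. norm2 (rvec \<beta> J x) \<in> ?G}
      \<subseteq> {x \<in> space ?M. a \<le> \<bar>(\<Sum>q\<in>?I. (x q)\<^sup>2) - real (card ?I)\<bar>}"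
  proof
    fix x assume x: "x \<in> space ?M - {x \<in> space ?M. norm2 (rvec \<beta> J x) \<in> ?G}"
    define s where "s = norm2 (rvec \<beta> J x) / t"
    have s: "0 \<le> s" "\<epsilon> \<le> \<bar>s - c\<bar>" using x t by (auto simp: s_def not_less)
    have "\<epsilon>\<^sup>2 \<le> \<bar>s - c\<bar> * \<bar>s - c\<bar>" unfolding power2_eq_square using s(2) \<epsilon> by (intro mult_mono) auto
    also have "\<dots> \<le> \<bar>s - c\<bar> * \<bar>s + c\<bar>" using s(1) c by (intro mult_left_mono) auto
    also have "\<dots> = \<bar>s\<^sup>2 - c\<^sup>2\<bar>" unfolding abs_mult[symmetric] by (simp add: power2_eq_square algebra_simps)
    also have "\<bar>s\<^sup>2 - c\<^sup>2\<bar> \<le> \<bar>s\<^sup>2 - real (\<beta> * J) / t\<^sup>2\<bar> + \<bar>real (\<beta> * J) / t\<^sup>2 - c\<^sup>2\<bar>"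
      by (rule order_trans[OF _ abs_triangle_ineq]) simp
    also have "\<dots> \<le> \<bar>s\<^sup>2 - real (\<beta> * J) / t\<^sup>2\<bar> + \<epsilon>\<^sup>2 / 2" using close by (rule add_left_mono)
    finally have "\<epsilon>\<^sup>2 / 2 \<le> \<bar>s\<^sup>2 - real (\<beta> * J) / t\<^sup>2\<bar>" by simp
    then have "a \<le> \<bar>s\<^sup>2 - real (\<beta> * J) / t\<^sup>2\<bar> * t\<^sup>2" using t unfolding a_def by (intro mult_right_mono) auto
    also have "\<dots> = \<bar>(s\<^sup>2 - real (\<beta> * J) / t\<^sup>2) * t\<^sup>2\<bar>" by (simp add: abs_mult)
    also have "(s\<^sup>2 - real (\<beta> * J) / t\<^sup>2) * t\<^sup>2 = (norm2 (rvec \<beta> J x))\<^sup>2 - real (\<beta> * J)"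
      using t by (simp add: s_def power_divide left_diff_distrib)
    finally show "x \<in> {x \<in> space ?M. a \<le> \<bar>(\<Sum>q\<in>?I. (x q)\<^sup>2) - real (card ?I)\<bar>}"
      using x by (simp add: norm2_rvec card_cartesian_product)
  qed
  then have "prob (space ?M - {x \<in> space ?M. norm2 (rvec \<beta> J x) \<in> ?G})
      \<le> prob {x \<in> space ?M. a \<le> \<bar>(\<Sum>q\<in>?I. (x q)\<^sup>2) - real (card ?I)\<bar>}"
    by (rule finite_measure_mono) (rule F)
  also have "\<dots> \<le> 2 * real (card ?I) / a\<^sup>2"
    by (rule chi_square_concentration[OF _ a]) simp
  also have "\<dots> = 8 / \<epsilon> ^ 4 * (real (\<beta> * J) / t\<^sup>2 * (1 / t\<^sup>2))"
    using t \<epsilon> by (simp add: a_def card_cartesian_product field_simps power2_eq_square power4_eq_xxxx)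
  finally show ?thesis
    unfolding prob_norm_def prob_compl[OF E] by simp
qed

lemma prob_norm_tendsto:
  assumes t: "filterlim t at_top sequentially" and c: "0 \<le> c" and \<epsilon>: "0 < \<epsilon>"
    and lim: "(\<lambda>i. real (\<beta> * J i) / (t i)\<^sup>2) \<longlonglongrightarrow> c\<^sup>2"
  shows "(\<lambda>i. prob_norm (J i) {s. \<bar>s / t i - c\<bar> < \<epsilon>}) \<longlonglongrightarrow> 1"
proof (rule tendsto_sandwich[OF _ _ _ tendsto_const])
  have t2: "filterlim (\<lambda>i. (t i)\<^sup>2) at_top sequentially"
    using filterlim_pow_at_top[OF _ t, of 2] by simp
  have "(\<lambda>i. 1 - 8 / \<epsilon> ^ 4 * (real (\<beta> * J i) / (t i)\<^sup>2 * (1 / (t i)\<^sup>2))) \<longlonglongrightarrow> 1 - 8 / \<epsilon> ^ 4 * (c\<^sup>2 * 0)"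
    by (intro tendsto_intros lim tendsto_divide_0[OF tendsto_const] filterlim_at_top_imp_at_infinity t2)
  then show "(\<lambda>i. 1 - 8 / \<epsilon> ^ 4 * (real (\<beta> * J i) / (t i)\<^sup>2 * (1 / (t i)\<^sup>2))) \<longlonglongrightarrow> 1" by simp
  have "0 < \<epsilon>\<^sup>2 / 2" using \<epsilon> by simp
  from tendstoD[OF lim this] have "\<forall>\<^sub>F i in sequentially. \<bar>real (\<beta> * J i) / (t i)\<^sup>2 - c\<^sup>2\<bar> < \<epsilon>\<^sup>2 / 2"
    by (simp add: dist_real_def)
  moreover have "\<forall>\<^sub>F i in sequentially. 0 < t i"
    using t by (simp add: filterlim_at_top_dense)
  ultimately show "\<forall>\<^sub>F i in sequentially. 1 - 8 / \<epsilon> ^ 4 * (real (\<beta> * J i) / (t i)\<^sup>2 * (1 / (t i)\<^sup>2))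
      \<le> prob_norm (J i) {s. \<bar>s / t i - c\<bar> < \<epsilon>}"
    by eventually_elim (rule prob_norm_ge[OF _ c \<epsilon>], auto)
qed (simp add: prob_norm_le_1)

text \<open>Each step drops a row and a column and costs no probability, by
  \<open>prob_norm_pos\<close>. After \<open>n\<close> steps one row of \<open>j + 1\<close> entries
  is left, so the initial energy is governed by a chi variable with \<open>\<beta> * (j + 1)\<close>
  degrees of freedom.\<close>

lemma prob_size_0_ge:
  assumes A: "A \<in> sets borel" and G: "G \<in> sets borel" "G \<subseteq> {0<..}" and sub: "\<And>s. s \<in> G \<Longrightarrow> 1 / s \<in> A"
  shows "prob_norm (Suc j) G \<le> prob_size 1 0 (Suc n) (Suc (n + j)) A (unit_vec (Suc n) 0)"
proof (induction n)
  case 0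
  show ?case using prob_size_0_1[OF A G sub] by simp
next
  case (Suc n)
  show ?case
    using Suc.IH prob_size_0_Suc[OF A, of "Suc n" "Suc (n + j)"] by (simp add: prob_norm_pos)
qed

lemma prob_size_mono:
  assumes "A \<subseteq> B" "A \<in> sets borel" "B \<in> sets borel" "b \<in> carrier_vec n" "vec_in K b"
  shows "prob_size l k n m A b \<le> prob_size l k n m B b"
  unfolding prob_size_def
  by (rule finite_measure.finite_measure_mono[OF prob_space.finite_measure[OF prob_space_gaussian]])
     (use assms sets_rmat_event in \<open>auto simp: size_event_def\<close>)

text \<open>With \<open>UNIV\<close> the left-hand side is the probability of definiteness alone,
  which thus carries over from the energy case; the initial residual is the right-hand side itself,
  of norm 1.\<close>

lemma prob_size_residual_0:
  assumes n: "0 < n" and A: "A \<in> sets borel" "1 \<in> A"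
  shows "prob_size 1 0 n m UNIV (unit_vec n 0) \<le> prob_size 2 0 n m A (unit_vec n 0)"
proof -
  let ?e = "unit_vec n 0 :: complex Matrix.vec"
  have e: "?e \<in> carrier_vec n" "vec_in K ?e" by (auto simp: vec_in_def)
  have "ip ?e ?e = 1" using n by (simp add: scalar_prod_left_unit)
  then have "complex_of_real ((norm2 ?e)\<^sup>2) = of_real (1\<^sup>2)" by (simp add: ip_self)
  then have "(norm2 ?e)\<^sup>2 = 1" unfolding of_real_eq_iff by simp
  then have ne: "norm2 ?e = 1" using norm2_nonneg[of ?e] by (auto simp: power2_eq_1_iff)
  have "cg_size 2 K (gram (rmat \<beta> n m f)) ?e 0 = 1" if pd: "positive_definite (gram (rmat \<beta> n m f))" for f
  proof -
    note G = gram_carrier[OF rmat_carrier[of n m f]]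
    note x = cramer[OF G det_ne_0_if_positive_definite[OF pd G] e(1)]
    show ?thesis using cg_size_0[OF pd G x(1), of 2] by (simp add: x(2) err_size_def ne)
  qed
  then show ?thesis
    unfolding prob_size_def
    by (intro finite_measure.finite_measure_mono[OF prob_space.finite_measure[OF prob_space_gaussian]] sets_rmat_event e A)
       (auto simp: size_event_def A)
qed

text \<open>Division of the Gram matrix by \<open>\<beta> * m\<close> multiplies energy norms of
  errors by the square root of this number and leaves residuals unchanged.\<close>

definition scale :: "nat \<Rightarrow> nat \<Rightarrow> real" where
  "scale l m = (if l = 1 then sqrt (real (\<beta> * m)) else 1)"

text \<open>The closed form of \<open>limit_error\<close>, by \<open>limit_error_eq\<close>. The
  probabilistic part uses only this form.\<close>

definition size_limit :: "nat \<Rightarrow> nat \<Rightarrow> real \<Rightarrow> real" where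
  "size_limit l k d = sqrt (d ^ k / (if l = 1 then 1 - d else 1))"

text \<open>\<open>N\<close> and \<open>M\<close> are arbitrary in the induction on
  \<open>k\<close>, which passes to \<open>N - 1\<close> and \<open>M - 1\<close>. The scale changes
  along with \<open>M\<close>, and the quotient of the two scales tends to 1.\<close>

theorem prob_size_tendsto:
  assumes d: "0 < d" "d < 1" and l: "l \<in> {1, 2}" and \<epsilon>: "0 < \<epsilon>"
    and N: "filterlim N at_top sequentially" and M: "filterlim M at_top sequentially"
    and NM: "(\<lambda>i. real (N i) / real (M i)) \<longlonglongrightarrow> d"
  shows "(\<lambda>i. prob_size l k (N i) (M i) {v. \<bar>scale l (M i) * v - size_limit l k d\<bar> < \<epsilon>} (unit_vec (N i) 0)) \<longlonglongrightarrow> 1"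
  using \<epsilon> N M NM
proof (induction k arbitrary: \<epsilon> N M)
  case 0
  define t where "t i = sqrt (real (\<beta> * M i))" for i
  have Mr: "filterlim (\<lambda>i. real (M i)) at_top sequentially"
    using filterlim_compose[OF filterlim_real_sequentially 0(3)] .
  have bM: "filterlim (\<lambda>i. real (\<beta> * M i)) at_top sequentially"
    using filterlim_tendsto_pos_mult_at_top[OF tendsto_const _ Mr, of "real \<beta>"] beta_pos by simp
  have t: "filterlim t at_top sequentially"
    unfolding t_def by (rule filterlim_compose[OF sqrt_at_top bM])
  have M0: "\<forall>\<^sub>F i in sequentially. 0 < M i" by (rule eventually_compose_filterlim[OF eventually_gt_at_top 0(3)])
  have N0: "\<forall>\<^sub>F i in sequentially. 0 < N i" by (rule eventually_compose_filterlim[OF eventually_gt_at_top 0(2)])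
  have "\<forall>\<^sub>F i in sequentially. real (N i) / real (M i) < 1" using order_tendstoD(2)[OF 0(4) d(2)] .
  with M0 have NltM: "\<forall>\<^sub>F i in sequentially. N i < M i" by eventually_elim (simp add: divide_simps split: if_splits)
  have inv: "(\<lambda>i. 1 / real (M i)) \<longlonglongrightarrow> 0"
    by (rule tendsto_divide_0[OF tendsto_const filterlim_at_top_imp_at_infinity[OF Mr]])
  \<comment> \<open>The energy case comes first: for \<open>l = 2\<close> it still provides the
    probability of definiteness.\<close>
  have l1: "(\<lambda>i. prob_size 1 0 (N i) (M i) {v. \<bar>scale 1 (M i) * v - size_limit 1 0 d\<bar> < \<epsilon>} (unit_vec (N i) 0)) \<longlonglongrightarrow> 1"
    if \<epsilon>: "0 < \<epsilon>" for \<epsilon>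
  proof -
    define c where "c = sqrt (1 - d)"
    have c: "0 < c" using d by (simp add: c_def)
    have L: "size_limit 1 0 d = 1 / c" by (simp add: size_limit_def c_def real_sqrt_divide)
    have "isCont (\<lambda>x. 1 / x) c" using c by (intro continuous_intros) auto
    then obtain \<delta>0 where \<delta>0: "0 < \<delta>0" "\<And>x. \<bar>x - c\<bar> < \<delta>0 \<Longrightarrow> \<bar>1 / x - 1 / c\<bar> < \<epsilon>"
      using \<epsilon> unfolding continuous_at_eps_delta dist_real_def by metis
    \<comment> \<open>The bound by \<open>c\<close> forces \<open>s\<close> to be positive, as the
      reciprocal requires.\<close>
    define \<delta> where "\<delta> = min \<delta>0 c"
    have \<delta>: "0 < \<delta>" using \<delta>0 c by (simp add: \<delta>_def)
    \<comment> \<open>The remaining row has \<open>M - N + 1\<close> entries; relative to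
      \<open>M\<close> this tends to \<open>1 - d\<close>.\<close>
    define J where "J i = Suc (M i - N i)" for i
    have "(\<lambda>i. 1 - real (N i) / real (M i) + 1 / real (M i)) \<longlonglongrightarrow> 1 - d + 0"
      by (intro tendsto_intros 0(4) inv)
    moreover have "\<forall>\<^sub>F i in sequentially. 1 - real (N i) / real (M i) + 1 / real (M i) = real (\<beta> * J i) / (t i)\<^sup>2"
      using NltM M0 by eventually_elim (use beta_pos in \<open>simp add: J_def t_def of_nat_diff field_simps\<close>)
    ultimately have "(\<lambda>i. real (\<beta> * J i) / (t i)\<^sup>2) \<longlonglongrightarrow> c\<^sup>2"
      by (rule tendsto_eventually_eq) (use d in \<open>simp add: c_def\<close>)
    then have lim: "(\<lambda>i. prob_norm (J i) {s. \<bar>s / t i - c\<bar> < \<delta>}) \<longlonglongrightarrow> 1"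
      by (rule prob_norm_tendsto[OF t less_imp_le[OF c] \<delta>])
    have ge: "\<forall>\<^sub>F i in sequentially. prob_norm (J i) {s. \<bar>s / t i - c\<bar> < \<delta>}
        \<le> prob_size 1 0 (N i) (M i) {v. \<bar>scale 1 (M i) * v - size_limit 1 0 d\<bar> < \<epsilon>} (unit_vec (N i) 0)"
      using NltM N0
    proof eventually_elim
      case (elim i)
      define n where "n = N i - 1"
      have NM: "N i = Suc n" "M i = Suc (n + (M i - N i))" using elim by (auto simp: n_def)
      have ti: "0 < t i" using elim beta_pos by (simp add: t_def)
      have "prob_norm (Suc (M i - N i)) {s. \<bar>s / t i - c\<bar> < \<delta>}
          \<le> prob_size 1 0 (Suc n) (Suc (n + (M i - N i))) {v. \<bar>scale 1 (M i) * v - size_limit 1 0 d\<bar> < \<epsilon>} (unit_vec (Suc n) 0)"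
      proof (rule prob_size_0_ge)
        fix s assume s: "s \<in> {s. \<bar>s / t i - c\<bar> < \<delta>}"
        then have "\<bar>1 / (s / t i) - 1 / c\<bar> < \<epsilon>" by (intro \<delta>0) (simp add: \<delta>_def)
        then show "1 / s \<in> {v. \<bar>scale 1 (M i) * v - size_limit 1 0 d\<bar> < \<epsilon>}"
          by (simp add: L[unfolded One_nat_def] scale_def t_def)
      next
        have "0 < s" if "\<bar>s / t i - c\<bar> < \<delta>" for s
        proof -
          have "\<bar>s / t i - c\<bar> < c" using that by (simp add: \<delta>_def)
          then have "0 < s / t i" by linarith
          then show ?thesis using ti by (simp add: zero_less_divide_iff)
        qed
        then show "{s. \<bar>s / t i - c\<bar> < \<delta>} \<subseteq> {0<..}" by auto
      qed measurable
      then show ?case using NM by (simp add: J_def)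
    qed
    show ?thesis
      by (rule tendsto_sandwich[OF ge _ lim tendsto_const]) (simp add: prob_size_le_1)
  qed
  show ?case
  proof (cases "l = 1")
    case True
    then show ?thesis using l1[OF 0(1)] by simp
  next
    case False
    then have l2: "l = 2" using l by simp
    have ge: "\<forall>\<^sub>F i in sequentially. prob_size 1 0 (N i) (M i) {v. \<bar>scale 1 (M i) * v - size_limit 1 0 d\<bar> < \<epsilon>} (unit_vec (N i) 0)
        \<le> prob_size l 0 (N i) (M i) {v. \<bar>scale l (M i) * v - size_limit l 0 d\<bar> < \<epsilon>} (unit_vec (N i) 0)"
      using N0
    proof eventually_elim
      case (elim i)
      have "prob_size 1 0 (N i) (M i) {v. \<bar>scale 1 (M i) * v - size_limit 1 0 d\<bar> < \<epsilon>} (unit_vec (N i) 0)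
          \<le> prob_size 1 0 (N i) (M i) UNIV (unit_vec (N i) 0)"
        by (rule prob_size_mono) (auto simp: vec_in_def)
      also have "\<dots> \<le> prob_size 2 0 (N i) (M i) {v. \<bar>scale l (M i) * v - size_limit l 0 d\<bar> < \<epsilon>} (unit_vec (N i) 0)"
        by (rule prob_size_residual_0[OF elim]) (use 0(1) l2 in \<open>auto simp: scale_def size_limit_def\<close>)
      finally show ?case using l2 by simp
    qed
    show ?thesis
      by (rule tendsto_sandwich[OF ge _ l1[OF 0(1)] tendsto_const]) (simp add: prob_size_le_1)
  qed
next
  case (Suc k)
  define t where "t i = sqrt (real (\<beta> * M i))" for i
  define N' where "N' i = N i - 1" for i
  define M' where "M' i = M i - 1" for i
  have Mr: "filterlim (\<lambda>i. real (M i)) at_top sequentially"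
    using filterlim_compose[OF filterlim_real_sequentially Suc.prems(3)] .
  have bM: "filterlim (\<lambda>i. real (\<beta> * M i)) at_top sequentially"
    using filterlim_tendsto_pos_mult_at_top[OF tendsto_const _ Mr, of "real \<beta>"] beta_pos by simp
  have t: "filterlim t at_top sequentially"
    unfolding t_def by (rule filterlim_compose[OF sqrt_at_top bM])
  have M1: "\<forall>\<^sub>F i in sequentially. 1 < M i" by (rule eventually_compose_filterlim[OF eventually_gt_at_top Suc.prems(3)])
  have N1: "\<forall>\<^sub>F i in sequentially. 1 < N i" by (rule eventually_compose_filterlim[OF eventually_gt_at_top Suc.prems(2)])
  have inv: "(\<lambda>i. 1 / real (M i)) \<longlonglongrightarrow> 0"
    by (rule tendsto_divide_0[OF tendsto_const filterlim_at_top_imp_at_infinity[OF Mr]])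
  have N': "filterlim N' at_top sequentially" and M': "filterlim M' at_top sequentially"
    unfolding N'_def[abs_def] M'_def[abs_def]
    using filterlim_compose[OF filterlim_minus_const_nat_at_top] Suc.prems(2,3) by auto
  have N'M: "(\<lambda>i. real (N i) / real (M i) - 1 / real (M i)) \<longlonglongrightarrow> d - 0"
    by (intro tendsto_intros Suc.prems(4) inv)
  have M'M: "(\<lambda>i. 1 - 1 / real (M i)) \<longlonglongrightarrow> 1 - 0" by (intro tendsto_intros inv)
  have "(\<lambda>i. (real (N i) / real (M i) - 1 / real (M i)) / (1 - 1 / real (M i))) \<longlonglongrightarrow> (d - 0) / (1 - 0)"
    by (intro tendsto_divide N'M M'M) simp
  moreover have "\<forall>\<^sub>F i in sequentially. (real (N i) / real (M i) - 1 / real (M i)) / (1 - 1 / real (M i)) = real (N' i) / real (M' i)"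
    using M1 N1 by eventually_elim (simp add: N'_def M'_def of_nat_diff divide_simps)
  ultimately have N'M': "(\<lambda>i. real (N' i) / real (M' i)) \<longlonglongrightarrow> d"
    by (rule tendsto_eventually_eq) simp
  define L where "L = size_limit l k d"
  have L': "size_limit l (Suc k) d = sqrt d * L"
    by (simp add: L_def size_limit_def real_sqrt_mult[symmetric])
  \<comment> \<open>The variables stand for the scaled norm of the first row, the scaled norm of the
    column, the scaled size at step \<open>k\<close> and the quotient of the scales for
    \<open>M\<close> and \<open>M - 1\<close>; their limits are 1, \<open>sqrt d\<close>,
    \<open>L\<close> and 1.\<close>
  have "isCont (\<lambda>(x, y, z, r). y * z * r / x) (1, sqrt d, L, 1 :: real)"
    unfolding split_def by (intro continuous_intros) auto
  from eps_delta4[OF this Suc.prems(1)] obtain \<delta>0 where \<delta>0: "0 < \<delta>0"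
    "\<And>x y z r. \<bar>x - 1\<bar> < \<delta>0 \<Longrightarrow> \<bar>y - sqrt d\<bar> < \<delta>0 \<Longrightarrow> \<bar>z - L\<bar> < \<delta>0 \<Longrightarrow> \<bar>r - 1\<bar> < \<delta>0 \<Longrightarrow>
      \<bar>y * z * r / x - sqrt d * L\<bar> < \<epsilon>"
    by auto
  \<comment> \<open>The bounds 1 and \<open>sqrt d\<close> keep both norms positive.\<close>
  define \<delta> where "\<delta> = min \<delta>0 (min 1 (sqrt d))"
  have \<delta>: "0 < \<delta>" using \<delta>0 d by (simp add: \<delta>_def)
  define G1 where "G1 i = {s. \<bar>s / t i - 1\<bar> < \<delta>}" for i
  define G2 where "G2 i = {s. \<bar>s / t i - sqrt d\<bar> < \<delta>}" for i
  define A where "A i = {v. \<bar>scale l (M' i) * v - L\<bar> < \<delta>}" for i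
  have "(\<lambda>i. 1 / sqrt (1 - 1 / real (M i))) \<longlonglongrightarrow> 1 / sqrt (1 - 0)"
    by (intro tendsto_intros M'M[simplified] inv) auto
  moreover have "\<forall>\<^sub>F i in sequentially. 1 / sqrt (1 - 1 / real (M i)) = sqrt (real (\<beta> * M i)) / sqrt (real (\<beta> * M' i))"
    using M1
  proof eventually_elim
    case (elim i)
    have "1 / (1 - 1 / real (M i)) = real (\<beta> * M i) / real (\<beta> * M' i)"
      using elim beta_pos by (simp add: M'_def of_nat_diff field_simps)
    then show ?case by (metis real_sqrt_divide real_sqrt_one)
  qed
  ultimately have "(\<lambda>i. sqrt (real (\<beta> * M i)) / sqrt (real (\<beta> * M' i))) \<longlonglongrightarrow> 1"
    by (rule tendsto_eventually_eq) simp
  then have "(\<lambda>i. scale l (M i) / scale l (M' i)) \<longlonglongrightarrow> 1"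
    by (cases "l = 1") (simp_all add: scale_def)
  from tendstoD[OF this \<delta>0(1)] have r: "\<forall>\<^sub>F i in sequentially. \<bar>scale l (M i) / scale l (M' i) - 1\<bar> < \<delta>0"
    by (simp add: dist_real_def)
  have "\<forall>\<^sub>F i in sequentially. 1 = real (\<beta> * M i) / (t i)\<^sup>2"
    using M1 by eventually_elim (use beta_pos in \<open>simp add: t_def\<close>)
  then have "(\<lambda>i. real (\<beta> * M i) / (t i)\<^sup>2) \<longlonglongrightarrow> 1\<^sup>2"
    by (rule tendsto_eventually_eq[OF tendsto_const]) simp
  from prob_norm_tendsto[OF t _ \<delta> this] have lim1: "(\<lambda>i. prob_norm (M i) (G1 i)) \<longlonglongrightarrow> 1"
    by (simp add: G1_def)
  have "\<forall>\<^sub>F i in sequentially. real (N i) / real (M i) - 1 / real (M i) = real (\<beta> * N' i) / (t i)\<^sup>2"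
    using M1 N1 by eventually_elim (use beta_pos in \<open>simp add: t_def N'_def of_nat_diff divide_simps\<close>)
  with N'M have "(\<lambda>i. real (\<beta> * N' i) / (t i)\<^sup>2) \<longlonglongrightarrow> (sqrt d)\<^sup>2"
    by (rule tendsto_eventually_eq) (use d in simp)
  from prob_norm_tendsto[OF t _ \<delta> this] have lim2: "(\<lambda>i. prob_norm (N' i) (G2 i)) \<longlonglongrightarrow> 1"
    using d by (simp add: G2_def)
  have lim3: "(\<lambda>i. prob_size l k (N' i) (M' i) (A i) (unit_vec (N' i) 0)) \<longlonglongrightarrow> 1"
    using Suc.IH[OF \<delta> N' M' N'M'] by (simp add: A_def L_def)
  have lim: "(\<lambda>i. prob_norm (M i) (G1 i) * (prob_norm (N' i) (G2 i) * prob_size l k (N' i) (M' i) (A i) (unit_vec (N' i) 0))) \<longlonglongrightarrow> 1 * (1 * 1)"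
    by (intro tendsto_mult lim1 lim2 lim3)
  have ge: "\<forall>\<^sub>F i in sequentially. prob_norm (M i) (G1 i) * (prob_norm (N' i) (G2 i) * prob_size l k (N' i) (M' i) (A i) (unit_vec (N' i) 0))
      \<le> prob_size l (Suc k) (N i) (M i) {v. \<bar>scale l (M i) * v - size_limit l (Suc k) d\<bar> < \<epsilon>} (unit_vec (N i) 0)"
    using M1 N1 r
  proof eventually_elim
    case (elim i)
    have NM: "N i = Suc (N' i)" "M i = Suc (M' i)" using elim by (auto simp: N'_def M'_def)
    have ti: "0 < t i" using elim beta_pos by (simp add: t_def)
    have sc: "scale l (M' i) \<noteq> 0" using elim beta_pos by (simp add: scale_def M'_def)
    have pos: "0 < s" if "0 < s / t i" for s using that ti by (simp add: zero_less_divide_iff)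
    have "prob_norm (Suc (M' i)) (G1 i) * (prob_norm (N' i) (G2 i) * prob_size l k (N' i) (M' i) (A i) (unit_vec (N' i) 0))
      \<le> prob_size l (Suc k) (Suc (N' i)) (Suc (M' i)) {v. \<bar>scale l (M i) * v - size_limit l (Suc k) d\<bar> < \<epsilon>} (unit_vec (Suc (N' i)) 0)"
    proof (rule prob_size_Suc)
      show "G1 i \<in> sets borel" "G2 i \<in> sets borel" "A i \<in> sets borel" unfolding G1_def G2_def A_def by measurable
      show "{v. \<bar>scale l (M i) * v - size_limit l (Suc k) d\<bar> < \<epsilon>} \<in> sets borel" by measurable
      have "0 < s / t i" if "s \<in> G1 i" for s
      proof -
        have "\<bar>s / t i - 1\<bar> < 1" using that by (simp add: G1_def \<delta>_def)
        then show ?thesis by linarith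
      qed
      then show "G1 i \<subseteq> {0<..}" by (meson greaterThan_iff pos subsetI)
      have "0 < s / t i" if "s \<in> G2 i" for s
      proof -
        have "\<bar>s / t i - sqrt d\<bar> < sqrt d" using that by (simp add: G2_def \<delta>_def)
        then show ?thesis by linarith
      qed
      then show "G2 i \<subseteq> {0<..}" by (meson greaterThan_iff pos subsetI)
      show "0 < N' i" using elim by (simp add: N'_def)
      fix s u v assume suv: "s \<in> G1 i" "u \<in> G2 i" "v \<in> A i"
      have "\<bar>(u / t i) * (scale l (M' i) * v) * (scale l (M i) / scale l (M' i)) / (s / t i) - sqrt d * L\<bar> < \<epsilon>"
        using suv elim by (intro \<delta>0(2)) (simp_all add: G1_def G2_def A_def \<delta>_def)
      moreover have "(u / t i) * (scale l (M' i) * v) * (scale l (M i) / scale l (M' i)) / (s / t i) = scale l (M i) * (u * v / s)"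
        using ti sc by (simp add: field_simps)
      ultimately show "u * v / s \<in> {v. \<bar>scale l (M i) * v - size_limit l (Suc k) d\<bar> < \<epsilon>}"
        by (simp only: L' mem_Collect_eq)
    qed
    then show ?case using NM by simp
  qed
  show ?case
    by (rule tendsto_sandwich[OF ge _ lim[simplified] tendsto_const]) (simp add: prob_size_le_1)
qed

end

section \<open>The halting times\<close>

text \<open>Independence makes the joint law a product, and Fubini reduces the probability to its
  value with \<open>Y\<close> frozen, which is almost surely the constant \<open>c\<close>.\<close>

lemma indep_rvs_freeze:
  assumes M: "prob_space M" and ind: "indep_rvs M N1 X N2 Y" and E: "E \<in> sets (N1 \<Otimes>\<^sub>M N2)"
    and c: "AE \<omega>' in M. measure M {\<omega> \<in> space M. (X \<omega>, Y \<omega>') \<in> E} = c"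
  shows "measure M {\<omega> \<in> space M. (X \<omega>, Y \<omega>) \<in> E} = c"
proof -
  interpret M: prob_space M by (rule M)
  have X: "X \<in> measurable M N1" and Y: "Y \<in> measurable M N2"
    and I: "M.indep_set (sets (vimage_algebra (space M) X N1)) (sets (vimage_algebra (space M) Y N2))"
    using ind by (auto simp: indep_rvs_def)
  define P where "P = distr M N1 X"
  define Q where "Q = distr M N2 Y"
  interpret P: prob_space P unfolding P_def by (rule M.prob_space_distr[OF X])
  interpret Q: prob_space Q unfolding Q_def by (rule M.prob_space_distr[OF Y])
  interpret PQ: pair_prob_space P Q ..
  have XY: "(\<lambda>\<omega>. (X \<omega>, Y \<omega>)) \<in> measurable M (N1 \<Otimes>\<^sub>M N2)" using X Y by measurable
  have sPQ: "sets (P \<Otimes>\<^sub>M Q) = sets (N1 \<Otimes>\<^sub>M N2)"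
    by (intro sets_pair_measure_cong) (simp_all add: P_def Q_def)
  have joint: "P \<Otimes>\<^sub>M Q = distr M (N1 \<Otimes>\<^sub>M N2) (\<lambda>\<omega>. (X \<omega>, Y \<omega>))"
  proof (rule pair_measure_eqI)
    show "sigma_finite_measure P" "sigma_finite_measure Q" by unfold_locales
    show "sets (P \<Otimes>\<^sub>M Q) = sets (distr M (N1 \<Otimes>\<^sub>M N2) (\<lambda>\<omega>. (X \<omega>, Y \<omega>)))" using sPQ by simp
    fix A B assume AB: "A \<in> sets P" "B \<in> sets Q"
    then have AB': "A \<in> sets N1" "B \<in> sets N2" by (simp_all add: P_def Q_def)
    have "(\<lambda>\<omega>. (X \<omega>, Y \<omega>)) -` (A \<times> B) \<inter> space M = (X -` A \<inter> space M) \<inter> (Y -` B \<inter> space M)" by auto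
    moreover have "M.prob ((X -` A \<inter> space M) \<inter> (Y -` B \<inter> space M)) = M.prob (X -` A \<inter> space M) * M.prob (Y -` B \<inter> space M)"
      by (rule M.indep_setD[OF I]) (intro in_vimage_algebra X Y AB')+
    ultimately show "emeasure P A * emeasure Q B = emeasure (distr M (N1 \<Otimes>\<^sub>M N2) (\<lambda>\<omega>. (X \<omega>, Y \<omega>))) (A \<times> B)"
      using AB' X Y XY by (simp add: P_def Q_def emeasure_distr M.emeasure_eq_measure ennreal_mult)
  qed
  have "emeasure M {\<omega> \<in> space M. (X \<omega>, Y \<omega>) \<in> E} = emeasure (P \<Otimes>\<^sub>M Q) E"
    unfolding joint using emeasure_distr[OF XY E] by (simp add: vimage_def Int_def conj_commute)
  also have "\<dots> = (\<integral>\<^sup>+y. emeasure P ((\<lambda>x. (x, y)) -` E) \<partial>Q)"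
    by (rule PQ.emeasure_pair_measure_alt2) (simp add: sPQ E)
  also have "\<dots> = (\<integral>\<^sup>+\<omega>'. emeasure P ((\<lambda>x. (x, Y \<omega>')) -` E) \<partial>M)"
  proof -
    have "(\<lambda>y. emeasure P ((\<lambda>x. (x, y)) -` E)) \<in> borel_measurable Q"
      by (rule PQ.measurable_emeasure_Pair2) (simp add: sPQ E)
    then show ?thesis unfolding Q_def by (intro nn_integral_distr[OF Y]) simp
  qed
  also have "\<dots> = (\<integral>\<^sup>+\<omega>'. ennreal c \<partial>M)"
  proof (rule nn_integral_cong_AE)
    show "AE \<omega>' in M. emeasure P ((\<lambda>x. (x, Y \<omega>')) -` E) = ennreal c"
      using c
    proof eventually_elim
      case (elim \<omega>')
      have "(\<lambda>x. (x, Y \<omega>')) -` E \<in> sets N1" using sets_Pair2[OF E] .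
      then have "emeasure P ((\<lambda>x. (x, Y \<omega>')) -` E) = emeasure M (X -` ((\<lambda>x. (x, Y \<omega>')) -` E) \<inter> space M)"
        unfolding P_def by (rule emeasure_distr[OF X])
      also have "X -` ((\<lambda>x. (x, Y \<omega>')) -` E) \<inter> space M = {\<omega> \<in> space M. (X \<omega>, Y \<omega>') \<in> E}" by auto
      finally show ?case using elim by (simp add: M.emeasure_eq_measure)
    qed
  qed
  also have "\<dots> = ennreal c" by (simp add: M.emeasure_space_1)
  finally have *: "ennreal (M.prob {\<omega> \<in> space M. (X \<omega>, Y \<omega>) \<in> E}) = ennreal c"
    by (simp add: M.emeasure_eq_measure)
  \<comment> \<open>\<open>ennreal\<close> sends negative numbers to 0, so the sign of
    \<open>c\<close> is needed to return to real numbers.\<close>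
  have "0 \<le> c"
  proof (rule ccontr)
    assume neg: "\<not> 0 \<le> c"
    have "AE \<omega>' in M. False"
      using c
    proof (rule eventually_mono)
      fix \<omega>' assume "M.prob {\<omega> \<in> space M. (X \<omega>, Y \<omega>') \<in> E} = c"
      then show False using neg measure_nonneg[of M] by metis
    qed
    then show False by (simp add: M.AE_False)
  qed
  with * show ?thesis by simp
qed

lemma halting_time_eq:
  "halting_time l K \<epsilon> W b = (if positive_definite W then LEAST k. cg_size l K W b k < \<epsilon> else 0)"
  by (simp add: halting_time_def cg_size_def)

section \<open>From the sizes to the halting times\<close>

context wishart_beta
begin

text \<open>Transports the entrywise hypothesis on \<open>X\<close> to the measure on coordinate
  families; joint independence turns the marginal laws into a product.\<close>

lemma gaussian_matrix_law:
  assumes M: "prob_space M" and X: "std_gaussian_matrix M \<beta> n m X" and nm: "0 < n" "0 < m"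
  shows "\<And>\<omega>. \<omega> \<in> space M \<Longrightarrow> X \<omega> \<in> carrier_mat n m \<and> mat_in K (X \<omega>)"
    and "(\<lambda>\<omega>. restrict (parts (X \<omega>)) (gidx \<beta> n m)) \<in> measurable M (gaussian (gidx \<beta> n m))"
    and "distr M (gaussian (gidx \<beta> n m)) (\<lambda>\<omega>. restrict (parts (X \<omega>)) (gidx \<beta> n m)) = gaussian (gidx \<beta> n m)"
proof -
  interpret M: prob_space M by (rule M)
  define entry where "entry = (\<lambda>(p::nat, i, j) \<omega>. if p = 0 then Re (X \<omega> $$ (i, j)) else Im (X \<omega> $$ (i, j)))"
  have X': "\<And>\<omega>. \<omega> \<in> space M \<Longrightarrow> X \<omega> \<in> carrier_mat n m \<and> elements_mat (X \<omega>) \<subseteq> K"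
    "M.indep_vars (\<lambda>_. borel) entry (gidx \<beta> n m)"
    "\<And>q. q \<in> gidx \<beta> n m \<Longrightarrow> distributed M lborel (entry q) std_normal_density"
    using X unfolding std_gaussian_matrix_def Let_def entry_def[symmetric] gidx_def[symmetric] by auto
  show "X \<omega> \<in> carrier_mat n m \<and> mat_in K (X \<omega>)" if "\<omega> \<in> space M" for \<omega>
    using X'(1)[OF that] by (auto simp: mat_in_def intro: elements_matI)
  have em: "entry q \<in> borel_measurable M" if "q \<in> gidx \<beta> n m" for q
    using distributed_measurable[OF X'(3)[OF that]] by simp
  have law: "distr M borel (entry q) = std_normal" if "q \<in> gidx \<beta> n m" for q
    using distributed_distr_eq_density[OF X'(3)[OF that]] distr_cong[of M M borel lborel "entry q" "entry q"] by simp
  have ne: "gidx \<beta> n m \<noteq> {}" using gidx_0[OF nm] by blast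
  have eq: "parts (X \<omega>) q = entry q \<omega>" for \<omega> q
    by (cases q) (simp add: parts_def entry_def)
  have "(\<lambda>\<omega>. \<lambda>q\<in>gidx \<beta> n m. entry q \<omega>) \<in> measurable M (PiM (gidx \<beta> n m) (\<lambda>_. borel))"
    by (rule measurable_restrict) (rule em)
  then show "(\<lambda>\<omega>. restrict (parts (X \<omega>)) (gidx \<beta> n m)) \<in> measurable M (gaussian (gidx \<beta> n m))"
    unfolding measurable_cong_sets[OF refl sets_gaussian] restrict_def eq .
  have "distr M (PiM (gidx \<beta> n m) (\<lambda>_. borel)) (\<lambda>\<omega>. \<lambda>q\<in>gidx \<beta> n m. entry q \<omega>) = PiM (gidx \<beta> n m) (\<lambda>q. distr M borel (entry q))"
    using M.indep_vars_iff_distr_eq_PiM'[OF ne em] X'(2) by simp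
  also have "\<dots> = gaussian (gidx \<beta> n m)"
    unfolding gaussian_def by (intro PiM_cong refl law)
  finally have "distr M (PiM (gidx \<beta> n m) (\<lambda>_. borel)) (\<lambda>\<omega>. \<lambda>q\<in>gidx \<beta> n m. entry q \<omega>) = gaussian (gidx \<beta> n m)" .
  moreover have "distr M (gaussian (gidx \<beta> n m)) (\<lambda>\<omega>. \<lambda>q\<in>gidx \<beta> n m. entry q \<omega>)
      = distr M (PiM (gidx \<beta> n m) (\<lambda>_. borel)) (\<lambda>\<omega>. \<lambda>q\<in>gidx \<beta> n m. entry q \<omega>)"
    by (rule distr_cong) (simp_all add: sets_gaussian)
  ultimately show "distr M (gaussian (gidx \<beta> n m)) (\<lambda>\<omega>. restrict (parts (X \<omega>)) (gidx \<beta> n m)) = gaussian (gidx \<beta> n m)"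
    unfolding restrict_def eq by simp
qed

lemma wishart_props:
  assumes X: "X \<in> carrier_mat n m" "mat_in K X" and m: "0 < m"
  shows "wishart \<beta> m X \<in> carrier_mat n n" "mat_in K (wishart \<beta> m X)"
    and "positive_definite (wishart \<beta> m X) \<longleftrightarrow> Determinant.det (wishart \<beta> m X) \<noteq> 0"
    and "b \<in> carrier_vec n \<Longrightarrow> vec_in K b \<Longrightarrow>
      size_event l K k A (wishart \<beta> m X) b \<longleftrightarrow> size_event l K k {v. scale l m * v \<in> A} (gram X) b"
proof -
  define c where "c = 1 / real (\<beta> * m)"
  have c: "0 < c" using m beta_pos by (simp add: c_def)
  have W: "wishart \<beta> m X = of_real c \<cdot>\<^sub>m gram X" by (simp add: wishart_def gram_def c_def)
  note G = gram_carrier[OF X(1)]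
  have GK: "mat_in K (gram X)"
    unfolding gram_def by (intro mat_in_mult[OF X(1) adjoint_carrier[OF X(1)]] X mat_in_adjoint)
  show "wishart \<beta> m X \<in> carrier_mat n n" unfolding W using G by simp
  show "mat_in K (wishart \<beta> m X)" unfolding W using G GK by (auto simp: mat_in_def)
  have det: "Determinant.det (wishart \<beta> m X) \<noteq> 0 \<longleftrightarrow> Determinant.det (gram X) \<noteq> 0"
    unfolding W using c by simp
  have z: "0\<^sub>v n \<in> carrier_vec n" "vec_in K (0\<^sub>v n)" by (auto simp: vec_in_def)
  have up: "positive_definite (wishart \<beta> m X)" if "positive_definite (gram X)"
    unfolding W using cg_size_scale(1)[OF that G GK z c] .
  have pd: "positive_definite (wishart \<beta> m X) \<longleftrightarrow> positive_definite (gram X)"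
    using up det_ne_0_if_positive_definite[OF _ \<open>wishart \<beta> m X \<in> carrier_mat n n\<close>] det
      positive_definite_gram_iff_det[OF X(1)] by blast
  show "positive_definite (wishart \<beta> m X) \<longleftrightarrow> Determinant.det (wishart \<beta> m X) \<noteq> 0"
    unfolding pd det by (rule positive_definite_gram_iff_det[OF X(1)])
  assume b: "b \<in> carrier_vec n" "vec_in K b"
  have sc: "(if l = 1 then 1 / sqrt c else 1) = scale l m"
    by (simp add: scale_def c_def real_sqrt_divide)
  have "cg_size l K (wishart \<beta> m X) b k = scale l m * cg_size l K (gram X) b k" if "positive_definite (gram X)"
    unfolding W cg_size_scale(2)[OF that G GK b c] sc ..
  then show "size_event l K k A (wishart \<beta> m X) b \<longleftrightarrow> size_event l K k {v. scale l m * v \<in> A} (gram X) b"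
    unfolding size_event_def pd by auto
qed

text \<open>The hypotheses of the theorem for a single \<open>n\<close>, so that limit arguments can
  require them eventually; size 0 is excluded.\<close>

definition wishart_system ::
  "'a measure \<Rightarrow> nat \<Rightarrow> nat \<Rightarrow> ('a \<Rightarrow> complex Matrix.mat) \<Rightarrow> ('a \<Rightarrow> complex Matrix.mat) \<Rightarrow> ('a \<Rightarrow> complex Matrix.vec) \<Rightarrow> bool" where
  "wishart_system M n m X W b \<longleftrightarrow> 0 < n \<and> 0 < m \<and> prob_space M \<and> std_gaussian_matrix M \<beta> n m X \<and>
     (\<forall>\<omega>\<in>space M. W \<omega> = wishart \<beta> m (X \<omega>)) \<and> (\<forall>\<omega>\<in>space M. b \<omega> \<in> carrier_vec n \<and> vec_in K (b \<omega>)) \<and>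
     (AE \<omega> in M. norm2 (b \<omega>) = 1) \<and> indep_mat_vec M n W b"

context
  fixes M :: "'a measure" and n m :: nat and X W :: "'a \<Rightarrow> complex Matrix.mat" and b :: "'a \<Rightarrow> complex Matrix.vec"
  assumes sys: "wishart_system M n m X W b"
begin

lemma sys_facts:
  shows sys_pos: "0 < n" "0 < m" and sys_prob: "prob_space M" and sys_gauss: "std_gaussian_matrix M \<beta> n m X"
    and sys_eq: "\<And>\<omega>. \<omega> \<in> space M \<Longrightarrow> W \<omega> = wishart \<beta> m (X \<omega>)"
    and sys_b: "\<And>\<omega>. \<omega> \<in> space M \<Longrightarrow> b \<omega> \<in> carrier_vec n" "\<And>\<omega>. \<omega> \<in> space M \<Longrightarrow> vec_in K (b \<omega>)"
    and sys_norm: "AE \<omega> in M. norm2 (b \<omega>) = 1" and sys_indep: "indep_mat_vec M n W b"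
  using sys by (auto simp: wishart_system_def)

lemma sys_X: "\<omega> \<in> space M \<Longrightarrow> X \<omega> \<in> carrier_mat n m" "\<omega> \<in> space M \<Longrightarrow> mat_in K (X \<omega>)"
  using gaussian_matrix_law(1)[OF sys_prob sys_gauss sys_pos] by auto

lemma sys_W:
  assumes "\<omega> \<in> space M"
  shows "W \<omega> \<in> carrier_mat n n" "mat_in K (W \<omega>)" "positive_definite (W \<omega>) \<longleftrightarrow> Determinant.det (W \<omega>) \<noteq> 0"
    and "v \<in> carrier_vec n \<Longrightarrow> vec_in K v \<Longrightarrow>
      size_event l K k A (W \<omega>) v \<longleftrightarrow> size_event l K k {v. scale l m * v \<in> A} (gram (X \<omega>)) v"
  using wishart_props[OF sys_X[OF assms] sys_pos(2)] sys_eq[OF assms] by simp_all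

lemma sys_families: "mat_family M n n W" "vec_family M n b"
proof -
  let ?N1 = "PiM ({..<n} \<times> {..<n}) (\<lambda>_. borel :: complex measure)" and ?N2 = "PiM {..<n} (\<lambda>_. borel :: complex measure)"
  have 1: "(\<lambda>\<omega>. restrict (\<lambda>ij. W \<omega> $$ ij) ({..<n} \<times> {..<n})) \<in> measurable M ?N1"
    and 2: "(\<lambda>\<omega>. restrict (\<lambda>i. b \<omega> $ i) {..<n}) \<in> measurable M ?N2"
    using sys_indep by (auto simp: indep_mat_vec_def indep_rvs_def)
  have "(\<lambda>\<omega>. W \<omega> $$ (i, j)) \<in> borel_measurable M" if "i < n" "j < n" for i j
    using measurable_compose[OF 1 measurable_component_singleton[of "(i, j)"]] that by simp
  then show "mat_family M n n W" using sys_W(1) by (simp add: mat_family_def)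
  have "(\<lambda>\<omega>. b \<omega> $ i) \<in> borel_measurable M" if "i < n" for i
    using measurable_compose[OF 2 measurable_component_singleton[of i]] that by simp
  then show "vec_family M n b" using sys_b by (simp add: vec_family_def)
qed

lemma sets_sys_event:
  assumes "A \<in> sets borel"
  shows "{\<omega> \<in> space M. size_event l K k A (W \<omega>) (b \<omega>)} \<in> sets M"
  by (rule sets_size_event[OF sys_families(1) sys_W(2,3) sys_families(2) sys_b(2) assms])

text \<open>Independence is given for \<open>W\<close> and \<open>b\<close>, so the event is first
  written in terms of the entries of these two. For a frozen unit vector its probability is that of
  the Gaussian model and does not depend on the vector.\<close>

lemma prob_sys_event:
  assumes A: "A \<in> sets borel"
  shows "measure M {\<omega> \<in> space M. size_event l K k A (W \<omega>) (b \<omega>)} = prob_size l k n m {v. scale l m * v \<in> A} (unit_vec n 0)"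
proof -
  let ?N1 = "PiM ({..<n} \<times> {..<n}) (\<lambda>_. borel :: complex measure)" and ?N2 = "PiM {..<n} (\<lambda>_. borel :: complex measure)"
  let ?w = "\<lambda>\<omega>. restrict (\<lambda>ij. W \<omega> $$ ij) ({..<n} \<times> {..<n})" and ?v = "\<lambda>\<omega>. restrict (\<lambda>i. b \<omega> $ i) {..<n}"
  let ?A = "{v. scale l m * v \<in> A}"
  have A': "?A \<in> sets borel"
    using measurable_sets[of "\<lambda>v. scale l m * v" borel borel A] A by (simp add: vimage_def)
  \<comment> \<open>\<open>formula_event\<close> is used because \<open>E\<close> must be measurable
    on all pairs, also where the entries form no Gram matrix.\<close>
  define E where "E = {z \<in> space (?N1 \<Otimes>\<^sub>M ?N2). formula_event l k A (Matrix.mat n n (fst z)) (Matrix.vec n (snd z))}"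
  have E: "E \<in> sets (?N1 \<Otimes>\<^sub>M ?N2)"
    unfolding E_def
  proof (rule sets_formula_event[OF _ _ A])
    show "mat_family (?N1 \<Otimes>\<^sub>M ?N2) n n (\<lambda>z. Matrix.mat n n (fst z))"
    proof (rule mat_familyI[where F = "\<lambda>i j z. fst z (i, j)"])
      show "(\<lambda>z. fst z (i, j)) \<in> borel_measurable (?N1 \<Otimes>\<^sub>M ?N2)" if "i < n" "j < n" for i j
        using measurable_compose[OF measurable_fst measurable_component_singleton[of "(i, j)"]] that by simp
    qed auto
    show "vec_family (?N1 \<Otimes>\<^sub>M ?N2) n (\<lambda>z. Matrix.vec n (snd z))"
    proof (rule vec_familyI[where F = "\<lambda>i z. snd z i"])
      show "(\<lambda>z. snd z i) \<in> borel_measurable (?N1 \<Otimes>\<^sub>M ?N2)" if "i < n" for i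
        using measurable_compose[OF measurable_snd measurable_component_singleton[of i]] that by simp
    qed auto
  qed
  have mw: "Matrix.mat n n (?w \<omega>) = W \<omega>" if "\<omega> \<in> space M" for \<omega>
    using sys_W(1)[OF that] by (intro eq_matI) auto
  have vv: "Matrix.vec n (?v \<omega>) = b \<omega>" if "\<omega> \<in> space M" for \<omega>
    using sys_b(1)[OF that] by (intro eq_vecI) auto
  have inE: "(?w \<omega>, ?v \<omega>') \<in> E \<longleftrightarrow> size_event l K k A (W \<omega>) (b \<omega>')" if "\<omega> \<in> space M" "\<omega>' \<in> space M" for \<omega> \<omega>'
  proof -
    have "(?w \<omega>, ?v \<omega>') \<in> space (?N1 \<Otimes>\<^sub>M ?N2)" by (simp add: space_pair_measure space_PiM)
    then have "(?w \<omega>, ?v \<omega>') \<in> E \<longleftrightarrow> formula_event l k A (W \<omega>) (b \<omega>')"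
      unfolding E_def using mw[OF that(1)] vv[OF that(2)] by simp
    then show ?thesis
      using size_event_iff_formula_event[OF sys_W(1,2,3)[OF that(1)] sys_b(1,2)[OF that(2)]] by simp
  qed
  have "measure M {\<omega> \<in> space M. (?w \<omega>, ?v \<omega>) \<in> E} = prob_size l k n m ?A (unit_vec n 0)"
  proof (rule indep_rvs_freeze[OF sys_prob sys_indep[unfolded indep_mat_vec_def] E])
    show "AE \<omega>' in M. measure M {\<omega> \<in> space M. (?w \<omega>, ?v \<omega>') \<in> E} = prob_size l k n m ?A (unit_vec n 0)"
      using sys_norm AE_space
    proof eventually_elim
      case (elim \<omega>')
      note bb = sys_b(1,2)[OF elim(2)]
      let ?G = "gaussian (gidx \<beta> n m)"
      have "{\<omega> \<in> space M. (?w \<omega>, ?v \<omega>') \<in> E} = {\<omega> \<in> space M. size_event l K k ?A (gram (X \<omega>)) (b \<omega>')}"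
        using inE[OF _ elim(2)] sys_W(4)[OF _ bb] by blast
      also have "measure M \<dots> = measure ?G {f \<in> space ?G. size_event l K k ?A (gram (rmat \<beta> n m f)) (b \<omega>')}"
      proof (rule measure_distr_event(1)[OF gaussian_matrix_law(2,3)[OF sys_prob sys_gauss sys_pos] sets_rmat_event[OF bb A'], symmetric])
        fix \<omega> assume \<omega>: "\<omega> \<in> space M"
        show "size_event l K k ?A (gram (X \<omega>)) (b \<omega>') \<longleftrightarrow>
            size_event l K k ?A (gram (rmat \<beta> n m (restrict (parts (X \<omega>)) (gidx \<beta> n m)))) (b \<omega>')"
          unfolding rmat_restrict_parts[OF sys_X[OF \<omega>]] ..
      qed
      also have "\<dots> = prob_size l k n m ?A (b \<omega>')" by (simp add: prob_size_def)
      also have "\<dots> = prob_size l k n m ?A (unit_vec n 0)"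
        by (rule prob_size_unit_vec[OF bb elim(1) sys_pos(1) A'])
      finally show ?case .
    qed
  qed
  moreover have "{\<omega> \<in> space M. (?w \<omega>, ?v \<omega>) \<in> E} = {\<omega> \<in> space M. size_event l K k A (W \<omega>) (b \<omega>)}"
    using inE by blast
  ultimately show ?thesis by simp
qed

lemma measurable_halting_time:
  "(\<lambda>\<omega>. halting_time l K \<epsilon> (W \<omega>) (b \<omega>)) \<in> measurable M (count_space UNIV)"
proof -
  define P where "P k \<omega> \<longleftrightarrow> size_event l K k {..<\<epsilon>} (W \<omega>) (b \<omega>)" for k \<omega>
  \<comment> \<open>With \<open>UNIV\<close> as target only definiteness is left, which separates
    the default value 0 from the minimum.\<close>
  define D where "D \<omega> \<longleftrightarrow> size_event l K 0 UNIV (W \<omega>) (b \<omega>)" for \<omega>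
  have P: "Measurable.pred M (P k)" for k
    unfolding P_def pred_def by (rule sets_sys_event) simp
  have D: "Measurable.pred M D"
    unfolding D_def pred_def by (rule sets_sys_event) simp
  have "halting_time l K \<epsilon> (W \<omega>) (b \<omega>) = (if D \<omega> then LEAST k. P k \<omega> else 0)" for \<omega>
    by (simp add: halting_time_eq P_def D_def size_event_def)
  then show ?thesis using P D by simp
qed

lemma sets_halting_time: "{\<omega> \<in> space M. Q (halting_time l K \<epsilon> (W \<omega>) (b \<omega>))} \<in> sets M"
  using measurable_sets[OF measurable_halting_time, of "{t. Q t}"] by (simp add: vimage_def Int_def conj_commute)

text \<open>Union bound over the first steps.\<close>

lemma prob_halting_time_ge:
  assumes A: "\<And>k. k \<in> J \<Longrightarrow> A k \<in> sets borel" and J: "finite J" "J \<noteq> {}"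
    and imp: "\<And>s. (\<And>k. k \<in> J \<Longrightarrow> s k \<in> A k) \<Longrightarrow> Q (LEAST k. s k < \<epsilon>)"
  shows "1 - (\<Sum>k\<in>J. 1 - prob_size l k n m {v. scale l m * v \<in> A k} (unit_vec n 0))
    \<le> measure M {\<omega> \<in> space M. Q (halting_time l K \<epsilon> (W \<omega>) (b \<omega>))}"
proof -
  interpret M: prob_space M by (rule sys_prob)
  define S where "S k = {\<omega> \<in> space M. size_event l K k (A k) (W \<omega>) (b \<omega>)}" for k
  have S: "S k \<in> sets M" if "k \<in> J" for k unfolding S_def by (rule sets_sys_event[OF A[OF that]])
  let ?H = "{\<omega> \<in> space M. Q (halting_time l K \<epsilon> (W \<omega>) (b \<omega>))}"
  have "space M - ?H \<subseteq> (\<Union>k\<in>J. space M - S k)"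
  proof
    fix \<omega> assume \<omega>: "\<omega> \<in> space M - ?H"
    show "\<omega> \<in> (\<Union>k\<in>J. space M - S k)"
    proof (rule ccontr)
      assume "\<omega> \<notin> (\<Union>k\<in>J. space M - S k)"
      then have s: "size_event l K k (A k) (W \<omega>) (b \<omega>)" if "k \<in> J" for k
        using \<omega> that by (auto simp: S_def)
      \<comment> \<open>A nonempty \<open>J\<close> guarantees definiteness, so the halting time is
        the minimum and not its default value.\<close>
      then have "positive_definite (W \<omega>)" using J(2) by (auto simp: size_event_def)
      moreover have "Q (LEAST k. cg_size l K (W \<omega>) (b \<omega>) k < \<epsilon>)"
        using s by (intro imp) (simp add: size_event_def)
      ultimately show False using \<omega> by (simp add: halting_time_eq)
    qed
  qed
  then have "M.prob (space M - ?H) \<le> M.prob (\<Union>k\<in>J. space M - S k)"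
    by (rule M.finite_measure_mono) (intro sets.finite_UN J(1) sets.Diff sets.top S)
  also have "\<dots> \<le> (\<Sum>k\<in>J. M.prob (space M - S k))"
    using S J(1) by (intro M.finite_measure_subadditive_finite) auto
  also have "\<dots> = (\<Sum>k\<in>J. 1 - prob_size l k n m {v. scale l m * v \<in> A k} (unit_vec n 0))"
  proof (rule sum.cong[OF refl])
    fix k assume k: "k \<in> J"
    show "M.prob (space M - S k) = 1 - prob_size l k n m {v. scale l m * v \<in> A k} (unit_vec n 0)"
      using M.prob_compl[OF S[OF k]] prob_sys_event[OF A[OF k], of l k] by (simp add: S_def)
  qed
  finally show ?thesis using M.prob_compl[OF sets_halting_time] by simp
qed

end

text \<open>\<open>J\<close> holds the steps whose comparison with \<epsilon> decides
  \<open>Q\<close>. Their limits differ from \<epsilon>, so on events of probability tending to 1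
  the random sizes compare with \<epsilon> as the limits do. Both parts of the theorem are
  instances.\<close>

lemma halting_time_tendsto:
  fixes M :: "nat \<Rightarrow> 'a measure"
  assumes d: "0 < d" "d < 1" and l: "l \<in> {1, 2}"
    and sys: "\<forall>\<^sub>F n in sequentially. wishart_system (M n) n (m n) (X n) (W n) (b n)"
    and m: "filterlim m at_top sequentially" "(\<lambda>n. real n / real (m n)) \<longlonglongrightarrow> d"
    and J: "finite J" "J \<noteq> {}" "\<And>k. k \<in> J \<Longrightarrow> size_limit l k d \<noteq> \<epsilon>"
    and imp: "\<And>s. (\<And>k. k \<in> J \<Longrightarrow> s k < \<epsilon> \<longleftrightarrow> size_limit l k d < \<epsilon>) \<Longrightarrow> Q (LEAST k. s k < \<epsilon>)"
  shows "(\<lambda>n. measure (M n) {\<omega> \<in> space (M n). Q (halting_time l K \<epsilon> (W n \<omega>) (b n \<omega>))}) \<longlonglongrightarrow> 1"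
proof -
  \<comment> \<open>The full distance between the limit and \<epsilon>: any size strictly closer to
    the limit lies on the same side.\<close>
  define \<delta> where "\<delta> k = \<bar>size_limit l k d - \<epsilon>\<bar>" for k
  define A where "A k = {v. \<bar>v - size_limit l k d\<bar> < \<delta> k}" for k
  have A: "A k \<in> sets borel" for k unfolding A_def by measurable
  have N: "filterlim (\<lambda>n. n) at_top sequentially" by (rule filterlim_ident)
  have "(\<lambda>n. 1 - (\<Sum>k\<in>J. 1 - prob_size l k n (m n) {v. scale l (m n) * v \<in> A k} (unit_vec n 0))) \<longlonglongrightarrow> 1 - (\<Sum>k\<in>J. 1 - 1)"
  proof (intro tendsto_intros)
    fix k assume "k \<in> J"
    then have "0 < \<delta> k" using J(3) by (simp add: \<delta>_def)
    from prob_size_tendsto[OF d l this N m]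
    show "(\<lambda>n. prob_size l k n (m n) {v. scale l (m n) * v \<in> A k} (unit_vec n 0)) \<longlonglongrightarrow> 1"
      by (simp add: A_def)
  qed
  then have lim: "(\<lambda>n. 1 - (\<Sum>k\<in>J. 1 - prob_size l k n (m n) {v. scale l (m n) * v \<in> A k} (unit_vec n 0))) \<longlonglongrightarrow> 1" by simp
  have close: "v < \<epsilon> \<longleftrightarrow> size_limit l k d < \<epsilon>" if "v \<in> A k" for k v
    using that unfolding A_def \<delta>_def by (auto simp: abs_if split: if_splits)
  show ?thesis
  proof (rule tendsto_sandwich[OF _ _ lim tendsto_const])
    show "\<forall>\<^sub>F n in sequentially. 1 - (\<Sum>k\<in>J. 1 - prob_size l k n (m n) {v. scale l (m n) * v \<in> A k} (unit_vec n 0))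
        \<le> measure (M n) {\<omega> \<in> space (M n). Q (halting_time l K \<epsilon> (W n \<omega>) (b n \<omega>))}"
      using sys by eventually_elim (rule prob_halting_time_ge[OF _ A J(1,2)], assumption, rule imp, rule close)
    show "\<forall>\<^sub>F n in sequentially. measure (M n) {\<omega> \<in> space (M n). Q (halting_time l K \<epsilon> (W n \<omega>) (b n \<omega>))} \<le> 1"
      using sys by eventually_elim (rule prob_space.prob_le_1, simp add: wishart_system_def)
  qed
qed

end

section \<open>Deterministic limits and the conclusion\<close>

lemma wishart_cols_limits:
  assumes d: "0 < d" "d < 1"
  shows "filterlim (wishart_cols d) at_top sequentially"
    and "(\<lambda>n. real n / real (wishart_cols d n)) \<longlonglongrightarrow> d"
    and "n \<le> wishart_cols d n"
proof -
  have r: "real (wishart_cols d n) = of_int \<lfloor>real n / d\<rfloor>" for n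
    using d by (simp add: wishart_cols_def)
  show le: "n \<le> wishart_cols d n" for n
  proof -
    have "real n \<le> real n / d" using d mult_right_mono[of d 1 "real n"] by (simp add: field_simps)
    then show ?thesis by (simp add: wishart_cols_def le_nat_iff le_floor_iff)
  qed
  show "filterlim (wishart_cols d) at_top sequentially"
    by (rule filterlim_at_top_mono[OF filterlim_ident]) (simp add: le)
  have "(\<lambda>n. real (wishart_cols d n) / real n) \<longlonglongrightarrow> 1 / d"
  proof (rule tendsto_sandwich)
    show "\<forall>\<^sub>F n in sequentially. 1 / d - 1 / real n \<le> real (wishart_cols d n) / real n"
      using eventually_gt_at_top[of 0]
    proof eventually_elim
      case (elim n)
      have "real n / d - 1 \<le> real (wishart_cols d n)" unfolding r by linarith
      then have "(real n / d - 1) / real n \<le> real (wishart_cols d n) / real n" by (intro divide_right_mono) auto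
      then show ?case using elim by (simp add: diff_divide_distrib)
    qed
    show "\<forall>\<^sub>F n in sequentially. real (wishart_cols d n) / real n \<le> 1 / d"
      using eventually_gt_at_top[of 0]
    proof eventually_elim
      case (elim n)
      have "real (wishart_cols d n) \<le> real n / d" unfolding r by linarith
      then have "real (wishart_cols d n) / real n \<le> (real n / d) / real n" by (intro divide_right_mono) auto
      then show ?case using elim by simp
    qed
    have "(\<lambda>n. 1 / d - 1 / real n) \<longlonglongrightarrow> 1 / d - 0"
      by (intro tendsto_intros lim_1_over_n)
    then show "(\<lambda>n. 1 / d - 1 / real n) \<longlonglongrightarrow> 1 / d" by simp
  qed simp
  then have "(\<lambda>n. inverse (real (wishart_cols d n) / real n)) \<longlonglongrightarrow> inverse (1 / d)"
    using d by (intro tendsto_inverse) auto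
  then show "(\<lambda>n. real n / real (wishart_cols d n)) \<longlonglongrightarrow> d" by (simp add: field_simps)
qed

text \<open>\<open>x\<close> is the real solution of
  \<open>d powr x / g = \<epsilon>\<^sup>2\<close>, the point at which the interpolated limits cross
  \<epsilon>. Division by the negative number \<open>ln d\<close> reverses the inequality.\<close>

lemma limit_error_compare:
  assumes d: "0 < d" "d < 1" and l: "l \<in> {1, 2}" and \<epsilon>: "0 < \<epsilon>"
  obtains x where "limit_time l \<epsilon> d = \<lceil>x\<rceil>" "\<And>k. limit_error l k d < \<epsilon> \<longleftrightarrow> x < real k"
    "\<And>k. limit_error l k d = \<epsilon> \<longleftrightarrow> x = real k"
proof -
  define g where "g = (if l = 1 then 1 - d else 1)"
  have g: "0 < g" using d by (simp add: g_def)
  define x where "x = (2 * ln \<epsilon> + ln g) / ln d"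
  have ld: "ln d < 0" using d by simp
  have e: "limit_error l k d = sqrt (d ^ k / g)" for k by (simp add: limit_error_eq[OF d l] g_def)
  have pos: "0 < d ^ k / g" for k using d g by simp
  have sq: "sqrt (\<epsilon>\<^sup>2) = \<epsilon>" using \<epsilon> by simp
  have lnk: "ln (d ^ k / g) = real k * ln d - ln g" for k using d g by (simp add: ln_div ln_realpow)
  have lne: "ln (\<epsilon>\<^sup>2) = 2 * ln \<epsilon>" using \<epsilon> by (simp add: ln_realpow)
  have "limit_error l k d < \<epsilon> \<longleftrightarrow> x < real k" for k
  proof -
    have "limit_error l k d < \<epsilon> \<longleftrightarrow> d ^ k / g < \<epsilon>\<^sup>2" unfolding e by (metis real_sqrt_less_iff sq)
    also have "\<dots> \<longleftrightarrow> ln (d ^ k / g) < ln (\<epsilon>\<^sup>2)" using pos[of k] \<epsilon> by simp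
    also have "\<dots> \<longleftrightarrow> real k * ln d < 2 * ln \<epsilon> + ln g" unfolding lnk lne by linarith
    also have "\<dots> \<longleftrightarrow> x < real k" unfolding x_def using ld by (simp add: neg_divide_less_eq)
    finally show ?thesis .
  qed
  moreover have "limit_error l k d = \<epsilon> \<longleftrightarrow> x = real k" for k
  proof -
    have "limit_error l k d = \<epsilon> \<longleftrightarrow> d ^ k / g = \<epsilon>\<^sup>2" unfolding e by (metis real_sqrt_eq_iff sq)
    also have "\<dots> \<longleftrightarrow> ln (d ^ k / g) = ln (\<epsilon>\<^sup>2)" using pos[of k] \<epsilon> by (simp only: ln_inj_iff zero_less_power)
    also have "\<dots> \<longleftrightarrow> real k * ln d = 2 * ln \<epsilon> + ln g" unfolding lnk lne by linarith
    also have "\<dots> \<longleftrightarrow> x = real k" unfolding x_def using ld by (auto simp: divide_eq_eq)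
    finally show ?thesis .
  qed
  moreover have "limit_time l \<epsilon> d = \<lceil>x\<rceil>" by (simp add: limit_time_def x_def g_def)
  ultimately show ?thesis using that by blast
qed

theorem theorem3p3:
  fixes \<beta> l :: nat and d \<epsilon> :: real
    and M :: "nat \<Rightarrow> 'a measure"
    and X W :: "nat \<Rightarrow> 'a \<Rightarrow> complex Matrix.mat"
    and b :: "nat \<Rightarrow> 'a \<Rightarrow> complex Matrix.vec"
  assumes beta: "\<beta> \<in> {1, 2}"
    and d: "0 < d" "d < 1"
    and ell: "l \<in> {1, 2}"
    and eps: "0 < \<epsilon>"
    and prob: "\<And>n. n \<ge> 1 \<Longrightarrow> prob_space (M n)"
    and gauss: "\<And>n. n \<ge> 1 \<Longrightarrow> std_gaussian_matrix (M n) \<beta> n (wishart_cols d n) (X n)"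
    and W: "\<And>n \<omega>. n \<ge> 1 \<Longrightarrow> \<omega> \<in> space (M n) \<Longrightarrow> W n \<omega> = wishart \<beta> (wishart_cols d n) (X n \<omega>)"
    and b_vec: "\<And>n \<omega>. n \<ge> 1 \<Longrightarrow> \<omega> \<in> space (M n) \<Longrightarrow>
                  b n \<omega> \<in> carrier_vec n \<and> (\<forall>i<n. b n \<omega> $ i \<in> scalars \<beta>)"
    and b_norm: "\<And>n. n \<ge> 1 \<Longrightarrow> AE \<omega> in M n. norm2 (b n \<omega>) = 1"
    and indep: "\<And>n. n \<ge> 1 \<Longrightarrow> indep_mat_vec (M n) n (W n) (b n)"
  shows
    "(\<epsilon> < limit_error l 0 d \<longleftrightarrow> (if l = 1 then \<epsilon>\<^sup>2 < inverse (1 - d) else \<epsilon> < 1)) \<and>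
     ((\<forall>k. \<epsilon> \<noteq> limit_error l k d) \<and> \<epsilon> < limit_error l 0 d \<longrightarrow>
        (\<lambda>n. measure (M n) {\<omega> \<in> space (M n).
            int (halting_time l (scalars \<beta>) \<epsilon> (W n \<omega>) (b n \<omega>)) = limit_time l \<epsilon> d})
          \<longlonglongrightarrow> 1) \<and>
     (\<forall>k>0. \<epsilon> = limit_error l k d \<longrightarrow>
        int k = limit_time l \<epsilon> d \<and>
        (\<lambda>n. measure (M n) {\<omega> \<in> space (M n).
            int (halting_time l (scalars \<beta>) \<epsilon> (W n \<omega>) (b n \<omega>)) = limit_time l \<epsilon> d \<or>
            int (halting_time l (scalars \<beta>) \<epsilon> (W n \<omega>) (b n \<omega>)) = limit_time l \<epsilon> d + 1})
          \<longlonglongrightarrow> 1)"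
proof -
  interpret wishart_beta \<beta> by standard (rule beta)
  note cols = wishart_cols_limits[OF d]
  have sys: "\<forall>\<^sub>F n in sequentially. wishart_system (M n) n (wishart_cols d n) (X n) (W n) (b n)"
    using eventually_ge_at_top[of 1]
  proof eventually_elim
    case (elim n)
    have "b n \<omega> \<in> carrier_vec n \<and> vec_in K (b n \<omega>)" if "\<omega> \<in> space (M n)" for \<omega>
      using b_vec[OF elim that] carrier_vecD[of "b n \<omega>" n] by (auto simp: vec_in_def)
    then show ?case
      using elim prob[OF elim] gauss[OF elim] W[OF elim] b_norm[OF elim] indep[OF elim] cols(3)[of n]
      by (auto simp: wishart_system_def)
  qed
  have lim: "size_limit l k d = limit_error l k d" for k
    by (simp add: size_limit_def limit_error_eq[OF d ell])
  obtain x where x: "limit_time l \<epsilon> d = \<lceil>x\<rceil>" "\<And>k. limit_error l k d < \<epsilon> \<longleftrightarrow> x < real k"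
    "\<And>k. limit_error l k d = \<epsilon> \<longleftrightarrow> x = real k"
    using limit_error_compare[OF d ell eps] by blast
  note tendsto = halting_time_tendsto[OF d ell sys cols(1,2), unfolded lim]
  have "\<epsilon> < limit_error l 0 d \<longleftrightarrow> (if l = 1 then \<epsilon>\<^sup>2 < inverse (1 - d) else \<epsilon> < 1)"
  proof -
    have lt: "\<epsilon> < sqrt y \<longleftrightarrow> \<epsilon>\<^sup>2 < y" for y
      using eps real_sqrt_less_iff[of "\<epsilon>\<^sup>2" y] by simp
    show ?thesis
      using lt[of "1 / (1 - d)"] by (simp add: limit_error_eq[OF d ell] inverse_eq_divide)
  qed
  moreover have "(\<lambda>n. measure (M n) {\<omega> \<in> space (M n).
            int (halting_time l (scalars \<beta>) \<epsilon> (W n \<omega>) (b n \<omega>)) = limit_time l \<epsilon> d}) \<longlonglongrightarrow> 1"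
    if ne: "\<forall>k. \<epsilon> \<noteq> limit_error l k d" and lt: "\<epsilon> < limit_error l 0 d"
  proof -
    have x0: "0 < x" using lt x(2,3)[of 0] by auto
    have xn: "x \<noteq> real k" for k using ne x(3)[of k] by auto
    \<comment> \<open>\<open>\<tau>\<close> is the first step after the crossing; as
      \<open>x\<close> is not a natural number here, \<open>x < real k\<close> and
      \<open>\<tau> \<le> k\<close> agree.\<close>
    define \<tau> where "\<tau> = nat \<lceil>x\<rceil>"
    have t: "int \<tau> = \<lceil>x\<rceil>" using x0 by (simp add: \<tau>_def)
    have xt: "x < real k \<longleftrightarrow> \<tau> \<le> k" for k
    proof -
      have "\<tau> \<le> k \<longleftrightarrow> x \<le> real k" using t by (metis ceiling_le_iff of_int_of_nat_eq of_nat_le_iff)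
      then show ?thesis using xn[of k] by auto
    qed
    show ?thesis
      unfolding x(1) t[symmetric]
    \<comment> \<open>The steps up to \<open>\<tau>\<close> decide the minimum: all but the last
      have limits above \<epsilon>.\<close>
    proof (rule tendsto[where J = "{..\<tau>}"])
      fix s :: "nat \<Rightarrow> real" assume s': "\<And>k. k \<in> {..\<tau>} \<Longrightarrow> s k < \<epsilon> \<longleftrightarrow> limit_error l k d < \<epsilon>"
      note s = s'[unfolded x(2)]
      have "(LEAST k. s k < \<epsilon>) = \<tau>"
      proof (rule Least_equality)
        show "s \<tau> < \<epsilon>" using s[of \<tau>] xt by simp
        show "\<tau> \<le> k" if "s k < \<epsilon>" for k using that s[of k] xt[of k] by (cases "k \<le> \<tau>") auto
      qed
      then show "int (LEAST k. s k < \<epsilon>) = int \<tau>" by simp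
    qed (use ne in \<open>auto simp: eq_commute\<close>)
  qed
  moreover have "int k = limit_time l \<epsilon> d \<and>
        (\<lambda>n. measure (M n) {\<omega> \<in> space (M n).
            int (halting_time l (scalars \<beta>) \<epsilon> (W n \<omega>) (b n \<omega>)) = limit_time l \<epsilon> d \<or>
            int (halting_time l (scalars \<beta>) \<epsilon> (W n \<omega>) (b n \<omega>)) = limit_time l \<epsilon> d + 1}) \<longlonglongrightarrow> 1"
    if k: "0 < k" and eq: "\<epsilon> = limit_error l k d" for k
  proof
    have xk: "x = real k" using x(3)[of k] eq by simp
    show t: "int k = limit_time l \<epsilon> d" unfolding x(1) xk by simp
    show "(\<lambda>n. measure (M n) {\<omega> \<in> space (M n).
            int (halting_time l (scalars \<beta>) \<epsilon> (W n \<omega>) (b n \<omega>)) = limit_time l \<epsilon> d \<or>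
            int (halting_time l (scalars \<beta>) \<epsilon> (W n \<omega>) (b n \<omega>)) = limit_time l \<epsilon> d + 1}) \<longlonglongrightarrow> 1"
      unfolding t[symmetric]
    \<comment> \<open>Step \<open>k\<close> is left out because its limit equals \<epsilon>. Earlier
      limits lie above \<epsilon> and that of step \<open>k + 1\<close> below, so the minimum is
      \<open>k\<close> or \<open>k + 1\<close>.\<close>
    proof (rule tendsto[where J = "{..<k} \<union> {Suc k}"])
      fix s :: "nat \<Rightarrow> real" assume s': "\<And>j. j \<in> {..<k} \<union> {Suc k} \<Longrightarrow> s j < \<epsilon> \<longleftrightarrow> limit_error l j d < \<epsilon>"
      note s = s'[unfolded x(2)]
      have "s (Suc k) < \<epsilon>" using s[of "Suc k"] xk by simp
      then have "(LEAST j. s j < \<epsilon>) \<le> Suc k" "s (LEAST j. s j < \<epsilon>) < \<epsilon>" by (rule Least_le, rule LeastI)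
      moreover have "\<not> s j < \<epsilon>" if "j < k" for j using s[of j] that xk by simp
      ultimately have "(LEAST j. s j < \<epsilon>) = k \<or> (LEAST j. s j < \<epsilon>) = Suc k"
        by (metis le_SucE le_neq_implies_less)
      then show "int (LEAST j. s j < \<epsilon>) = int k \<or> int (LEAST j. s j < \<epsilon>) = int k + 1" by auto
    next
      show "limit_error l j d \<noteq> \<epsilon>" if "j \<in> {..<k} \<union> {Suc k}" for j using that x(3)[of j] xk by auto
    qed auto
  qed
  ultimately show ?thesis by blast
qed

end
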